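(* Let $\mathbb{K}$ be a number field, let $\varphi\in\mathbb{K}(X)$ be a rational function of degree $d\ge 2$ which is not of the form $\beta X^{d}$ or $\beta X^{-d}$ with $\beta\in\mathbb{K}^*$, and let $\alpha\in\overline{\mathbb{Q}}$ be an algebraic number which is not a root of unity and is not a preperiodic point of $\varphi$. Then there are only finitely many positive integers $n$ such that $\alpha$ and $\varphi^{(n)}(\alpha)$ are multiplicatively dependent.
   Context: The degree of $\varphi=f/g$ ($f,g\in\mathbb{K}[X]$ coprime) is $\max\{\deg f,\deg g\}$. Iterates: $\varphi^{(0)}=X$, $\varphi^{(n)}=\varphi(\varphi^{(n-1)})$; $\varphi^{(n)}(\alpha)$ denotes the $n$-th element of the orbit $u_0=\alpha$, $u_n=\varphi(u_{n-1})$ (defined as long as no earlier element is a pole of $\varphi$). A point $\alpha$ is periodic for $\varphi$ if $\varphi^{(n)}(\alpha)=\alpha$ for some $n\ge1$, and preperiodic if $\varphi^{(m)}(\alpha)$ is periodic for some $m\ge1$. Two complex numbers $x,y$ are multiplicatively dependent if both are non-zero and $x^{k}y^{\ell}=1$ for some integers $k,\ell$ not both zero. *)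

theory Defs
  imports Complex_Main "HOL-Computational_Algebra.Computational_Algebra"
    "HOL-Computational_Algebra.Field_as_Ring"
begin

interpretation rat_vs: vector_space "\<lambda>(q::rat) (z::complex). of_rat q * z"
  by unfold_locales (simp_all add: algebra_simps of_rat_add of_rat_mult)

definition number_field :: "complex set \<Rightarrow> bool" where
  "number_field K \<longleftrightarrow>
     0 \<in> K \<and> 1 \<in> K \<and>
     (\<forall>x\<in>K. \<forall>y\<in>K. x + y \<in> K \<and> x * y \<in> K) \<and>
     (\<forall>x\<in>K. - x \<in> K \<and> inverse x \<in> K) \<and>
     (\<exists>B. finite B \<and> B \<subseteq> K \<and> rat_vs.span B = K)"

definition polys_over :: "complex set \<Rightarrow> complex poly set" where
  "polys_over K = {p. \<forall>i. coeff p i \<in> K}"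

text \<open>
  The function field \<open>K(X)\<close>, as a subfield of \<open>\<complex>(X)\<close>.
\<close>
definition ratfuns_over :: "complex set \<Rightarrow> complex poly fract set" where
  "ratfuns_over K = {Fract f g |f g. f \<in> polys_over K \<and> g \<in> polys_over K \<and> g \<noteq> 0}"

text \<open>
  \<^const>\<open>quot_of_fract\<close> yields the coprime pair with monic denominator. Any other coprime
  pair representing the same rational function differs from it by a constant factor, so the notions
  below agree with those read off from an arbitrary representation in lowest terms; see
  \<open>rat_degree_Fract\<close>, \<open>rat_pole_Fract\<close> and \<open>rat_eval_Fract\<close>.
\<close>
definition rat_num :: "complex poly fract \<Rightarrow> complex poly" where
  "rat_num \<phi> = fst (quot_of_fract \<phi>)"

definition rat_den :: "complex poly fract \<Rightarrow> complex poly" where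
  "rat_den \<phi> = snd (quot_of_fract \<phi>)"

definition rat_degree :: "complex poly fract \<Rightarrow> nat" where
  "rat_degree \<phi> = max (degree (rat_num \<phi>)) (degree (rat_den \<phi>))"

definition rat_pole :: "complex poly fract \<Rightarrow> complex \<Rightarrow> bool" where
  "rat_pole \<phi> z \<longleftrightarrow> poly (rat_den \<phi>) z = 0"

definition rat_eval :: "complex poly fract \<Rightarrow> complex \<Rightarrow> complex" where
  "rat_eval \<phi> z = poly (rat_num \<phi>) z / poly (rat_den \<phi>) z"

lemma rat_num_den_Fract:
  assumes "coprime f g" "g \<noteq> 0"
  obtains c where "c \<noteq> 0" "f = smult c (rat_num (Fract f g))" "g = smult c (rat_den (Fract f g))"
proof -
  have q: "quot_of_fract (Fract f g) = normalize_quot (f, g)"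
    using quot_of_fract_quot_to_fract[of "(f, g)"] by (simp add: quot_to_fract_def)
  obtain e where e: "f = rat_num (Fract f g) * e" "g = rat_den (Fract f g) * e" "e dvd f" "e dvd g"
    unfolding rat_num_def rat_den_def q using normalize_quotE[OF assms(2), of f] by metis
  have "is_unit e" using assms(1) e(3,4) by (rule coprime_common_divisor)
  then obtain c where "e = [:c:]" "c \<noteq> 0" by (metis is_unit_polyE dvd_0_left_iff zero_neq_one)
  with e that show thesis by simp
qed

lemma rat_degree_Fract:
  assumes "coprime f g" "g \<noteq> 0"
  shows "rat_degree (Fract f g) = max (degree f) (degree g)"
  by (rule rat_num_den_Fract[OF assms]) (metis rat_degree_def degree_smult_eq)

lemma rat_pole_Fract:
  assumes "coprime f g" "g \<noteq> 0"
  shows "rat_pole (Fract f g) z \<longleftrightarrow> poly g z = 0"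
  by (rule rat_num_den_Fract[OF assms]) (metis rat_pole_def poly_smult mult_eq_0_iff)

lemma rat_eval_Fract:
  assumes "coprime f g" "g \<noteq> 0"
  shows "rat_eval (Fract f g) z = poly f z / poly g z"
  by (rule rat_num_den_Fract[OF assms]) (metis rat_eval_def poly_smult mult_divide_mult_cancel_left)

text \<open>
  The orbit is \<^const>\<open>None\<close> from the point on where an earlier element is a pole.
\<close>
primrec rat_orbit :: "complex poly fract \<Rightarrow> complex \<Rightarrow> nat \<Rightarrow> complex option" where
  "rat_orbit \<phi> \<alpha> 0 = Some \<alpha>"
| "rat_orbit \<phi> \<alpha> (Suc n) =
     (case rat_orbit \<phi> \<alpha> n of
        None \<Rightarrow> None
      | Some z \<Rightarrow> if rat_pole \<phi> z then None else Some (rat_eval \<phi> z))"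

definition rat_periodic :: "complex poly fract \<Rightarrow> complex \<Rightarrow> bool" where
  "rat_periodic \<phi> \<alpha> \<longleftrightarrow> (\<exists>n\<ge>1. rat_orbit \<phi> \<alpha> n = Some \<alpha>)"

definition rat_preperiodic :: "complex poly fract \<Rightarrow> complex \<Rightarrow> bool" where
  "rat_preperiodic \<phi> \<alpha> \<longleftrightarrow> (\<exists>m\<ge>1. \<exists>z. rat_orbit \<phi> \<alpha> m = Some z \<and> rat_periodic \<phi> z)"

definition mult_dependent :: "complex \<Rightarrow> complex \<Rightarrow> bool" where
  "mult_dependent x y \<longleftrightarrow>
     x \<noteq> 0 \<and> y \<noteq> 0 \<and>
     (\<exists>k l :: int. \<not> (k = 0 \<and> l = 0) \<and> x powi k * y powi l = 1)"

end

theory Submission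
  imports Defs "HOL-Library.FuncSet"
begin

text \<open>
  If \<open>\<alpha>\<close> and \<open>u\<^sub>n = \<phi>\<^sup>(\<^sup>n\<^sup>)(\<alpha>)\<close> are multiplicatively dependent, then \<open>u\<^sub>n\<close> is an \<open>S\<close>-unit for a finite set \<open>S\<close> of
  primes that does not depend on \<open>n\<close>. Since \<open>\<phi>\<close> is not a monomial, \<open>\<phi>\<close> or \<open>\<phi>\<^sup>(\<^sup>2\<^sup>)\<close> has at least three zeros and poles
  on the projective line, and \<open>u\<^sub>n\<^sub>-\<^sub>1\<close> or \<open>u\<^sub>n\<^sub>-\<^sub>2\<close> is \<open>S\<close>-integral with respect to them. A cross ratio turns these points
  into solutions of the \<open>S\<close>-unit equation \<open>x + y = 1\<close>, of which there are finitely many; but the orbit is infinite.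

  For the unit equation we follow Beukers and Schlickewei: explicit Pade approximants show that two solutions of large
  and very different heights cannot be nearly proportional in the space of logarithms of absolute values, and this
  space has finite dimension.
\<close>

section \<open>Pade approximation\<close>

text \<open>\<open>K\<close> only makes the coefficients of \<phi> algebraic. The arithmetic takes
  place in a field \<open>rat_adjoin \<theta>\<close> chosen later so that it contains the orbit and
  all zeros and poles in question; the second iterate gets a field of its own. Places are encoded as
  pairs of an embedding and a place of \<rat>, so one place may be counted several times. This does
  no harm: the unit equation needs only finitely many absolute values whose product is at least 1 on
  nonzero S-integers, and finiteness of bounded sets of S-integers. The first comes from norms and
  the product formula over \<rat>, the second from characteristic polynomials; neither ideals nor
  Dirichlet's unit theorem enter. The exponent of \<open>u\<^sub>n\<close> in a dependence relation
  is nonzero because \<alpha> is not a root of unity, so S-integrality conditions pass from \<alpha>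
  to \<open>u\<^sub>n\<close>. The obstacle is that two zeros and poles do not suffice: they allow
  infinitely many solutions as soon as there are infinitely many S-units. This is why monomials are
  excluded and why a second step of the orbit is needed.\<close>

definition int01 :: "complex poly \<Rightarrow> complex" where
  "int01 p = (\<Sum>k\<le>degree p. coeff p k / of_nat (Suc k))"

lemma int01_eq:
  assumes "degree p \<le> n"
  shows "int01 p = (\<Sum>k\<le>n. coeff p k / of_nat (Suc k))"
  unfolding int01_def using assms
  by (intro sum.mono_neutral_left) (auto simp: coeff_eq_0)

lemma int01_add: "int01 (p + q) = int01 p + int01 q"
proof -
  define n where "n = max (degree p) (degree q)"
  have "degree (p + q) \<le> n" "degree p \<le> n" "degree q \<le> n"
    by (auto simp: n_def degree_add_le_max)
  thus ?thesis by (simp add: int01_eq[of _ n] sum.distrib add_divide_distrib)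
qed

lemma int01_smult: "int01 (smult c p) = c * int01 p"
  by (simp add: int01_eq[of _ "degree p"] degree_smult_le sum_distrib_left)

lemma int01_0 [simp]: "int01 0 = 0"
  by (simp add: int01_def)

lemma int01_sum: "int01 (\<Sum>i\<in>A. f i) = (\<Sum>i\<in>A. int01 (f i))"
  by (induction A rule: infinite_finite_induct) (auto simp: int01_add)

text \<open>The fundamental theorem of calculus for the integral over [0, 1]. Reading the integral
  off the coefficients allows the complex break points of \<open>int01_split\<close> without path
  integrals.\<close>

lemma int01_pderiv: "int01 (pderiv q) = poly q 1 - poly q 0"
proof -
  have "degree (pderiv q) \<le> degree q" by (simp add: degree_pderiv)
  hence "int01 (pderiv q) = (\<Sum>k\<le>degree q. coeff q (Suc k))"
    by (simp add: int01_eq[of _ "degree q"] coeff_pderiv del: of_nat_Suc)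
  also have "\<dots> = (\<Sum>k\<le>Suc (degree q). coeff q k) - coeff q 0"
    by (subst sum.atMost_Suc_shift) simp
  also have "(\<Sum>k\<le>Suc (degree q). coeff q k) = poly q 1"
    by (simp add: poly_altdef coeff_eq_0)
  finally show ?thesis by (simp add: poly_0_coeff_0)
qed

lemma pderiv_sum: "pderiv (\<Sum>i\<in>A. f i) = (\<Sum>i\<in>A. pderiv (f i))"
  by (induction A rule: infinite_finite_induct) (auto simp: pderiv_add)

lemma pcompose_power: "(p ^ n) \<circ>\<^sub>p q = (p \<circ>\<^sub>p q) ^ n"
  for p :: "'a::comm_ring_1 poly"
  by (induction n) (simp_all add: pcompose_mult, metis one_pCons pcompose_const)

lemma pderiv_surj: "\<exists>q::complex poly. pderiv q = p"
proof
  show "pderiv (\<Sum>k\<le>degree p. monom (coeff p k / of_nat (Suc k)) (Suc k)) = p"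
    by (simp add: pderiv_sum pderiv_monom poly_as_sum_of_monoms del: of_nat_Suc)
qed

text \<open>With a primitive \<open>q\<close> of \<open>p\<close> the left side telescopes:
  \<open>q x - q 0\<close> plus \<open>q 1 - q x\<close>. The maps \<open>[:0, x:]\<close> and
  \<open>[:1, x - 1:]\<close> carry [0, 1] to the segments from 0 to x and from 1 to x.\<close>

lemma int01_split:
  "x * int01 (p \<circ>\<^sub>p [:0, x:]) + (1 - x) * int01 (p \<circ>\<^sub>p [:1, x - 1:]) = int01 p"
proof -
  obtain q where q: "pderiv q = p" using pderiv_surj by blast
  have aff: "(b - a) * int01 (p \<circ>\<^sub>p [:a, b - a:]) = poly q b - poly q a" for a b
  proof -
    have "pderiv (q \<circ>\<^sub>p [:a, b - a:]) = smult (b - a) (p \<circ>\<^sub>p [:a, b - a:])"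
      by (simp add: pderiv_pcompose q pderiv_pCons mult.commute)
    hence "(b - a) * int01 (p \<circ>\<^sub>p [:a, b - a:]) = int01 (pderiv (q \<circ>\<^sub>p [:a, b - a:]))"
      by (simp add: int01_smult)
    thus ?thesis by (simp add: int01_pderiv poly_pcompose)
  qed
  have "int01 p = poly q 1 - poly q 0" using q int01_pderiv by metis
  moreover have "x * int01 (p \<circ>\<^sub>p [:0, x:]) = poly q x - poly q 0" using aff[of x 0] by simp
  moreover have "(1 - x) * int01 (p \<circ>\<^sub>p [:1, x - 1:]) = poly q 1 - poly q x"
    using aff[of x 1] by (metis minus_diff_eq mult_minus_left)
  ultimately show ?thesis by simp
qed

text \<open>Integration by parts: the derivative of \<open>X ^ (m+1) * (1-X) ^ (n+1)\<close> has
  integral 0, which trades a factor \<open>1 - X\<close> for a factor \<open>X\<close>. Hence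
  \<open>m\<close> is generalised in the induction on \<open>n\<close>.\<close>

lemma int01_beta:
  "int01 ([:0, 1:] ^ m * [:1, -1:] ^ n) = fact m * fact n / fact (m + n + 1)"
proof (induction n arbitrary: m)
  case 0
  have "int01 (monom 1 m) = (1 / of_nat (Suc m) :: complex)"
    by (simp add: int01_def degree_monom_eq sum.delta if_distrib[of "\<lambda>x. x / _"] cong: if_cong)
  moreover have "fact m / fact (m + 1) = (1 / of_nat (Suc m) :: complex)"
    by (simp only: Suc_eq_plus1 [symmetric] fact_Suc) simp
  ultimately show ?case by (simp add: monom_altdef)
next
  case (Suc n)
  have pd1: "pderiv ([:0, 1:] ^ Suc m :: complex poly) = smult (of_nat (Suc m)) ([:0, 1:] ^ m)" for m
    by (simp add: pderiv_power_Suc pderiv_pCons del: power_Suc)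
  have pd2: "pderiv ([:1, -1:] ^ Suc n :: complex poly) = smult (- of_nat (Suc n)) ([:1, -1:] ^ n)"
    by (simp add: pderiv_power_Suc pderiv_pCons del: power_Suc)
  have "pderiv ([:0, 1:] ^ Suc m * [:1, -1:] ^ Suc n) =
     smult (of_nat (Suc m)) ([:0, 1:] ^ m * [:1, -1:] ^ Suc n)
     + smult (- of_nat (Suc n)) ([:0, 1:] ^ Suc m * [:1, -1:] ^ n :: complex poly)"
    by (simp only: pderiv_mult pd1 pd2) (simp add: mult_ac)
  moreover have "int01 (pderiv ([:0, 1:] ^ Suc m * [:1, -1:] ^ Suc n)) = 0"
    by (simp only: int01_pderiv poly_mult poly_power) simp
  ultimately have "of_nat (Suc m) * int01 ([:0, 1:] ^ m * [:1, -1:] ^ Suc n)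
      + (- of_nat (Suc n)) * int01 ([:0, 1:] ^ Suc m * [:1, -1:] ^ n) = 0"
    by (simp only: int01_add int01_smult)
  hence "of_nat (Suc m) * int01 ([:0, 1:] ^ m * [:1, -1:] ^ Suc n)
      = of_nat (Suc n) * int01 ([:0, 1:] ^ Suc m * [:1, -1:] ^ n)"
    by (simp only: mult_minus_left add_eq_0_iff2 minus_minus)
  hence "of_nat (Suc m) * int01 ([:0, 1:] ^ m * [:1, -1:] ^ Suc n)
      = of_nat (Suc n) * (fact (Suc m) * fact n / fact (m + Suc n + 1))"
    unfolding Suc by simp
  also have "\<dots> = of_nat (Suc m) * (fact m * fact (Suc n) / fact (m + Suc n + 1))"
    by (simp only: fact_Suc) simp
  finally show ?case by (simp only: mult_cancel_left of_nat_eq_0_iff) simp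
qed

text \<open>
  These are the coefficients of \<open>\<integral>\<^sub>0\<^sup>1 s\<^sup>a (1 - s)\<^sup>c (1 - x s)\<^sup>b ds\<close> as a polynomial in \<open>-x\<close>, scaled by
  \<open>(a + b + c + 1)! / (a! b! c!)\<close>, which makes them integers.
\<close>
definition pade_coeff :: "nat \<Rightarrow> nat \<Rightarrow> nat \<Rightarrow> nat \<Rightarrow> nat" where
  "pade_coeff a b c k = (if k \<le> b then ((a + k) choose k) * ((a + b + c + 1) choose (b - k)) else 0)"

definition pade_scale :: "nat \<Rightarrow> nat \<Rightarrow> nat \<Rightarrow> complex" where
  "pade_scale a b c = fact (a + b + c + 1) / (fact a * fact b * fact c)"

lemma pade_coeff_beta:
  assumes "k \<le> b"
  shows "pade_scale a b c * (of_nat (b choose k) * (fact (a + k) * fact c / fact (a + k + c + 1)))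
     = of_nat (pade_coeff a b c k)"
proof -
  have "of_nat (b choose k) = (fact b / (fact k * fact (b - k)) :: complex)"
    using assms by (simp add: binomial_fact)
  moreover have "of_nat ((a + k) choose k) = (fact (a + k) / (fact k * fact a) :: complex)"
    by (simp add: binomial_fact)
  moreover have "of_nat ((a + b + c + 1) choose (b - k))
     = (fact (a + b + c + 1) / (fact (b - k) * fact (a + k + c + 1)) :: complex)"
    using assms by (subst binomial_fact) (auto simp: algebra_simps)
  ultimately show ?thesis using assms
    by (simp only: pade_coeff_def pade_scale_def if_True of_nat_mult) (simp add: divide_simps mult_ac)
qed

text \<open>Expanding the power of \<open>1 - x s\<close> by the binomial theorem leaves Beta
  integrals.\<close>

lemma pade_num:
  "pade_scale a b c * int01 ([:0, 1:] ^ a * [:1, -1:] ^ c * [:1, -x:] ^ b)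
     = (\<Sum>k\<le>b. of_nat (pade_coeff a b c k) * (-1) ^ k * x ^ k)"
proof -
  have "[:1, -x:] = [:0, -x:] + (1 :: complex poly)" by (simp add: one_pCons)
  hence "[:1, -x:] ^ b = (\<Sum>k\<le>b. of_nat (b choose k) * [:0, -x:] ^ k * 1 ^ (b - k))"
    by (simp only: binomial_ring)
  also have "\<dots> = (\<Sum>k\<le>b. smult (of_nat (b choose k) * (-x) ^ k) ([:0, 1:] ^ k))"
  proof (intro sum.cong refl)
    fix k
    have "[:0, -x:] ^ k = smult ((-x) ^ k) ([:0, 1:] ^ k)"
      by (subst smult_power [symmetric]) simp
    thus "of_nat (b choose k) * [:0, -x:] ^ k * 1 ^ (b - k)
       = smult (of_nat (b choose k) * (-x) ^ k) ([:0, 1:] ^ k)"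
      by (simp add: of_nat_poly mult.commute)
  qed
  finally have "[:0, 1:] ^ a * [:1, -1:] ^ c * [:1, -x:] ^ b =
    (\<Sum>k\<le>b. smult (of_nat (b choose k) * (-x) ^ k) ([:0, 1:] ^ (a + k) * [:1, -1:] ^ c))"
    by (simp add: sum_distrib_left power_add mult_ac)
  hence "pade_scale a b c * int01 ([:0, 1:] ^ a * [:1, -1:] ^ c * [:1, -x:] ^ b) =
    (\<Sum>k\<le>b. (pade_scale a b c * (of_nat (b choose k) * (fact (a + k) * fact c / fact (a + k + c + 1))))
       * (-x) ^ k)"
    by (simp only: int01_sum int01_smult int01_beta) (simp add: sum_distrib_left mult_ac)
  also have "\<dots> = (\<Sum>k\<le>b. of_nat (pade_coeff a b c k) * (-x) ^ k)"
    by (intro sum.cong refl, subst pade_coeff_beta) auto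
  finally show ?thesis by (simp add: power_minus[of x] mult.assoc)
qed

text \<open>Here it is the power of \<open>x - s\<close> that is expanded, so \<open>b\<close> and
  \<open>c\<close> exchange places in the coefficients.\<close>

lemma pade_den:
  "pade_scale a b c * int01 ([:0, 1:] ^ a * [:1, -1:] ^ b * [:x, -1:] ^ c)
     = (\<Sum>k\<le>c. of_nat (pade_coeff a c b k) * (-1) ^ k * x ^ (c - k))"
proof -
  have "[:x, -1:] = [:0, -1:] + [:x:]" by simp
  hence "[:x, -1:] ^ c = (\<Sum>k\<le>c. of_nat (c choose k) * [:0, -1:] ^ k * [:x:] ^ (c - k))"
    by (simp only: binomial_ring)
  also have "\<dots> = (\<Sum>k\<le>c. smult (of_nat (c choose k) * (-1) ^ k * x ^ (c - k)) ([:0, 1:] ^ k))"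
  proof (intro sum.cong refl)
    fix k
    have "[:0, -1:] ^ k = smult ((-1) ^ k) ([:0, 1:] ^ k :: complex poly)"
      by (subst smult_power [symmetric]) simp
    thus "of_nat (c choose k) * [:0, -1:] ^ k * [:x:] ^ (c - k)
       = smult (of_nat (c choose k) * (-1) ^ k * x ^ (c - k)) ([:0, 1:] ^ k)"
      by (simp add: of_nat_poly poly_const_pow mult_ac)
  qed
  finally have "[:0, 1:] ^ a * [:1, -1:] ^ b * [:x, -1:] ^ c =
    (\<Sum>k\<le>c. smult (of_nat (c choose k) * (-1) ^ k * x ^ (c - k)) ([:0, 1:] ^ (a + k) * [:1, -1:] ^ b))"
    by (simp add: sum_distrib_left power_add mult_ac)
  hence "pade_scale a b c * int01 ([:0, 1:] ^ a * [:1, -1:] ^ b * [:x, -1:] ^ c) =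
    (\<Sum>k\<le>c. (pade_scale a c b * (of_nat (c choose k) * (fact (a + k) * fact b / fact (a + k + b + 1))))
       * (-1) ^ k * x ^ (c - k))"
    by (simp only: int01_sum int01_smult int01_beta) (simp add: sum_distrib_left pade_scale_def add_ac mult_ac)
  also have "\<dots> = (\<Sum>k\<le>c. of_nat (pade_coeff a c b k) * (-1) ^ k * x ^ (c - k))"
    by (intro sum.cong refl, subst pade_coeff_beta) auto
  finally show ?thesis .
qed

text \<open>
  The integral of \<open>t\<^sup>a (1 - t)\<^sup>b (x - t)\<^sup>c\<close> over \<open>[0, 1]\<close> is split at \<open>t = x\<close>; the substitutions
  \<open>t = x s\<close> and \<open>t = 1 - (1 - x) s\<close> produce the two powers on the left.
\<close>
lemma pade_identity:
  fixes x :: complex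
  shows "x ^ (a + c + 1) * (\<Sum>k\<le>b. of_nat (pade_coeff a b c k) * (-1) ^ k * x ^ k)
    + (1 - x) ^ (b + c + 1) * ((-1) ^ c * (\<Sum>k\<le>a. of_nat (pade_coeff b a c k) * (-1) ^ k * (1 - x) ^ k))
    = (\<Sum>k\<le>c. of_nat (pade_coeff a c b k) * (-1) ^ k * x ^ (c - k))"
proof -
  define p where "p = [:0, 1:] ^ a * [:1, -1:] ^ b * [:x, -1:] ^ c"
  have pow: "smult u q ^ n = smult (u ^ n) (q ^ n)" for u :: complex and q n
    by (simp add: smult_power)
  have "p \<circ>\<^sub>p [:0, x:] = (smult x [:0, 1:]) ^ a * [:1, -x:] ^ b * (smult x [:1, -1:]) ^ c"
    by (simp add: p_def pcompose_mult pcompose_power pcompose_pCons)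
  also have "\<dots> = smult (x ^ (a + c)) ([:0, 1:] ^ a * [:1, -1:] ^ c * [:1, -x:] ^ b)"
    by (simp only: pow) (simp add: power_add mult_ac)
  finally have 1: "p \<circ>\<^sub>p [:0, x:] = \<dots>" .
  have "p \<circ>\<^sub>p [:1, x - 1:] = [:1, -(1-x):] ^ a * (smult (1 - x) [:0, 1:]) ^ b * (smult (-1 * (1 - x)) [:1, -1:]) ^ c"
    by (simp add: p_def pcompose_mult pcompose_power pcompose_pCons)
  also have "\<dots> = smult ((1 - x) ^ (b + c) * (-1) ^ c) ([:0, 1:] ^ b * [:1, -1:] ^ c * [:1, -(1-x):] ^ a)"
    by (simp only: pow power_mult_distrib) (simp add: power_add mult_ac)
  finally have 2: "p \<circ>\<^sub>p [:1, x - 1:] = \<dots>" .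
  have "x ^ (a + c + 1) * int01 ([:0, 1:] ^ a * [:1, -1:] ^ c * [:1, -x:] ^ b)
      + (1 - x) ^ (b + c + 1) * (-1) ^ c * int01 ([:0, 1:] ^ b * [:1, -1:] ^ c * [:1, -(1-x):] ^ a) = int01 p"
    using int01_split[of x p] unfolding 1 2 int01_smult by (simp add: mult_ac)
  hence "x ^ (a + c + 1) * (pade_scale a b c * int01 ([:0, 1:] ^ a * [:1, -1:] ^ c * [:1, -x:] ^ b))
      + (1 - x) ^ (b + c + 1) * (-1) ^ c * (pade_scale a b c * int01 ([:0, 1:] ^ b * [:1, -1:] ^ c * [:1, -(1-x):] ^ a))
      = pade_scale a b c * int01 p"
    by (metis (no_types, lifting) distrib_left mult.left_commute)
  moreover have "pade_scale a b c = pade_scale b a c" by (simp add: pade_scale_def add_ac mult_ac)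
  hence "pade_scale a b c * int01 ([:0, 1:] ^ b * [:1, -1:] ^ c * [:1, -(1-x):] ^ a)
      = (\<Sum>k\<le>a. of_nat (pade_coeff b a c k) * (-1) ^ k * (1 - x) ^ k)"
    using pade_num[of b a c "1 - x"] by simp
  ultimately show ?thesis
    unfolding p_def by (simp only: pade_num pade_den) (simp only: mult.assoc)
qed

section \<open>Integral coefficient sequences and their size\<close>

definition int_eval :: "nat \<Rightarrow> (nat \<Rightarrow> int) \<Rightarrow> complex \<Rightarrow> complex" where
  "int_eval n a x = (\<Sum>k\<le>n. of_int (a k) * x ^ k)"

lemma int_eval_eq:
  assumes "b \<le> n" "\<And>k. k > b \<Longrightarrow> a k = 0"
  shows "int_eval n a x = (\<Sum>k\<le>b. of_int (a k) * x ^ k)"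
  unfolding int_eval_def using assms by (intro sum.mono_neutral_right) auto

lemma pade_coeff_le: "pade_coeff a b c k \<le> 2 ^ (a + b) * 2 ^ (a + b + c + 1)"
proof (cases "k \<le> b")
  case True
  have "(a + k) choose k \<le> 2 ^ (a + k)" by (rule binomial_le_pow2)
  also have "\<dots> \<le> 2 ^ (a + b)" using True by (intro power_increasing) auto
  finally have "(a + k) choose k \<le> 2 ^ (a + b)" .
  moreover have "(a + b + c + 1) choose (b - k) \<le> 2 ^ (a + b + c + 1)" by (rule binomial_le_pow2)
  ultimately show ?thesis using True unfolding pade_coeff_def by (simp only: if_True mult_le_mono)
qed (simp add: pade_coeff_def)

lemma pade_coeff_pos: "k \<le> b \<Longrightarrow> pade_coeff a b c k > 0"
  by (simp add: pade_coeff_def zero_less_binomial_iff del: binomial_Suc_Suc)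

definition padeA :: "nat \<Rightarrow> nat \<Rightarrow> nat \<Rightarrow> nat \<Rightarrow> int" where
  "padeA a b c k = (-1) ^ k * int (pade_coeff a b c k)"

definition padeB :: "nat \<Rightarrow> nat \<Rightarrow> nat \<Rightarrow> nat \<Rightarrow> int" where
  "padeB a b c k = (-1) ^ c * (-1) ^ k * int (pade_coeff b a c k)"

definition padeC :: "nat \<Rightarrow> nat \<Rightarrow> nat \<Rightarrow> nat \<Rightarrow> int" where
  "padeC a b c k = (if k \<le> c then (-1) ^ (c - k) * int (pade_coeff a c b (c - k)) else 0)"

lemma pade_identity':
  assumes "a \<le> n" "b \<le> n" "c \<le> n"
  shows "x ^ (a + c + 1) * int_eval n (padeA a b c) x + (1 - x) ^ (b + c + 1) * int_eval n (padeB a b c) (1 - x)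
     = int_eval n (padeC a b c) x"
proof -
  have A: "int_eval n (padeA a b c) x = (\<Sum>k\<le>b. of_nat (pade_coeff a b c k) * (-1) ^ k * x ^ k)"
    using assms by (subst int_eval_eq[of b]) (auto simp: padeA_def pade_coeff_def mult_ac intro!: sum.cong)
  have B: "int_eval n (padeB a b c) (1 - x)
     = (-1) ^ c * (\<Sum>k\<le>a. of_nat (pade_coeff b a c k) * (-1) ^ k * (1 - x) ^ k)"
    using assms by (subst int_eval_eq[of a])
      (auto simp: padeB_def pade_coeff_def sum_distrib_left mult_ac intro!: sum.cong)
  have "int_eval n (padeC a b c) x
     = (\<Sum>k\<le>c. of_nat (pade_coeff a c b (c - k)) * (-1) ^ (c - k) * x ^ k)"
    using assms by (subst int_eval_eq[of c])
      (auto simp: padeC_def mult_ac intro!: sum.cong)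
  also have "\<dots> = (\<Sum>k\<le>c. of_nat (pade_coeff a c b k) * (-1) ^ k * x ^ (c - k))"
    by (rule sum.reindex_bij_witness[of _ "\<lambda>k. c - k" "\<lambda>k. c - k"]) auto
  finally show ?thesis unfolding A B using pade_identity[of x a c b] by simp
qed

text \<open>Each coefficient is at most \<open>2 ^ (5*N+4)\<close>, and their number
  \<open>N + 2\<close> is at most \<open>2 ^ (N+2)\<close>; this is the origin of 64 =
  \<open>2 ^ 6\<close>.\<close>

lemma pade_coeff_sum_le:
  assumes "\<And>k. \<exists>j. \<bar>f k\<bar> \<le> int (pade_coeff a b c j)" "a + b \<le> 2 * N + 2" "a + b + c \<le> 3 * N + 1"
  shows "(\<Sum>k\<le>N+1. \<bar>f k\<bar>) \<le> 64 ^ (N + 1)"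
proof -
  have "\<bar>f k\<bar> \<le> 2 ^ (5 * N + 4)" for k
  proof -
    obtain j where "\<bar>f k\<bar> \<le> int (pade_coeff a b c j)" using assms(1) by blast
    also have "\<dots> \<le> int (2 ^ (a + b) * 2 ^ (a + b + c + 1))" using pade_coeff_le of_nat_mono by blast
    also have "\<dots> = 2 ^ (a + b + (a + b + c + 1))" by (simp add: power_add)
    also have "\<dots> \<le> 2 ^ (5 * N + 4)" using assms(2,3) by (intro power_increasing) auto
    finally show ?thesis .
  qed
  hence "(\<Sum>k\<le>N+1. \<bar>f k\<bar>) \<le> of_nat (card {..N+1}) * 2 ^ (5 * N + 4)"
    by (intro sum_bounded_above)
  also have "\<dots> \<le> 2 ^ (N + 2) * 2 ^ (5 * N + 4)"
  proof -
    have "int (N + 2) \<le> int (2 ^ (N + 2))" by (intro of_nat_mono less_imp_le less_exp)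
    thus ?thesis by (intro mult_right_mono) auto
  qed
  also have "\<dots> = 2 ^ ((N + 2) + (5 * N + 4))" by (simp only: power_add)
  also have "(N + 2) + (5 * N + 4) = 6 * (N + 1)" by simp
  also have "(2 :: int) ^ (6 * (N + 1)) = 64 ^ (N + 1)" by (simp only: power_mult) simp
  finally show ?thesis .
qed

definition int_poly :: "nat \<Rightarrow> (nat \<Rightarrow> int) \<Rightarrow> complex poly" where
  "int_poly n a = (\<Sum>k\<le>n. monom (of_int (a k)) k)"

lemma poly_int_poly: "poly (int_poly n a) x = int_eval n a x"
  by (simp add: int_poly_def int_eval_def poly_sum poly_monom)

lemma coeff_int_poly: "coeff (int_poly n a) k = (if k \<le> n then of_int (a k) else 0)"
  by (simp add: int_poly_def coeff_sum)

text \<open>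
  The parameters \<open>(N, N, N)\<close> and \<open>(N + 1, N + 1, N - 1)\<close> share the exponent \<open>2 N + 1\<close>. Hence \<open>D\<close> is
  divisible by \<open>(1 - X) ^ (2 N + 1)\<close>, which is already its maximal degree, and it suffices to look at \<open>D 0\<close>,
  where no cancellation occurs.
\<close>
lemma pade_independent:
  assumes "N \<ge> 1"
  defines "n \<equiv> N + 1"
  shows "int_eval n (padeA N N N) x * int_eval n (padeB (N+1) (N+1) (N-1)) (1 - x)
    \<noteq> int_eval n (padeA (N+1) (N+1) (N-1)) x * int_eval n (padeB N N N) (1 - x)"
proof -
  define A A' B B' C C' where
    "A = int_poly n (padeA N N N)" "A' = int_poly n (padeA (N+1) (N+1) (N-1))"
    "B = int_poly n (padeB N N N)" "B' = int_poly n (padeB (N+1) (N+1) (N-1))"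
    "C = int_poly n (padeC N N N)" "C' = int_poly n (padeC (N+1) (N+1) (N-1))"
  note defs = this
  define D where "D = A * C' - A' * C"
  define E where "E = A * (B' \<circ>\<^sub>p [:1, -1:]) - A' * (B \<circ>\<^sub>p [:1, -1:])"
  have id1: "poly C y = y ^ (2*N+1) * poly A y + (1 - y) ^ (2*N+1) * poly B (1 - y)" for y
    using pade_identity'[of N n N N y] by (simp add: defs poly_int_poly n_def mult_2)
  have id2: "poly C' y = y ^ (2*N+1) * poly A' y + (1 - y) ^ (2*N+1) * poly B' (1 - y)" for y
    using pade_identity'[of "N+1" n "N+1" "N-1" y] assms by (simp add: defs poly_int_poly n_def mult_2)
  have "poly D y = poly ([:1, -1:] ^ (2*N+1) * E) y" for y
    unfolding D_def E_def poly_diff poly_mult id1 id2 poly_power poly_pcompose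
    by (simp add: algebra_simps)
  hence DE: "D = [:1, -1:] ^ (2*N+1) * E" by (metis poly_eq_poly_eq_iff ext)
  have "degree A \<le> N" "degree A' \<le> N + 1" "degree C \<le> N" "degree C' \<le> N - 1"
    by (intro degree_le; auto simp: defs coeff_int_poly padeA_def padeC_def pade_coeff_def)+
  hence "degree D \<le> 2*N+1" unfolding D_def
    by (intro degree_diff_le order.trans[OF degree_mult_le]) auto
  have "poly D 0 \<noteq> 0"
  proof -
    \<comment> \<open>The parities of \<open>N\<close> and \<open>N - 1\<close> differ, so the two
      products in \<open>A * C' - A' * C\<close> add up at 0.\<close>
    have sgn: "(-1) ^ (N - 1) = (- ((-1) ^ N) :: complex)" using assms(1) by (cases N) auto
    have [simp]: "poly A 0 = of_nat (pade_coeff N N N 0)"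
      "poly A' 0 = of_nat (pade_coeff (N+1) (N+1) (N-1) 0)"
      "poly C 0 = (-1) ^ N * of_nat (pade_coeff N N N N)"
      "poly C' 0 = - ((-1) ^ N) * of_nat (pade_coeff (N+1) (N-1) (N+1) (N-1))"
      using sgn by (simp_all add: poly_0_coeff_0 defs coeff_int_poly padeA_def padeC_def)
    have "poly D 0 = - ((-1) ^ N) * of_nat (pade_coeff N N N 0 * pade_coeff (N+1) (N-1) (N+1) (N-1)
        + pade_coeff (N+1) (N+1) (N-1) 0 * pade_coeff N N N N)"
      unfolding D_def by (simp add: algebra_simps)
    moreover have "pade_coeff N N N 0 * pade_coeff (N+1) (N-1) (N+1) (N-1)
        + pade_coeff (N+1) (N+1) (N-1) 0 * pade_coeff N N N N > 0"
      by (intro add_pos_pos mult_pos_pos pade_coeff_pos) auto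
    ultimately show ?thesis by (metis less_irrefl mult_eq_0_iff neg_equal_0_iff_equal of_nat_eq_0_iff power_eq_0_iff zero_neq_one)
  qed
  hence "D \<noteq> 0" by auto
  hence "E \<noteq> 0" using DE by auto
  have deg: "degree ([:1, -1:] ^ m :: complex poly) = m" for m by (simp add: degree_power_eq)
  have nz: "[:1, -1:] ^ m \<noteq> (0 :: complex poly)" for m by simp
  have "degree D = (2*N+1) + degree E"
    unfolding DE degree_mult_eq[OF nz \<open>E \<noteq> 0\<close>] deg ..
  with \<open>degree D \<le> 2*N+1\<close> have "degree E = 0" by simp
  then obtain e where e: "E = [:e:]" by (metis degree_eq_zeroE)
  have "e \<noteq> 0" using \<open>E \<noteq> 0\<close> e by auto
  hence "poly E x \<noteq> 0" using e by simp
  thus ?thesis by (simp add: E_def defs poly_pcompose poly_int_poly)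
qed

text \<open>Two approximants with the same exponent are provided because a single one may make the
  auxiliary number \<open>l\<close> of \<open>height_gap\<close> vanish; by the third property both
  cannot.\<close>

lemma pade_approximants:
  assumes "N \<ge> 1"
  obtains a b c a' b' c' where
    "\<And>x. x ^ (2*N+1) * int_eval (N+1) a x + (1 - x) ^ (2*N+1) * int_eval (N+1) b (1 - x) = int_eval (N+1) c x"
    "\<And>x. x ^ (2*N+1) * int_eval (N+1) a' x + (1 - x) ^ (2*N+1) * int_eval (N+1) b' (1 - x) = int_eval (N+1) c' x"
    "\<And>x. int_eval (N+1) a x * int_eval (N+1) b' (1 - x) \<noteq> int_eval (N+1) a' x * int_eval (N+1) b (1 - x)"
    "\<And>f. f \<in> {a, b, c, a', b', c'} \<Longrightarrow> (\<Sum>k\<le>N+1. \<bar>f k\<bar>) \<le> 64 ^ (N + 1)"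
proof (rule that)
  fix x
  show "x ^ (2*N+1) * int_eval (N+1) (padeA N N N) x + (1 - x) ^ (2*N+1) * int_eval (N+1) (padeB N N N) (1 - x)
      = int_eval (N+1) (padeC N N N) x"
    using pade_identity'[of N "N+1" N N x] by (simp add: mult_2)
  show "x ^ (2*N+1) * int_eval (N+1) (padeA (N+1) (N+1) (N-1)) x
      + (1 - x) ^ (2*N+1) * int_eval (N+1) (padeB (N+1) (N+1) (N-1)) (1 - x)
      = int_eval (N+1) (padeC (N+1) (N+1) (N-1)) x"
    using pade_identity'[of "N+1" "N+1" "N+1" "N-1" x] assms by (simp add: mult_2)
  show "int_eval (N+1) (padeA N N N) x * int_eval (N+1) (padeB (N+1) (N+1) (N-1)) (1 - x)
    \<noteq> int_eval (N+1) (padeA (N+1) (N+1) (N-1)) x * int_eval (N+1) (padeB N N N) (1 - x)"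
    by (rule pade_independent[OF assms])
next
  fix f
  have bnd: "(\<Sum>k\<le>N+1. \<bar>padeA a b c k\<bar>) \<le> 64 ^ (N + 1)" "(\<Sum>k\<le>N+1. \<bar>padeB a b c k\<bar>) \<le> 64 ^ (N + 1)"
    "(\<Sum>k\<le>N+1. \<bar>padeC a b c k\<bar>) \<le> 64 ^ (N + 1)"
    if "a + b \<le> 2*N+2" "a + c \<le> 2*N+2" "a+b+c \<le> 3*N+1" for a b c
  proof -
    have "\<exists>j. \<bar>padeA a b c k\<bar> \<le> int (pade_coeff a b c j)" "\<exists>j. \<bar>padeB a b c k\<bar> \<le> int (pade_coeff b a c j)"
      "\<exists>j. \<bar>padeC a b c k\<bar> \<le> int (pade_coeff a c b j)" for k
      by (rule exI[of _ k] exI[of _ "c - k"], simp add: padeA_def padeB_def padeC_def abs_mult power_abs)+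
    note coeffs = this
    show "(\<Sum>k\<le>N+1. \<bar>padeA a b c k\<bar>) \<le> 64 ^ (N + 1)"
      using that by (intro pade_coeff_sum_le[OF coeffs(1)]) auto
    show "(\<Sum>k\<le>N+1. \<bar>padeB a b c k\<bar>) \<le> 64 ^ (N + 1)"
      using that by (intro pade_coeff_sum_le[OF coeffs(2)]) auto
    show "(\<Sum>k\<le>N+1. \<bar>padeC a b c k\<bar>) \<le> 64 ^ (N + 1)"
      using that by (intro pade_coeff_sum_le[OF coeffs(3)]) auto
  qed
  assume "f \<in> {padeA N N N, padeB N N N, padeC N N N, padeA (N+1) (N+1) (N-1), padeB (N+1) (N+1) (N-1), padeC (N+1) (N+1) (N-1)}"
  thus "(\<Sum>k\<le>N+1. \<bar>f k\<bar>) \<le> 64 ^ (N + 1)"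
    using bnd[of N N N] bnd[of "N+1" "N+1" "N-1"] assms by (auto simp del: sum.atMost_Suc)
qed

section \<open>The unit equation in valued rings\<close>

text \<open>An abstraction of the S-integers with their finitely many places. The plain triangle
  inequality treats archimedean and p-adic places alike; \<open>prod_ge_1\<close> is what the
  product formula leaves when all factors outside \<open>W\<close> are at most 1.\<close>

locale valued_ring =
  fixes R :: "complex set" and W :: "'i set" and v :: "'i \<Rightarrow> complex \<Rightarrow> real"
  assumes one_R: "1 \<in> R"
    and add_R: "\<And>x y. x \<in> R \<Longrightarrow> y \<in> R \<Longrightarrow> x + y \<in> R"
    and mult_R: "\<And>x y. x \<in> R \<Longrightarrow> y \<in> R \<Longrightarrow> x * y \<in> R"
    and uminus_R: "\<And>x. x \<in> R \<Longrightarrow> - x \<in> R"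
    and finite_W: "finite W"
    and v_mult: "\<And>w x y. w \<in> W \<Longrightarrow> x \<in> R \<Longrightarrow> y \<in> R \<Longrightarrow> v w (x * y) = v w x * v w y"
    and v_add: "\<And>w x y. w \<in> W \<Longrightarrow> x \<in> R \<Longrightarrow> y \<in> R \<Longrightarrow> v w (x + y) \<le> v w x + v w y"
    and v_0: "\<And>w. w \<in> W \<Longrightarrow> v w 0 = 0"
    and v_pos: "\<And>w x. w \<in> W \<Longrightarrow> x \<in> R \<Longrightarrow> x \<noteq> 0 \<Longrightarrow> v w x > 0"
    and prod_ge_1: "\<And>x. x \<in> R \<Longrightarrow> x \<noteq> 0 \<Longrightarrow> (\<Prod>w\<in>W. v w x) \<ge> 1"
    and northcott: "\<And>B. finite {x\<in>R. \<forall>w\<in>W. v w x \<le> B}"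
begin

lemma zero_R: "0 \<in> R"
  using add_R[OF one_R uminus_R[OF one_R]] by simp

lemma diff_R: "x \<in> R \<Longrightarrow> y \<in> R \<Longrightarrow> x - y \<in> R"
  using add_R[of x "- y"] uminus_R by simp

lemma power_R: "x \<in> R \<Longrightarrow> x ^ n \<in> R"
  by (induction n) (auto intro: one_R mult_R)

lemma sum_R: "(\<And>i. i \<in> A \<Longrightarrow> f i \<in> R) \<Longrightarrow> (\<Sum>i\<in>A. f i) \<in> R"
  by (induction A rule: infinite_finite_induct) (auto intro: zero_R add_R)

lemma of_nat_R: "of_nat n \<in> R"
  by (induction n) (auto intro: zero_R one_R add_R)

lemma of_int_R: "of_int n \<in> R"
  by (cases n) (auto intro: of_nat_R uminus_R diff_R one_R simp: uminus_R[OF one_R])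

lemma int_eval_R: "x \<in> R \<Longrightarrow> int_eval n a x \<in> R"
  unfolding int_eval_def by (intro sum_R mult_R of_int_R power_R)

context
  fixes w assumes w: "w \<in> W"
begin

lemma v_nonneg: "x \<in> R \<Longrightarrow> v w x \<ge> 0"
  using v_pos[OF w] v_0[OF w] by (cases "x = 0") (auto intro: less_imp_le)

lemma v_1: "v w 1 = 1"
  using v_mult[OF w one_R one_R] v_pos[OF w one_R] by simp

lemma v_uminus: "x \<in> R \<Longrightarrow> v w (- x) = v w x"
proof -
  assume x: "x \<in> R"
  have m1: "- 1 \<in> R" by (intro uminus_R one_R)
  have "v w (-1) * v w (-1) = 1" using v_mult[OF w m1 m1] v_1 by simp
  moreover have "v w (-1) \<ge> 0" using v_nonneg m1 by blast
  ultimately have "v w (-1) = 1" by (metis power2_eq_square power2_eq_1_iff neg_0_le_iff_le not_one_le_zero)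
  thus ?thesis using v_mult[OF w m1 x] by simp
qed

lemma v_diff: "x \<in> R \<Longrightarrow> y \<in> R \<Longrightarrow> v w (x - y) \<le> v w x + v w y"
  using v_add[OF w, of x "- y"] v_uminus[of y] uminus_R[of y] by simp

lemma v_power: "x \<in> R \<Longrightarrow> v w (x ^ n) = v w x ^ n"
  by (induction n) (auto simp: v_1 v_mult[OF w] power_R)

lemma v_of_nat: "v w (of_nat n) \<le> of_nat n"
proof (induction n)
  case (Suc n)
  have "v w (of_nat (Suc n)) \<le> v w 1 + v w (of_nat n)"
    using v_add[OF w one_R of_nat_R[of n]] by simp
  with Suc v_1 show ?case by simp
qed (simp add: v_0[OF w])

lemma v_of_int: "v w (of_int n) \<le> of_int \<bar>n\<bar>"
proof (cases "n \<ge> 0")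
  case True
  thus ?thesis using v_of_nat[of "nat n"] by (simp add: of_nat_nat)
next
  case False
  hence "of_int n = (- of_nat (nat (- n)) :: complex)" by (simp add: of_nat_nat)
  thus ?thesis using v_of_nat[of "nat (- n)"] v_uminus[OF of_nat_R, of "nat (- n)"] False
    by (simp add: of_nat_nat)
qed

lemma v_sum_le: "(\<And>i. i \<in> A \<Longrightarrow> f i \<in> R) \<Longrightarrow> v w (\<Sum>i\<in>A. f i) \<le> (\<Sum>i\<in>A. v w (f i))"
proof (induction A rule: infinite_finite_induct)
  case (insert i A)
  have "v w (f i + sum f A) \<le> v w (f i) + v w (sum f A)"
    using insert by (intro v_add[OF w] sum_R) auto
  with insert show ?case by fastforce
qed (auto simp: v_0[OF w])

lemma v_int_eval_le:
  assumes "x \<in> R" "v w x \<le> m" "1 \<le> m" "(\<Sum>k\<le>n. \<bar>a k\<bar>) \<le> C"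
  shows "v w (int_eval n a x) \<le> of_int C * m ^ n"
proof -
  have "v w (int_eval n a x) \<le> (\<Sum>k\<le>n. v w (of_int (a k) * x ^ k))"
    unfolding int_eval_def by (intro v_sum_le mult_R of_int_R power_R assms)
  also have "\<dots> \<le> (\<Sum>k\<le>n. of_int \<bar>a k\<bar> * m ^ n)"
  proof (rule sum_mono)
    fix k assume k: "k \<in> {..n}"
    have "v w x ^ k \<le> m ^ k" using assms v_nonneg by (intro power_mono) auto
    also have "\<dots> \<le> m ^ n" using assms k by (intro power_increasing) auto
    finally have "v w x ^ k \<le> m ^ n" .
    thus "v w (of_int (a k) * x ^ k) \<le> of_int \<bar>a k\<bar> * m ^ n"
      using v_of_int[of "a k"] assms(1)
      by (auto simp: v_mult[OF w] of_int_R power_R v_power intro!: mult_mono v_nonneg zero_le_power)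
  qed
  also have "\<dots> = of_int (\<Sum>k\<le>n. \<bar>a k\<bar>) * m ^ n" by (simp add: sum_distrib_right)
  also have "\<dots> \<le> of_int C * m ^ n" using assms by (intro mult_right_mono) (auto simp del: of_int_sum)
  finally show ?thesis .
qed

end

section \<open>Units, heights and the gap principle\<close>

definition unit :: "complex \<Rightarrow> bool" where
  "unit x \<longleftrightarrow> x \<noteq> 0 \<and> x \<in> R \<and> inverse x \<in> R"

text \<open>\<open>prod_ge_1\<close> applies to \<open>x\<close> and to \<open>1 / x\<close>, and
  the two products multiply to 1.\<close>

lemma unit_ln_sum: assumes "unit x" shows "(\<Sum>w\<in>W. ln (v w x)) = 0"
proof -
  have x: "x \<noteq> 0" "x \<in> R" "inverse x \<in> R" using assms by (auto simp: unit_def)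
  have pos: "w \<in> W \<Longrightarrow> v w x > 0" "w \<in> W \<Longrightarrow> v w (inverse x) > 0" for w using x v_pos by auto
  have "v w x * v w (inverse x) = 1" if "w \<in> W" for w
    using v_mult[OF that x(2,3)] x(1) v_1[OF that] by simp
  hence "(\<Prod>w\<in>W. v w x) * (\<Prod>w\<in>W. v w (inverse x)) = 1" by (simp add: prod.distrib [symmetric])
  moreover have "(\<Prod>w\<in>W. v w x) \<ge> 1" "(\<Prod>w\<in>W. v w (inverse x)) \<ge> 1" using x by (auto intro: prod_ge_1)
  moreover from this have "(\<Prod>w\<in>W. v w x) * 1 \<le> (\<Prod>w\<in>W. v w x) * (\<Prod>w\<in>W. v w (inverse x))"
    by (intro mult_left_mono) auto
  ultimately have "(\<Prod>w\<in>W. v w x) = 1" by simp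
  hence "ln (\<Prod>w\<in>W. v w x) = 0" by simp
  thus ?thesis using pos finite_W by (subst (asm) ln_prod) (auto simp: less_imp_neq[symmetric])
qed

text \<open>The local factor of the height of the projective point
  \<open>(1 : x : 1 - x)\<close>.\<close>

definition local_height :: "'i \<Rightarrow> complex \<Rightarrow> real" where
  "local_height w x = max 1 (max (v w x) (v w (1 - x)))"

definition height :: "complex \<Rightarrow> real" where
  "height x = (\<Sum>w\<in>W. ln (local_height w x))"

lemma local_height_ge_1: "local_height w x \<ge> 1" "v w x \<le> local_height w x" "v w (1 - x) \<le> local_height w x"
  by (auto simp: local_height_def)

lemma ln_local_height_le: "w \<in> W \<Longrightarrow> ln (local_height w x) \<le> height x"
  unfolding height_def using finite_W local_height_ge_1
  by (intro member_le_sum) (auto intro: ln_ge_zero)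

text \<open>The bound from below holds because the logarithms at all places sum to 0:
  \<open>- ln (v w y)\<close> is the sum over the other places, each term of which is at most a
  local height.\<close>

lemma abs_ln_le_height:
  assumes "unit y" "y \<in> {x, 1 - x}" "w \<in> W"
  shows "\<bar>ln (v w y)\<bar> \<le> height x"
proof -
  have pos: "w \<in> W \<Longrightarrow> v w y > 0" for w using assms v_pos by (auto simp: unit_def)
  have le: "ln (v w y) \<le> ln (local_height w x)" if "w \<in> W" for w
    using pos[OF that] assms(2) local_height_ge_1 by (intro ln_mono) (auto simp: local_height_def)
  have ge: "ln (local_height w x) \<ge> 0" for w using local_height_ge_1 by (intro ln_ge_zero)
  have "(\<Sum>u\<in>W. ln (v u y)) = ln (v w y) + (\<Sum>u\<in>W-{w}. ln (v u y))"
    using assms(3) finite_W by (rule sum.remove[rotated])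
  hence "- ln (v w y) = (\<Sum>u\<in>W-{w}. ln (v u y))" using unit_ln_sum[OF assms(1)] by simp
  also have "\<dots> \<le> (\<Sum>u\<in>W-{w}. ln (local_height u x))" using le by (intro sum_mono) auto
  also have "\<dots> \<le> height x" unfolding height_def using finite_W ge by (intro sum_mono2) auto
  finally show ?thesis using le[OF assms(3)] ln_local_height_le[OF assms(3), of x] by linarith
qed

definition unit_solutions :: "complex set" where
  "unit_solutions = {x. unit x \<and> unit (1 - x)}"

lemma finite_height_le: "finite {x\<in>unit_solutions. height x \<le> B}"
proof (rule finite_subset[OF _ northcott])
  show "{x\<in>unit_solutions. height x \<le> B} \<subseteq> {x\<in>R. \<forall>w\<in>W. v w x \<le> exp B}"
  proof safe
    fix x w assume x: "x \<in> unit_solutions" "height x \<le> B" and w: "w \<in> W"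
    have "v w x \<le> local_height w x" by (rule local_height_ge_1)
    also have "\<dots> = exp (ln (local_height w x))" using local_height_ge_1(1)[of w x] by simp
    also have "\<dots> \<le> exp B" using ln_local_height_le[OF w, of x] x by simp
    finally show "v w x \<le> exp B" .
  qed (auto simp: unit_solutions_def unit_def)
qed

text \<open>
  The vectors \<open>(r, s, 1)\<close> and \<open>(A, B, -C)\<close> are both orthogonal to \<open>(x1 ^ n, (1 - x1) ^ n, -1)\<close>, so their cross
  product is a multiple \<open>l\<close> of the latter; \<open>l\<close> is small at every place, while the product of its absolute values
  is at least \<open>1\<close> unless \<open>l = 0\<close>.
\<close>
lemma height_gap:
  assumes x1: "x1 \<in> unit_solutions" and x2: "x2 \<in> unit_solutions" and N: "N \<ge> 1" and "\<rho> \<ge> 0"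
    and close: "\<And>w. w \<in> W \<Longrightarrow> \<bar>ln (v w x2) - real (2*N+1) * ln (v w x1)\<bar> \<le> \<rho>"
      "\<And>w. w \<in> W \<Longrightarrow> \<bar>ln (v w (1 - x2)) - real (2*N+1) * ln (v w (1 - x1))\<bar> \<le> \<rho>"
  shows "real N * height x1 \<le> real (card W) * (ln 2 + \<rho> + real (N + 1) * ln 64)"
proof -
  define n where "n = 2*N+1"
  have R: "x1 \<in> R" "inverse x1 \<in> R" "1 - x1 \<in> R" "inverse (1 - x1) \<in> R" "x2 \<in> R" "1 - x2 \<in> R"
      "inverse x2 \<in> R" "inverse (1 - x2) \<in> R"
    and nz: "x1 \<noteq> 0" "1 - x1 \<noteq> 0" "x2 \<noteq> 0" "1 - x2 \<noteq> 0"
    using x1 x2 by (auto simp: unit_solutions_def unit_def)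
  \<comment> \<open>\<open>r\<close> and \<open>s\<close> measure how far \<open>x2\<close> and
    \<open>1 - x2\<close> are from the n-th powers of \<open>x1\<close> and \<open>1 - x1\<close>;
    closeness of the logarithms bounds both by \<open>exp \<rho>\<close> at every place.\<close>
  define r s where "r = x2 * inverse x1 ^ n" and "s = (1 - x2) * inverse (1 - x1) ^ n"
  have rs_R: "r \<in> R" "s \<in> R" unfolding r_def s_def by (intro mult_R power_R R)+
  have rs: "r * x1 ^ n = x2" "s * (1 - x1) ^ n = 1 - x2"
    using nz by (auto simp: r_def s_def power_inverse)
  have rsnz: "r \<noteq> 0" "s \<noteq> 0" using nz by (auto simp: r_def s_def)
  have quot: "v w t \<le> exp \<rho>"
    if "w \<in> W" "t \<in> R" "t \<noteq> 0" "y \<in> R" "y \<noteq> 0" "t * y ^ n = z" "z \<in> R"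
       "\<bar>ln (v w z) - real n * ln (v w y)\<bar> \<le> \<rho>" for w t y z
  proof -
    have "v w z = v w t * v w y ^ n" using that by (metis v_mult power_R v_power)
    moreover have "v w t > 0" "v w y > 0" using that by (auto intro: v_pos)
    ultimately have "ln (v w z) = ln (v w t) + real n * ln (v w y)"
      by (simp add: ln_mult ln_realpow)
    hence "ln (v w t) \<le> \<rho>" using that by linarith
    thus ?thesis using \<open>v w t > 0\<close> by (metis exp_le_cancel_iff exp_ln)
  qed
  have vr: "v w r \<le> exp \<rho>" if "w \<in> W" for w
    using quot[OF that rs_R(1) rsnz(1) R(1) nz(1) rs(1) R(5)] close(1)[OF that] by (simp add: n_def)
  have vs: "v w s \<le> exp \<rho>" if "w \<in> W" for w
    using quot[OF that rs_R(2) rsnz(2) R(3) nz(2) rs(2) R(6)] close(2)[OF that] by (simp add: n_def)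
  have *: "real N * height x1 \<le> real (card W) * (ln 2 + \<rho> + real (N + 1) * ln 64)"
    if id: "x1 ^ n * int_eval (N+1) a x1 + (1 - x1) ^ n * int_eval (N+1) b (1 - x1) = int_eval (N+1) c x1"
     and bd: "\<And>f. f \<in> {a, b, c} \<Longrightarrow> (\<Sum>k\<le>N+1. \<bar>f k\<bar>) \<le> 64 ^ (N + 1)"
     and ne: "r * int_eval (N+1) b (1 - x1) \<noteq> s * int_eval (N+1) a x1" for a b c
  proof -
    define A B C where "A = int_eval (N+1) a x1" "B = int_eval (N+1) b (1 - x1)" "C = int_eval (N+1) c x1"
    note ABC = this
    have ABC_R: "A \<in> R" "B \<in> R" "C \<in> R" unfolding ABC by (intro int_eval_R R)+
    define l where "l = r * B - s * A"
    have l_R: "l \<in> R" unfolding l_def by (intro diff_R mult_R rs_R ABC_R)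
    have l0: "l \<noteq> 0" using ne by (simp add: l_def ABC)
    have id': "x1 ^ n * A + (1 - x1) ^ n * B = C" using id by (simp add: ABC)
    have lx: "l * x1 ^ n = B - s * C"
    proof -
      have "l * x1 ^ n = (r * x1 ^ n) * B - s * (x1 ^ n * A)" by (simp add: l_def algebra_simps)
      also have "\<dots> = (1 - s * (1 - x1) ^ n) * B - s * (C - (1 - x1) ^ n * B)"
      proof -
        have "r * x1 ^ n = 1 - s * (1 - x1) ^ n" using rs by simp
        moreover have "x1 ^ n * A = C - (1 - x1) ^ n * B" using id' by (simp add: algebra_simps)
        ultimately show ?thesis by simp
      qed
      finally show ?thesis by (simp add: algebra_simps)
    qed
    have ly: "l * (1 - x1) ^ n = r * C - A"
    proof -
      have "l * (1 - x1) ^ n = r * ((1 - x1) ^ n * B) - (s * (1 - x1) ^ n) * A" by (simp add: l_def algebra_simps)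
      also have "(1 - x1) ^ n * B = C - x1 ^ n * A" using id' by (simp add: algebra_simps)
      also have "s * (1 - x1) ^ n = 1 - r * x1 ^ n" using rs by simp
      finally show ?thesis by (simp add: algebra_simps)
    qed
    \<comment> \<open>The three coordinates of the cross product of \<open>(r, s, 1)\<close> and
      \<open>(A, B, C)\<close> bound \<open>l\<close> times 1, \<open>x1 ^ n\<close> and
      \<open>(1 - x1) ^ n\<close>, hence \<open>l\<close> times the n-th power of the local height.
      The approximants cost only its power \<open>N + 1\<close>, and \<open>n = 2*N+1\<close> leaves
      a gain of \<open>N\<close>.\<close>
    have loc: "v w l * local_height w x1 ^ N \<le> 2 * exp \<rho> * 64 ^ (N + 1)" if w: "w \<in> W" for w
    proof -
      define m where "m = local_height w x1"
      have m: "m \<ge> 1" "v w x1 \<le> m" "v w (1 - x1) \<le> m" using local_height_ge_1 by (auto simp: m_def)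
      define G where "G = 64 ^ (N + 1) * m ^ (N + 1)"
      have bds: "v w A \<le> G" "v w B \<le> G" "v w C \<le> G"
        unfolding ABC using v_int_eval_le[OF w R(1) m(2,1) bd[of a]] v_int_eval_le[OF w R(3) m(3,1) bd[of b]]
          v_int_eval_le[OF w R(1) m(2,1) bd[of c]] by (auto simp: G_def simp del: power_Suc)
      have G0: "G \<ge> 0" using m by (auto simp: G_def)
      have e1: "exp \<rho> \<ge> 1" using \<open>\<rho> \<ge> 0\<close> by simp
      have bd2: "v w (t * X) \<le> exp \<rho> * G" if "t \<in> {r, s}" "X \<in> {A, B, C}" for t X
        using that vr[OF w] vs[OF w] bds rs_R ABC_R v_nonneg[OF w]
        by (auto simp: v_mult[OF w] intro!: mult_mono)
      have bd1: "v w X \<le> exp \<rho> * G" if "X \<in> {A, B, C}" for X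
      proof -
        have "v w X \<le> 1 * G" using that bds by auto
        also have "\<dots> \<le> exp \<rho> * G" using e1 G0 by (intro mult_right_mono)
        finally show ?thesis .
      qed
      have "v w l * 1 \<le> 2 * exp \<rho> * G"
        unfolding l_def using v_diff[OF w mult_R[OF rs_R(1) ABC_R(2)] mult_R[OF rs_R(2) ABC_R(1)]]
          bd2[of r B] bd2[of s A] by simp
      moreover have "v w l * v w x1 ^ n \<le> 2 * exp \<rho> * G"
      proof -
        have "v w l * v w x1 ^ n = v w (B - s * C)"
          using lx by (metis v_mult[OF w l_R power_R] v_power[OF w] R(1))
        also have "\<dots> \<le> v w B + v w (s * C)" by (intro v_diff[OF w] mult_R ABC_R rs_R)
        finally show ?thesis using bd1[of B] bd2[of s C] by simp
      qed
      moreover have "v w l * v w (1 - x1) ^ n \<le> 2 * exp \<rho> * G"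
      proof -
        have "v w l * v w (1 - x1) ^ n = v w (r * C - A)"
          using ly by (metis v_mult[OF w l_R power_R] v_power[OF w] R(3))
        also have "\<dots> \<le> v w (r * C) + v w A" by (intro v_diff[OF w] mult_R ABC_R rs_R)
        finally show ?thesis using bd1[of A] bd2[of r C] by simp
      qed
      moreover have "m = 1 \<or> m = v w x1 \<or> m = v w (1 - x1)" by (auto simp: m_def local_height_def max_def)
      ultimately have "v w l * m ^ n \<le> 2 * exp \<rho> * G" by auto
      moreover have "n = N + (N + 1)" by (simp add: n_def)
      hence "m ^ n = m ^ N * m ^ (N + 1)" by (simp only: power_add)
      ultimately have "(v w l * m ^ N) * m ^ (N+1) \<le> (2 * exp \<rho> * 64 ^ (N + 1)) * m ^ (N + 1)"
        by (simp only: G_def mult.assoc)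
      thus ?thesis using m(1) unfolding m_def[symmetric] by (simp only: mult_le_cancel_right) auto
    qed
    have lpos: "v w l > 0" if "w \<in> W" for w using v_pos[OF that l_R l0] .
    have "0 \<le> ln (\<Prod>w\<in>W. v w l)" using prod_ge_1[OF l_R l0] by (intro ln_ge_zero)
    also have "ln (\<Prod>w\<in>W. v w l) = (\<Sum>w\<in>W. ln (v w l))"
      using finite_W lpos by (subst ln_prod) (auto simp: less_imp_neq[symmetric])
    finally have "real N * height x1 \<le> (\<Sum>w\<in>W. ln (v w l)) + real N * height x1" by simp
    also have "\<dots> = (\<Sum>w\<in>W. ln (v w l) + real N * ln (local_height w x1))"
      by (simp add: height_def sum.distrib sum_distrib_left)
    also have "\<dots> \<le> (\<Sum>w\<in>W. ln 2 + \<rho> + real (N + 1) * ln 64)"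
    proof (rule sum_mono)
      fix w assume w: "w \<in> W"
      have mp: "local_height w x1 > 0" using local_height_ge_1(1)[of w x1] by linarith
      have "ln (v w l) + real N * ln (local_height w x1) = ln (v w l * local_height w x1 ^ N)"
        using lpos[OF w] mp by (simp add: ln_mult ln_realpow)
      also have "\<dots> \<le> ln (2 * exp \<rho> * 64 ^ (N + 1))"
        using loc[OF w] lpos[OF w] mp by (intro ln_mono) auto
      also have "\<dots> = ln 2 + \<rho> + real (N + 1) * ln 64"
        by (simp only: ln_mult ln_realpow ln_exp) (simp add: ln_mult ln_realpow del: power_Suc)
      finally show "ln (v w l) + real N * ln (local_height w x1) \<le> ln 2 + \<rho> + real (N + 1) * ln 64" .
    qed
    also have "\<dots> = real (card W) * (ln 2 + \<rho> + real (N + 1) * ln 64)" by simp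
    finally show ?thesis .
  qed
  obtain a b c a' b' c' where p:
    "\<And>x. x ^ (2*N+1) * int_eval (N+1) a x + (1 - x) ^ (2*N+1) * int_eval (N+1) b (1 - x) = int_eval (N+1) c x"
    "\<And>x. x ^ (2*N+1) * int_eval (N+1) a' x + (1 - x) ^ (2*N+1) * int_eval (N+1) b' (1 - x) = int_eval (N+1) c' x"
    "\<And>x. int_eval (N+1) a x * int_eval (N+1) b' (1 - x) \<noteq> int_eval (N+1) a' x * int_eval (N+1) b (1 - x)"
    "\<And>f. f \<in> {a, b, c, a', b', c'} \<Longrightarrow> (\<Sum>k\<le>N+1. \<bar>f k\<bar>) \<le> 64 ^ (N + 1)"
    by (rule pade_approximants[OF N]) blast
  \<comment> \<open>If both approximants gave \<open>l = 0\<close>, their vectors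
    \<open>(A, B)\<close> would both be proportional to \<open>(r, s)\<close>, against the nonzero
    determinant.\<close>
  have "r * int_eval (N+1) b (1 - x1) \<noteq> s * int_eval (N+1) a x1 \<or>
        r * int_eval (N+1) b' (1 - x1) \<noteq> s * int_eval (N+1) a' x1"
  proof (rule ccontr)
    assume "\<not> ?thesis"
    hence e: "r * int_eval (N+1) b (1 - x1) = s * int_eval (N+1) a x1"
      "r * int_eval (N+1) b' (1 - x1) = s * int_eval (N+1) a' x1" by auto
    have "r * s * (int_eval (N+1) a x1 * int_eval (N+1) b' (1 - x1))
        = (s * int_eval (N+1) a x1) * (r * int_eval (N+1) b' (1 - x1))" by (simp only: mult_ac)
    also have "\<dots> = (s * int_eval (N+1) a' x1) * (r * int_eval (N+1) b (1 - x1))"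
      unfolding e by (simp only: mult_ac)
    also have "\<dots> = r * s * (int_eval (N+1) a' x1 * int_eval (N+1) b (1 - x1))" by (simp only: mult_ac)
    finally show False using p(3)[of x1] rsnz by (simp only: mult_cancel_left) auto
  qed
  thus ?thesis
  proof
    assume "r * int_eval (N+1) b (1 - x1) \<noteq> s * int_eval (N+1) a x1"
    from *[OF _ _ this, of c] p(1)[of x1] p(4) show ?thesis by (auto simp: n_def simp del: power_Suc sum.atMost_Suc)
  next
    assume "r * int_eval (N+1) b' (1 - x1) \<noteq> s * int_eval (N+1) a' x1"
    from *[OF _ _ this, of c'] p(2)[of x1] p(4) show ?thesis by (auto simp: n_def simp del: power_Suc sum.atMost_Suc)
  qed
qed

text \<open>
  By the pigeonhole principle infinitely many solutions have nearly the same direction of logarithmic vectors. For two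
  of them of very different height, a suitable odd power of the first is close to the second at every place.
\<close>
theorem finite_unit_solutions: "finite unit_solutions"
proof (rule ccontr)
  assume inf: "infinite unit_solutions"
  define s where "s = real (card W)"
  \<comment> \<open>Directions are rounded to a mesh of 1/K. The error, summed over the
    \<open>s\<close> places, is about \<open>s * h2 / K\<close>, less than a tenth of
    \<open>h2\<close> and well below the gain \<open>N * h1\<close>, which is about half of
    \<open>h2\<close>.\<close>
  define K where "K = 10 * (int (card W) + 1)"
  \<comment> \<open>Heights above this bound absorb the constants: \<open>s * 6 * (N + 1)\<close> is
    then at most 6/100 of \<open>(N + 1) * h1\<close>.\<close>
  define F where "F = {x\<in>unit_solutions. height x > 100 * (s + 1)}"
  have s0: "s \<ge> 0" by (simp add: s_def)
  have K: "real_of_int K = 10 * (s + 1)" by (simp add: K_def s_def)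
  have "unit_solutions \<subseteq> F \<union> {x\<in>unit_solutions. height x \<le> 100 * (s + 1)}" by (auto simp: F_def)
  hence infF: "infinite F" using inf finite_height_le finite_subset by blast
  define key where "key = (\<lambda>x. \<lambda>w\<in>W. (\<lfloor>real_of_int K * (ln (v w x) / height x)\<rfloor>,
      \<lfloor>real_of_int K * (ln (v w (1 - x)) / height x)\<rfloor>))"
  have fl: "\<lfloor>real_of_int K * (ln (v w y) / height x)\<rfloor> \<in> {-K..K}"
    if "x \<in> F" "y \<in> {x, 1 - x}" "w \<in> W" for x y w
  proof -
    have "height x > 0" "unit y" using that s0 by (auto simp: F_def unit_solutions_def)
    hence "\<bar>ln (v w y) / height x\<bar> \<le> 1" using abs_ln_le_height[OF _ that(2,3)] by simp
    hence "real_of_int K * \<bar>ln (v w y) / height x\<bar> \<le> real_of_int K * 1" using K s0 by (intro mult_left_mono) auto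
    moreover have "\<bar>real_of_int K * (ln (v w y) / height x)\<bar> = real_of_int K * \<bar>ln (v w y) / height x\<bar>"
      using K s0 by (subst abs_mult) auto
    ultimately have "\<bar>real_of_int K * (ln (v w y) / height x)\<bar> \<le> real_of_int K" by (simp only: mult_1_right)
    moreover have "\<lfloor>z\<rfloor> \<in> {-K..K}" if "\<bar>z\<bar> \<le> real_of_int K" for z
      using that by (auto simp: le_floor_iff floor_le_iff abs_le_iff)
    ultimately show ?thesis by blast
  qed
  have "key ` F \<subseteq> (\<Pi>\<^sub>E w\<in>W. {-K..K} \<times> {-K..K})"
  proof (rule image_subsetI)
    fix x assume "x \<in> F"
    thus "key x \<in> (\<Pi>\<^sub>E w\<in>W. {-K..K} \<times> {-K..K})"
      unfolding key_def by (intro restrict_PiE_iff[THEN iffD2] ballI SigmaI fl) auto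
  qed
  moreover have "finite (\<Pi>\<^sub>E w\<in>W. {-K..K} \<times> {-K..K})" using finite_W by (intro finite_PiE) auto
  ultimately have "finite (key ` F)" by (rule finite_subset)
  from pigeonhole_infinite[OF infF this] obtain x1
    where x1: "x1 \<in> F" and infk: "infinite {x\<in>F. key x = key x1}" by blast
  define h1 where "h1 = height x1"
  have h1: "h1 > 100 * (s + 1)" and x1': "x1 \<in> unit_solutions" using x1 by (auto simp: F_def h1_def)
  have "0 \<le> 100 * (s + 1)" using s0 by simp
  hence h1_pos: "h1 > 0" using h1 by (rule le_less_trans)
  \<comment> \<open>A height \<open>h2\<close> above \<open>A\<close> forces \<open>N\<close> to be
    at least \<open>100 * (s + 1)\<close>.\<close>
  define A where "A = (200 * (s + 1) + 3) * h1"
  have "\<not> {x\<in>F. key x = key x1} \<subseteq> {x\<in>unit_solutions. height x \<le> A}"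
    using infk finite_height_le finite_subset by blast
  then obtain x2 where x2: "x2 \<in> F" "key x2 = key x1" "\<not> height x2 \<le> A" by (auto simp: F_def)
  define h2 where "h2 = height x2"
  have h2: "h2 > A" and x2': "x2 \<in> unit_solutions" using x2 by (auto simp: F_def h2_def)
  have q: "h2 / h1 > 200 * (s + 1) + 3" using h2 h1_pos by (simp add: A_def field_simps)
  \<comment> \<open>Makes \<open>2 * N + 1\<close> the largest odd integer not above
    \<open>h2 / h1\<close>, hence less than 2 away from it.\<close>
  define N where "N = nat \<lfloor>(h2 / h1 - 1) / 2\<rfloor>"
  have "real N = of_int \<lfloor>(h2 / h1 - 1) / 2\<rfloor>" using q s0 by (auto simp: N_def of_nat_nat)
  hence N: "real N \<le> (h2 / h1 - 1) / 2" "(h2 / h1 - 1) / 2 < real N + 1" by linarith+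
  have N100: "real N \<ge> 100 * (s + 1)"
  proof -
    have "h2 / h1 < 2 * real N + 3" using N(2) by (simp add: field_simps)
    with q have "200 * (s + 1) + 3 < 2 * real N + 3" by (rule less_trans)
    thus ?thesis by simp
  qed
  \<comment> \<open>The first term is the price of rounding \<open>h2 / h1\<close> to an odd
    integer, the second that of rounding the direction, with \<open>h2\<close> bounded by
    \<open>(2 * N + 3) * h1\<close>.\<close>
  define \<rho> where "\<rho> = 2 * h1 + (2 * real N + 3) * h1 / (10 * (s + 1))"
  have "\<rho> \<ge> 0" using h1_pos s0 by (auto simp: \<rho>_def)
  have close: "\<bar>ln (v w y2) - real (2*N+1) * ln (v w y1)\<bar> \<le> \<rho>"
    if w: "w \<in> W" and y: "y1 = x1 \<and> y2 = x2 \<or> y1 = 1 - x1 \<and> y2 = 1 - x2" for w y1 y2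
  proof -
    define l1 l2 where "l1 = ln (v w y1)" and "l2 = ln (v w y2)"
    have "\<lfloor>real_of_int K * (l1 / h1)\<rfloor> = \<lfloor>real_of_int K * (l2 / h2)\<rfloor>"
      using fun_cong[OF x2(2), of w] w y by (auto simp: key_def l1_def l2_def h1_def h2_def)
    hence "\<bar>real_of_int K * (l2 / h2) - real_of_int K * (l1 / h1)\<bar> \<le> 1" by linarith
    hence "\<bar>real_of_int K * (l2 / h2 - l1 / h1)\<bar> \<le> 1" by (simp add: algebra_simps)
    hence "real_of_int K * \<bar>l2 / h2 - l1 / h1\<bar> \<le> 1" using K s0 by (simp add: abs_mult)
    hence d: "\<bar>l2 / h2 - l1 / h1\<bar> \<le> 1 / (10 * (s + 1))" using K s0 by (simp add: field_simps)
    have h2_pos: "h2 > 0" using h2 s0 h1_pos by (auto simp: A_def intro: less_trans[rotated] mult_pos_pos add_nonneg_pos)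
    have "\<bar>l1\<bar> \<le> h1" unfolding l1_def h1_def
      using y w x1' by (intro abs_ln_le_height) (auto simp: unit_solutions_def)
    have "l2 - real (2*N+1) * l1 = (h2 / h1 - real (2*N+1)) * l1 + h2 * (l2 / h2 - l1 / h1)"
      using h1_pos h2_pos by (simp add: field_simps)
    hence "\<bar>l2 - real (2*N+1) * l1\<bar> \<le> \<bar>h2 / h1 - real (2*N+1)\<bar> * \<bar>l1\<bar> + h2 * \<bar>l2 / h2 - l1 / h1\<bar>"
      using h2_pos by (metis abs_mult abs_of_pos abs_triangle_ineq)
    also have "\<dots> \<le> 2 * h1 + ((2 * real N + 3) * h1) * (1 / (10 * (s + 1)))"
    proof (intro add_mono mult_mono d \<open>\<bar>l1\<bar> \<le> h1\<close>)
      show "\<bar>h2 / h1 - real (2*N+1)\<bar> \<le> 2" using N by (simp add: abs_le_iff)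
      have "h2 / h1 < 2 * real N + 3" using N(2) by (simp add: field_simps)
      thus "h2 \<le> (2 * real N + 3) * h1" using h1_pos by (simp add: field_simps)
    qed (use h1_pos in auto)
    finally show ?thesis by (simp add: l1_def l2_def \<rho>_def)
  qed
  have "N \<noteq> 0"
  proof
    assume "N = 0"
    thus False using N100 s0 by simp
  qed
  hence "N \<ge> 1" by simp
  have "real N * h1 \<le> s * (ln 2 + \<rho> + real (N + 1) * ln 64)"
    unfolding h1_def s_def
    by (rule height_gap[OF x1' x2' \<open>N \<ge> 1\<close> \<open>\<rho> \<ge> 0\<close>]; rule close; simp)
  moreover have "ln (2 :: real) \<le> 1" using ln_le_minus_one[of "2 :: real"] by simp
  moreover have "ln (64 :: real) \<le> 6"
  proof -
    have "ln (64 :: real) = 6 * ln 2" using ln_realpow[of 2 6] by simp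
    thus ?thesis using \<open>ln (2 :: real) \<le> 1\<close> by simp
  qed
  ultimately have "real N * h1 \<le> s * (1 + \<rho> + real (N + 1) * 6)"
    by (elim order.trans) (intro mult_left_mono[OF _ s0] add_mono mult_left_mono; simp)
  also have "\<dots> \<le> s * 1 + s * (2 * h1) + (2 * real N + 3) * h1 / 10 + s * (real (N + 1) * 6)"
  proof -
    have "s / (s + 1) \<le> 1" using s0 by simp
    hence "(s / (s + 1)) * ((2 * real N + 3) * h1 / 10) \<le> 1 * ((2 * real N + 3) * h1 / 10)"
      using h1_pos by (intro mult_right_mono) auto
    moreover have "s * ((2 * real N + 3) * h1 / (10 * (s + 1))) = (s / (s + 1)) * ((2 * real N + 3) * h1 / 10)"
      by simp
    ultimately have "s * ((2 * real N + 3) * h1 / (10 * (s + 1))) \<le> (2 * real N + 3) * h1 / 10"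
      by (simp only: mult_1_left)
    thus ?thesis unfolding \<rho>_def distrib_left add.assoc by (intro add_left_mono add_right_mono)
  qed
  also have "\<dots> \<le> h1 + 2 * s * h1 + (2 * real N + 3) * h1 / 10 + (real N + 1) * h1 * 6 / 100"
  proof -
    have "s * (real (N + 1) * 6) \<le> (h1 / 100) * (real (N + 1) * 6)"
      using h1 by (intro mult_right_mono) auto
    also have "\<dots> = (real N + 1) * h1 * 6 / 100" by simp
    finally show ?thesis using h1 s0 by (intro add_mono) simp_all
  qed
  also have "\<dots> = h1 * (1 + 2 * s + (2 * real N + 3) / 10 + (real N + 1) * 6 / 100)"
    by (simp add: algebra_simps)
  finally have "h1 * real N \<le> h1 * (1 + 2 * s + (2 * real N + 3) / 10 + (real N + 1) * 6 / 100)"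
    by (simp add: mult.commute)
  \<comment> \<open>The right side is about \<open>0.26 * N + 2 * s\<close>, too small for
    \<open>N \<ge> 100 * (s + 1)\<close>.\<close>
  hence "real N \<le> 1 + 2 * s + (2 * real N + 3) / 10 + (real N + 1) * 6 / 100"
    using h1_pos by simp
  thus False using N100 s0 by (simp add: field_simps)
qed

end

section \<open>Algebraic numbers\<close>

text \<open>More than \<open>card B\<close> distinct powers in the span of \<open>B\<close> are
  linearly dependent; a repeated power is an algebraic equation by itself.\<close>

lemma algebraic_if_powers_in_span:
  assumes "finite B" "\<And>k. x ^ k \<in> rat_vs.span B"
  shows "algebraic x"
proof (cases "inj (\<lambda>k::nat. x ^ k)")
  case True
  define S where "S = (\<lambda>k. x ^ k) ` {..card B}"
  have inj: "inj_on (\<lambda>k. x ^ k) {..card B}" using True by (rule inj_on_subset) auto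
  have "card S = Suc (card B)" unfolding S_def using inj by (simp add: card_image)
  moreover have "S \<subseteq> rat_vs.span B" using assms by (auto simp: S_def)
  ultimately have "rat_vs.dependent S"
    using rat_vs.independent_span_bound[OF assms(1), of S] by auto
  moreover have "finite S" by (simp add: S_def)
  ultimately obtain u y where u: "y \<in> S" "u y \<noteq> 0" "(\<Sum>z\<in>S. of_rat (u z) * z) = 0"
    by (subst (asm) rat_vs.dependent_finite) auto
  define p where "p = (\<Sum>k\<le>card B. monom (of_rat (u (x ^ k)) :: complex) k)"
  have "poly p x = (\<Sum>k\<le>card B. of_rat (u (x ^ k)) * x ^ k)"
    by (simp add: p_def poly_sum poly_monom)
  also have "\<dots> = (\<Sum>z\<in>S. of_rat (u z) * z)" unfolding S_def using inj by (simp add: sum.reindex)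
  finally have "poly p x = 0" using u by simp
  moreover have co: "coeff p k = (if k \<le> card B then of_rat (u (x ^ k)) else 0)" for k
    by (simp add: p_def coeff_sum)
  moreover have "p \<noteq> 0"
  proof -
    obtain k where k: "k \<le> card B" "y = x ^ k" using u by (auto simp: S_def)
    hence "coeff p k \<noteq> 0" using u co by simp
    thus ?thesis by auto
  qed
  ultimately show ?thesis by (intro algebraicI'[of p]) auto
next
  case False
  then obtain i j :: nat where ij: "i \<noteq> j" "x ^ i = x ^ j" by (auto simp: inj_def)
  show ?thesis
  proof (rule algebraicI'[of "monom 1 i - monom 1 j"])
    show "monom 1 i - monom 1 j \<noteq> (0 :: complex poly)"
    proof
      assume "monom 1 i - monom 1 j = (0 :: complex poly)"
      hence "coeff (monom 1 i - monom 1 j :: complex poly) i = 0" by simp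
      thus False using ij by simp
    qed
  qed (use ij in \<open>auto simp: poly_monom\<close>)
qed

lemma algebraic_if_number_field: "number_field K \<Longrightarrow> x \<in> K \<Longrightarrow> algebraic x"
proof -
  assume K: "number_field K" and x: "x \<in> K"
  then obtain B where B: "finite B" "rat_vs.span B = K" by (auto simp: number_field_def)
  have "x ^ k \<in> K" for k using K x by (induction k) (auto simp: number_field_def)
  thus ?thesis using B by (intro algebraic_if_powers_in_span[of B]) auto
qed

text \<open>\<open>A\<close> only has to lie in a finite-dimensional \<rat>-space. Its elements are
  then algebraic, which gives the closure properties of algebraic numbers without
  resultants.\<close>

definition finite_ring :: "complex set \<Rightarrow> bool" where
  "finite_ring A \<longleftrightarrow> \<rat> \<subseteq> A \<and> (\<forall>x\<in>A. \<forall>y\<in>A. x + y \<in> A \<and> x * y \<in> A) \<and>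
     (\<exists>B. finite B \<and> A \<subseteq> rat_vs.span B)"

lemma finite_ring_Rats: "finite_ring \<rat>"
proof -
  have "\<rat> \<subseteq> rat_vs.span {1}"
  proof
    fix x :: complex assume "x \<in> \<rat>"
    then obtain q where q: "x = of_rat q" by (rule Rats_cases)
    have "of_rat q * 1 \<in> rat_vs.span {1}" by (intro rat_vs.span_scale rat_vs.span_base) simp
    thus "x \<in> rat_vs.span {1}" using q by simp
  qed
  thus ?thesis unfolding finite_ring_def
    by (intro conjI exI[of _ "{1}"] ballI) auto
qed

lemma finite_ring_power: "finite_ring A \<Longrightarrow> x \<in> A \<Longrightarrow> x ^ k \<in> A"
  by (induction k) (auto simp: finite_ring_def)

lemma finite_ring_sum:
  assumes "finite_ring A" "\<And>i. i \<in> I \<Longrightarrow> f i \<in> A"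
  shows "(\<Sum>i\<in>I. f i) \<in> A"
  using assms(2)
proof (induction I rule: infinite_finite_induct)
  case (insert i I)
  thus ?case using assms(1) by (auto simp: finite_ring_def)
qed (use assms(1) in \<open>auto simp: finite_ring_def\<close>)

lemma algebraic_if_finite_ring: "finite_ring A \<Longrightarrow> x \<in> A \<Longrightarrow> algebraic x"
  using finite_ring_power algebraic_if_powers_in_span unfolding finite_ring_def by (metis subsetD)

text \<open>The new ring is \<open>A[x]\<close>. Powers of \<open>x\<close> from the degree of
  \<open>p\<close> on are lowered by the monic equation, so the products of elements of
  \<open>B\<close> with the lower powers span a space that contains it.\<close>

lemma finite_ring_extend:
  assumes A: "finite_ring A" and p: "lead_coeff p = 1" "\<And>i. coeff p i \<in> A" and x: "poly p x = 0"
  obtains A' where "finite_ring A'" "A \<subseteq> A'" "x \<in> A'"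
proof -
  define A' where "A' = (\<lambda>q. poly q x) ` {q. \<forall>i. coeff q i \<in> A}"
  obtain B where B: "finite B" "A \<subseteq> rat_vs.span B" using A by (auto simp: finite_ring_def)
  define n where "n = degree p"
  define B' where "B' = (\<lambda>(b, i). b * x ^ i) ` (B \<times> {..<n})"
  have fin: "finite B'" using B by (simp add: B'_def)
  have xn: "x ^ n = (\<Sum>i<n. - coeff p i * x ^ i)"
  proof -
    have "0 = (\<Sum>i\<le>n. coeff p i * x ^ i)" using x by (simp add: poly_altdef n_def)
    also have "\<dots> = (\<Sum>i<n. coeff p i * x ^ i) + x ^ n"
      using p(1) by (simp add: lessThan_Suc_atMost [symmetric] n_def)
    finally show ?thesis by (simp add: sum_negf eq_neg_iff_add_eq_0 add.commute)
  qed
  have m1: "- 1 \<in> A" using A by (auto simp: finite_ring_def)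
  have neg: "- y \<in> A" if "y \<in> A" for y
  proof -
    have "(-1) * y \<in> A" using A that m1 unfolding finite_ring_def by blast
    thus ?thesis by simp
  qed
  have key: "a * x ^ k \<in> rat_vs.span B'" if "a \<in> A" for a k
    using that
  proof (induction k arbitrary: a rule: less_induct)
    case (less k)
    show ?case
    proof (cases "k < n")
      case True
      have "b * x ^ k \<in> rat_vs.span B'" if "b \<in> rat_vs.span B" for b
        using that
      proof (induction rule: rat_vs.span_induct_alt)
        case (step c b y)
        have "b * x ^ k \<in> B'" using step True by (auto simp: B'_def)
        hence "of_rat c * (b * x ^ k) + y * x ^ k \<in> rat_vs.span B'"
          using step by (intro rat_vs.span_add rat_vs.span_scale) (auto intro: rat_vs.span_base)
        thus ?case by (simp add: algebra_simps)
      qed (simp add: rat_vs.span_zero)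
      thus ?thesis using less B by blast
    next
      case False
      hence "a * x ^ k = a * (x ^ (k - n) * x ^ n)" by (simp add: power_add [symmetric])
      also have "\<dots> = (\<Sum>i<n. (a * - coeff p i) * x ^ (k - n + i))"
        unfolding xn by (simp add: sum_distrib_left power_add mult_ac)
      also have "\<dots> \<in> rat_vs.span B'"
      proof (intro rat_vs.span_sum less)
        fix i assume "i \<in> {..<n}"
        thus "k - n + i < k" using False by auto
        show "a * - coeff p i \<in> A" using A less(2) neg[OF p(2)[of i]] unfolding finite_ring_def by blast
      qed
      finally show ?thesis .
    qed
  qed
  have "A' \<subseteq> rat_vs.span B'"
    unfolding A'_def by (auto simp: poly_altdef intro!: rat_vs.span_sum key)
  moreover have "A \<subseteq> A'"
  proof
    fix a assume "a \<in> A"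
    hence "\<forall>i. coeff [:a:] i \<in> A" using A by (auto simp: coeff_pCons finite_ring_def split: nat.splits)
    thus "a \<in> A'" unfolding A'_def by (intro image_eqI[of _ _ "[:a:]"]) auto
  qed
  moreover have "x \<in> A'"
  proof -
    have "\<forall>i. coeff [:0, 1:] i \<in> A" using A by (auto simp: coeff_pCons finite_ring_def split: nat.splits)
    thus "x \<in> A'" unfolding A'_def by (intro image_eqI[of _ _ "[:0, 1:]"]) auto
  qed
  moreover have "a + b \<in> A' \<and> a * b \<in> A'" if ab: "a \<in> A'" "b \<in> A'" for a b
  proof -
    obtain q r where q: "a = poly q x" "\<forall>i. coeff q i \<in> A" "b = poly r x" "\<forall>i. coeff r i \<in> A"
      using ab by (auto simp: A'_def)
    have "\<forall>i. coeff (q + r) i \<in> A" using q A by (auto simp: finite_ring_def)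
    moreover have "\<forall>i. coeff (q * r) i \<in> A"
      using q A unfolding coeff_mult by (auto intro!: finite_ring_sum[OF A]) (auto simp: finite_ring_def)
    ultimately show ?thesis unfolding A'_def q(1,3) poly_add [symmetric] poly_mult [symmetric] by blast
  qed
  ultimately have "finite_ring A'" unfolding finite_ring_def using fin A
    by (metis finite_ring_def order.trans)
  thus thesis using that \<open>A \<subseteq> A'\<close> \<open>x \<in> A'\<close> by blast
qed

lemma algebraic_monic:
  assumes "algebraic (x :: complex)"
  obtains p where "lead_coeff p = 1" "\<And>i. coeff p i \<in> \<rat>" "poly p x = 0"
proof -
  obtain q where q: "\<And>i. coeff q i \<in> \<rat>" "q \<noteq> 0" "poly q x = 0"
    using assms unfolding algebraic_altdef by blast
  define c where "c = inverse (lead_coeff q)"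
  have c: "c \<in> \<rat>" "c * lead_coeff q = 1" "c \<noteq> 0" using q by (simp_all add: c_def)
  show thesis
  proof (rule that)
    show "lead_coeff (smult c q) = 1" using c by (simp add: degree_smult_eq)
    show "coeff (smult c q) i \<in> \<rat>" for i using c q by simp
    show "poly (smult c q) x = 0" using q by simp
  qed
qed

lemma finite_ring_of_algebraics:
  assumes "finite X" "\<And>x. x \<in> X \<Longrightarrow> algebraic x"
  obtains A where "finite_ring A" "X \<subseteq> A"
proof -
  have "\<exists>A. finite_ring A \<and> X \<subseteq> A"
    using assms
  proof (induction X rule: finite_induct)
    case (insert x X)
    then obtain A where A: "finite_ring A" "X \<subseteq> A" by auto
    obtain p where p: "lead_coeff p = 1" "\<And>i. coeff p i \<in> \<rat>" "poly p x = 0"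
      using insert algebraic_monic by blast
    have "\<And>i. coeff p i \<in> A" using p(2) A(1) unfolding finite_ring_def by blast
    then obtain A' where "finite_ring A'" "A \<subseteq> A'" "x \<in> A'"
      by (rule finite_ring_extend[OF A(1) p(1) _ p(3)])
    thus ?case using A by blast
  qed (use finite_ring_Rats in blast)
  thus thesis using that by blast
qed

lemma algebraic_add:
  assumes "algebraic x" "algebraic y"
  shows "algebraic (x + y :: complex)"
proof -
  obtain A where "finite_ring A" "{x, y} \<subseteq> A" using finite_ring_of_algebraics[of "{x, y}"] assms by auto
  thus ?thesis using algebraic_if_finite_ring[of A "x + y"] by (auto simp: finite_ring_def)
qed

lemma algebraic_mult:
  assumes "algebraic x" "algebraic y"
  shows "algebraic (x * y :: complex)"
proof -
  obtain A where "finite_ring A" "{x, y} \<subseteq> A" using finite_ring_of_algebraics[of "{x, y}"] assms by auto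
  thus ?thesis using algebraic_if_finite_ring[of A "x * y"] by (auto simp: finite_ring_def)
qed

lemma algebraic_diff: "algebraic x \<Longrightarrow> algebraic y \<Longrightarrow> algebraic (x - y :: complex)"
  using algebraic_add[of x "- y"] by simp

lemma algebraic_divide: "algebraic x \<Longrightarrow> algebraic y \<Longrightarrow> algebraic (x / y :: complex)"
  using algebraic_mult[of x "inverse y"] by (auto simp: divide_inverse)

lemma algebraic_power: "algebraic x \<Longrightarrow> algebraic (x ^ n :: complex)"
  by (induction n) (auto intro: algebraic_mult)

lemma algebraic_sum: "(\<And>i. i \<in> I \<Longrightarrow> algebraic (f i)) \<Longrightarrow> algebraic (\<Sum>i\<in>I. f i :: complex)"
  by (induction I rule: infinite_finite_induct) (auto intro: algebraic_add)

text \<open>The coefficients of the monic multiple lie in a common \<open>finite_ring\<close>, to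
  which the root can be adjoined. This makes the zeros and poles of \<phi> algebraic.\<close>

lemma algebraic_poly_root:
  assumes "p \<noteq> 0" "\<And>i. algebraic (coeff p i)" "poly p x = (0 :: complex)"
  shows "algebraic x"
proof -
  define q where "q = smult (inverse (lead_coeff p)) p"
  have q: "lead_coeff q = 1" "poly q x = 0" "algebraic (coeff q i)" for i
    using assms by (auto simp: q_def intro: algebraic_mult)
  obtain A where A: "finite_ring A" "coeff q ` {..degree q} \<subseteq> A"
    using finite_ring_of_algebraics[of "coeff q ` {..degree q}"] q by auto
  have "coeff q i \<in> A" for i
    using A by (cases "i \<le> degree q") (auto simp: coeff_eq_0 finite_ring_def)
  then obtain A' where "finite_ring A'" "x \<in> A'"
    by (rule finite_ring_extend[OF A(1) q(1) _ q(2)])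
  thus ?thesis by (rule algebraic_if_finite_ring)
qed

section \<open>Extensions of the p-adic absolute value\<close>

definition subring :: "complex set \<Rightarrow> bool" where
  "subring B \<longleftrightarrow> 1 \<in> B \<and> (\<forall>x\<in>B. \<forall>y\<in>B. x + y \<in> B \<and> x * y \<in> B) \<and> (\<forall>x\<in>B. - x \<in> B)"

lemma inverse_prime_notin_Ints: "prime p \<Longrightarrow> inverse (of_nat p :: complex) \<notin> \<int>"
proof
  assume p: "prime p" and "inverse (of_nat p :: complex) \<in> \<int>"
  then obtain k where k: "inverse (of_nat p :: complex) = of_int k" by (auto elim: Ints_cases)
  have "of_nat p \<noteq> (0::complex)" using p by auto
  hence "(of_int (k * int p) :: complex) = 1" using k by (simp add: field_simps)
  hence "k * int p = 1" by (metis of_int_eq_1_iff)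
  hence "int p dvd 1" by (metis dvd_triv_right)
  thus False using p by auto
qed

text \<open>Zorn's lemma; the integers show that the family is nonempty. Such a ring will turn out
  to be a valuation ring in which \<open>p\<close> is not a unit, and so yields an extension of the
  p-adic absolute value.\<close>

lemma maximal_subring:
  assumes "prime p"
  obtains B where "subring B" "inverse (of_nat p) \<notin> B"
    "\<And>B'. subring B' \<Longrightarrow> inverse (of_nat p) \<notin> B' \<Longrightarrow> B \<subseteq> B' \<Longrightarrow> B' = B"
proof -
  define \<A> where "\<A> = {B. subring B \<and> inverse (of_nat p) \<notin> B}"
  have "\<int> \<in> \<A>" using inverse_prime_notin_Ints[OF assms] by (simp add: \<A>_def subring_def)
  hence "\<A> \<noteq> {}" by blast
  moreover have "\<Union>C \<in> \<A>" if C: "C \<noteq> {}" "subset.chain \<A> C" for C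
  proof -
    have CA: "B \<in> C \<Longrightarrow> subring B" "B \<in> C \<Longrightarrow> inverse (of_nat p) \<notin> B" for B
      using C(2) by (auto simp: subset_chain_def \<A>_def)
    have "x + y \<in> \<Union>C \<and> x * y \<in> \<Union>C" if xy: "x \<in> \<Union>C" "y \<in> \<Union>C" for x y
    proof -
      obtain X Y where XY: "X \<in> C" "Y \<in> C" "x \<in> X" "y \<in> Y" using xy by auto
      have "X \<subseteq> Y \<or> Y \<subseteq> X" using C(2) XY by (auto simp: subset_chain_def)
      then obtain Z where "Z \<in> C" "x \<in> Z" "y \<in> Z" using XY by blast
      thus ?thesis using CA(1)[of Z] by (auto simp: subring_def)
    qed
    moreover have "1 \<in> \<Union>C" using C(1) CA(1) by (auto simp: subring_def)
    moreover have "- x \<in> \<Union>C" if "x \<in> \<Union>C" for x using that CA(1) unfolding subring_def by blast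
    ultimately show ?thesis using CA(2) by (auto simp: \<A>_def subring_def)
  qed
  ultimately obtain B where B: "B \<in> \<A>" "\<And>X. X \<in> \<A> \<Longrightarrow> B \<subseteq> X \<Longrightarrow> X = B"
    using subset_Zorn_nonempty[of \<A>] by metis
  show thesis by (rule that[of B]) (use B in \<open>auto simp: \<A>_def\<close>)
qed

locale maximal_ring =
  fixes p :: nat and B :: "complex set"
  assumes prime: "prime p" and subring: "subring B" and p_inv: "inverse (of_nat p) \<notin> B"
    and maximal: "\<And>B'. subring B' \<Longrightarrow> inverse (of_nat p) \<notin> B' \<Longrightarrow> B \<subseteq> B' \<Longrightarrow> B' = B"
begin

abbreviation "P \<equiv> (of_nat p :: complex)"

lemma P_nz [simp]: "P \<noteq> 0" "p \<noteq> 0" using prime by auto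

lemma B_1: "1 \<in> B" and B_add: "x \<in> B \<Longrightarrow> y \<in> B \<Longrightarrow> x + y \<in> B"
  and B_mult: "x \<in> B \<Longrightarrow> y \<in> B \<Longrightarrow> x * y \<in> B" and B_uminus: "x \<in> B \<Longrightarrow> - x \<in> B"
  using subring by (auto simp: subring_def)

lemma B_diff: "x \<in> B \<Longrightarrow> y \<in> B \<Longrightarrow> x - y \<in> B"
  using B_add[of x "- y"] B_uminus by simp

lemma B_0: "0 \<in> B" using B_diff[OF B_1 B_1] by simp

lemma B_power: "x \<in> B \<Longrightarrow> x ^ n \<in> B"
  by (induction n) (auto intro: B_1 B_mult)

lemma B_sum: "(\<And>i. i \<in> I \<Longrightarrow> f i \<in> B) \<Longrightarrow> (\<Sum>i\<in>I. f i) \<in> B"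
  by (induction I rule: infinite_finite_induct) (auto intro: B_0 B_add)

lemma B_of_nat: "of_nat n \<in> B"
  by (induction n) (auto intro: B_0 B_1 B_add)

lemma B_of_int: "of_int n \<in> B"
  by (cases n rule: int_cases2) (auto intro: B_of_nat B_uminus)

text \<open>By maximality \<open>B[x]\<close> contains \<open>1 / p\<close>. Maximality enters the
  sequel only in this form.\<close>

lemma adjoin:
  assumes "x \<notin> B"
  obtains q where "q \<in> polys_over B" "poly q x = inverse P"
proof -
  define B' where "B' = (\<lambda>q. poly q x) ` polys_over B"
  have "subring B'" unfolding subring_def
  proof (intro conjI ballI)
    show "1 \<in> B'" unfolding B'_def
      by (rule image_eqI[of _ _ 1]) (auto simp: polys_over_def B_0 B_1 coeff_1)
    fix y assume "y \<in> B'"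
    then obtain q where q: "q \<in> polys_over B" "y = poly q x" by (auto simp: B'_def)
    show "- y \<in> B'" unfolding B'_def
      by (rule image_eqI[of _ _ "- q"]) (use q in \<open>auto simp: polys_over_def intro: B_uminus\<close>)
    fix z assume "z \<in> B'"
    then obtain r where r: "r \<in> polys_over B" "z = poly r x" by (auto simp: B'_def)
    show "y + z \<in> B'" unfolding B'_def
      by (rule image_eqI[of _ _ "q + r"]) (use q r in \<open>auto simp: polys_over_def intro: B_add\<close>)
    show "y * z \<in> B'" unfolding B'_def
      by (rule image_eqI[of _ _ "q * r"])
        (use q r in \<open>auto simp: polys_over_def coeff_mult intro!: B_sum B_mult\<close>)
  qed
  moreover have "B \<subseteq> B'"
  proof
    fix b assume "b \<in> B"
    hence "[:b:] \<in> polys_over B" by (auto simp: polys_over_def coeff_pCons B_0 split: nat.splits)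
    thus "b \<in> B'" unfolding B'_def by (intro image_eqI[of _ _ "[:b:]"]) auto
  qed
  moreover have "x \<in> B'"
  proof -
    have "[:0, 1:] \<in> polys_over B" by (auto simp: polys_over_def coeff_pCons B_0 B_1 split: nat.splits)
    thus "x \<in> B'" unfolding B'_def by (intro image_eqI[of _ _ "[:0, 1:]"]) auto
  qed
  ultimately have "inverse P \<in> B'" using maximal[of B'] assms by blast
  thus thesis using that by (auto simp: B'_def)
qed

text \<open>Here \<open>p\<close> lies in the Jacobson radical, although \<open>B\<close> is not yet known to be local.\<close>
lemma inverse_one_minus:
  assumes "c \<in> B"
  shows "1 - P * c \<noteq> 0" "inverse (1 - P * c) \<in> B"
proof -
  define y where "y = 1 - P * c"
  show nz: "1 - P * c \<noteq> 0"
  proof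
    assume "1 - P * c = 0"
    hence "c = inverse P" by (simp add: field_simps)
    thus False using assms p_inv by simp
  qed
  have yB: "y \<in> B" unfolding y_def by (intro B_diff B_1 B_mult B_of_nat assms)
  show "inverse (1 - P * c) \<in> B"
  proof (rule ccontr)
    assume "inverse (1 - P * c) \<notin> B"
    then obtain q where q: "q \<in> polys_over B" "poly q (inverse y) = inverse P"
      using adjoin unfolding y_def by blast
    define n where "n = degree q"
    have "y ^ n * inverse P = (\<Sum>i\<le>n. coeff q i * y ^ (n - i))"
    proof -
      have "y ^ n * inverse y ^ i = y ^ (n - i)" if "i \<le> n" for i
        using that nz by (simp add: y_def power_inverse power_diff field_simps)
      thus ?thesis unfolding q(2) [symmetric] poly_altdef n_def [symmetric]
        by (auto simp: sum_distrib_left mult_ac intro!: sum.cong)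
    qed
    also have "\<dots> \<in> B" using q(1) by (intro B_sum B_mult B_power yB) (auto simp: polys_over_def)
    finally have 1: "y ^ n * inverse P \<in> B" .
    \<comment> \<open>\<open>y\<close> is 1 modulo \<open>P\<close>, hence so is
      \<open>y ^ n\<close>; thus \<open>y ^ n / P\<close> and \<open>1 / P\<close> differ by an
      element of \<open>B\<close>.\<close>
    have "\<exists>c'\<in>B. y ^ k = 1 - P * c'" for k
    proof (induction k)
      case (Suc k)
      then obtain c' where c': "c' \<in> B" "y ^ k = 1 - P * c'" by auto
      have "y ^ Suc k = 1 - P * (c + y * c')" unfolding power_Suc c'(2) by (simp add: y_def algebra_simps)
      thus ?case using c' assms yB by (intro bexI[of _ "c + y * c'"] B_add B_mult) auto
    qed (auto intro: B_0)
    then obtain c' where c': "c' \<in> B" "y ^ n = 1 - P * c'" by blast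
    have "inverse P = y ^ n * inverse P + c'" unfolding c' by (simp add: algebra_simps)
    thus False using B_add[OF 1 c'(1)] p_inv by simp
  qed
qed

text \<open>As \<open>1 - P * coeff r 0\<close> is invertible, the equation of \<open>1 / x\<close>
  writes 1 as a combination of negative powers of \<open>x\<close>. Multiplied by the leading term
  of \<open>q\<close>, this replaces that term by lower ones; the degree condition keeps the
  exponents nonnegative.\<close>

lemma reduce_degree:
  assumes "x \<noteq> 0" and q: "q \<in> polys_over B" "poly q x = inverse P"
    and r: "r \<in> polys_over B" "poly r (inverse x) = inverse P" and le: "degree r \<le> degree q"
  obtains q' where "q' \<in> polys_over B" "poly q' x = inverse P" "degree q' < degree q"
proof -
  define n where "n = degree q"
  define m where "m = degree r"
  have qB: "coeff q i \<in> B" and rB: "coeff r i \<in> B" for i using q r by (auto simp: polys_over_def)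
  have "n \<noteq> 0"
  proof
    assume "n = 0"
    then obtain a where "q = [:a:]" by (metis n_def degree_eq_zeroE)
    hence "inverse P \<in> B" using q qB[of 0] by simp
    thus False using p_inv by simp
  qed
  define u where "u = inverse (1 - P * coeff r 0)"
  have u: "u \<in> B" "u * (1 - P * coeff r 0) = 1"
    using inverse_one_minus[OF rB[of 0]] by (auto simp: u_def)
  have "1 = P * poly r (inverse x)" using r by simp
  also have "poly r (inverse x) = coeff r 0 + (\<Sum>j\<in>{1..m}. coeff r j * inverse x ^ j)"
    unfolding poly_altdef m_def [symmetric] by (subst atMost_atLeast0, subst sum.atLeast_Suc_atMost) auto
  finally have "1 - P * coeff r 0 = P * (\<Sum>j\<in>{1..m}. coeff r j * inverse x ^ j)"
    by (simp add: algebra_simps)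
  hence one: "1 = u * (P * (\<Sum>j\<in>{1..m}. coeff r j * inverse x ^ j))" using u by simp
  define t where "t = (\<Sum>j\<in>{1..m}. monom (coeff q n * u * P * coeff r j) (n - j))"
  have "poly t x = coeff q n * x ^ n"
  proof -
    have "x ^ n * inverse x ^ j = x ^ (n - j)" if "j \<in> {1..m}" for j
      using that assms(1) le by (simp add: m_def n_def power_inverse power_diff field_simps)
    hence "poly t x = (\<Sum>j\<in>{1..m}. (coeff q n * u * P * coeff r j) * (x ^ n * inverse x ^ j))"
      unfolding t_def by (simp add: poly_sum poly_monom)
    also have "\<dots> = coeff q n * x ^ n * (u * (P * (\<Sum>j\<in>{1..m}. coeff r j * inverse x ^ j)))"
      by (simp add: sum_distrib_left mult_ac)
    finally show ?thesis unfolding one [symmetric] by simp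
  qed
  define q' where "q' = q - monom (coeff q n) n + t"
  have "poly q' x = inverse P" using q \<open>poly t x = _\<close> by (simp add: q'_def poly_monom)
  moreover have "q' \<in> polys_over B"
    unfolding polys_over_def q'_def t_def
    by (auto simp: coeff_sum intro!: B_add B_diff B_sum B_mult qB rB u B_of_nat B_0)
  moreover have "degree q' < n"
  proof -
    have "degree (q - monom (coeff q n) n) \<le> n" by (intro degree_diff_le degree_monom_le) (simp add: n_def)
    moreover have "coeff (q - monom (coeff q n) n) n = 0" by simp
    ultimately have "degree (q - monom (coeff q n) n) < n"
      using \<open>n \<noteq> 0\<close> by (metis degree_0 gr0I leading_coeff_0_iff le_neq_implies_less)
    moreover have "degree t < n"
    proof -
      have "degree t \<le> n - 1" unfolding t_def
        by (intro degree_sum_le) (auto intro!: order.trans[OF degree_monom_le])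
      thus ?thesis using \<open>n \<noteq> 0\<close> by simp
    qed
    ultimately show ?thesis unfolding q'_def by (rule degree_add_less)
  qed
  ultimately show thesis using that n_def by blast
qed

text \<open>Infinite descent: of the equations for \<open>x\<close> and \<open>1 / x\<close>, the
  one of larger degree is reduced by means of the other.\<close>

lemma valuation_ring: "x \<noteq> 0 \<Longrightarrow> x \<in> B \<or> inverse x \<in> B"
proof (rule ccontr)
  assume x: "x \<noteq> 0" and "\<not> (x \<in> B \<or> inverse x \<in> B)"
  then obtain q r where "q \<in> polys_over B" "poly q x = inverse P"
      "r \<in> polys_over B" "poly r (inverse x) = inverse P"
    using adjoin[of x] adjoin[of "inverse x"] by metis
  thus False using x
  proof (induction "degree q + degree r" arbitrary: q r x rule: less_induct)
    case less
    show False
    proof (cases "degree r \<le> degree q")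
      case True
      obtain q' where "q' \<in> polys_over B" "poly q' x = inverse P" "degree q' < degree q"
        using reduce_degree[OF less(6,2,3,4,5) True] by blast
      thus False using less(1)[of q' r x] less(2-6) by auto
    next
      case False
      have "inverse x \<noteq> 0" "poly q (inverse (inverse x)) = inverse P" "degree q \<le> degree r" using less False by auto
      then obtain r' where "r' \<in> polys_over B" "poly r' (inverse x) = inverse P" "degree r' < degree r"
        using reduce_degree[of "inverse x" r q] less(2-5) by blast
      thus False using less(1)[of q r' x] less(2-6) by auto
    qed
  qed
qed

section \<open>Units of the valuation ring and the order function\<close>

definition bunit :: "complex \<Rightarrow> bool" where
  "bunit x \<longleftrightarrow> x \<noteq> 0 \<and> x \<in> B \<and> inverse x \<in> B"

lemma bunit_1: "bunit 1" by (simp add: bunit_def B_1)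
lemma bunit_mult: "bunit x \<Longrightarrow> bunit y \<Longrightarrow> bunit (x * y)" by (auto simp: bunit_def intro: B_mult)
lemma bunit_inverse: "bunit x \<Longrightarrow> bunit (inverse x)" by (auto simp: bunit_def)
lemma bunit_divide: "bunit x \<Longrightarrow> bunit y \<Longrightarrow> bunit (x / y)"
  by (simp add: divide_inverse bunit_mult bunit_inverse)
lemma bunit_power: "bunit x \<Longrightarrow> bunit (x ^ n)" by (induction n) (auto intro: bunit_1 bunit_mult)

lemma bunit_P_powi: "bunit (P powi k) \<longleftrightarrow> k = 0"
proof
  have *: "k \<le> 0" if "P powi (-k) \<in> B" for k
  proof (rule ccontr)
    assume "\<not> k \<le> 0"
    then obtain n where k: "k = int (Suc n)" by (metis not_le zero_less_imp_eq_int Suc_pred)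
    have "P powi (-k) = inverse (P ^ Suc n)" by (simp only: k power_int_minus power_int_of_nat)
    hence "inverse P = P ^ n * P powi (-k)" by (simp add: field_simps)
    thus False using that p_inv B_mult[OF B_power[OF B_of_nat[of p]]] by metis
  qed
  assume "bunit (P powi k)"
  hence "P powi k \<in> B" "P powi (-k) \<in> B" by (auto simp: bunit_def power_int_minus)
  thus "k = 0" using *[of k] *[of "-k"] by simp
qed (simp add: bunit_1)

text \<open>Of two nonzero elements one divides the other in \<open>B\<close>, so if their sum were
  a unit, the divisor would be one too.\<close>

lemma nonunit_sum:
  assumes "finite I" "\<And>i. i \<in> I \<Longrightarrow> f i \<in> B \<and> \<not> bunit (f i)"
  shows "(\<Sum>i\<in>I. f i) \<in> B \<and> \<not> bunit (\<Sum>i\<in>I. f i)"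
  using assms
proof (induction I rule: finite_induct)
  case (insert i I)
  have two: "\<not> bunit (a + b)" if "a \<in> B" "b \<in> B" "\<not> bunit a" "\<not> bunit b" "b \<noteq> 0" "a / b \<in> B" for a b
  proof
    assume "bunit (a + b)"
    hence "inverse (a + b) \<in> B" "a + b \<noteq> 0" by (auto simp: bunit_def)
    moreover have "inverse b = (1 + a / b) * inverse (a + b)"
      using \<open>b \<noteq> 0\<close> \<open>a + b \<noteq> 0\<close> by (simp add: field_simps)
    ultimately have "inverse b \<in> B" using that by (metis B_mult B_add B_1)
    thus False using that by (auto simp: bunit_def)
  qed
  define a where "a = f i"
  define b where "b = (\<Sum>j\<in>I. f j)"
  have ab: "a \<in> B" "\<not> bunit a" "b \<in> B" "\<not> bunit b" using insert by (auto simp: a_def b_def)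
  have "\<not> bunit (a + b)"
  proof (cases "a = 0 \<or> b = 0")
    case False
    hence "a / b \<in> B \<or> b / a \<in> B" using valuation_ring[of "a / b"] by auto
    thus ?thesis using two[of a b] two[of b a] ab False by (auto simp: add.commute)
  qed (use ab in auto)
  thus ?case using insert ab by (simp add: a_def b_def B_add)
qed (auto simp: B_0 bunit_def)

lemma exists_dominant:
  assumes "finite I" "I \<noteq> {}" "\<And>i. i \<in> I \<Longrightarrow> t i \<noteq> 0"
  shows "\<exists>j\<in>I. \<forall>i\<in>I. t i / t j \<in> B"
  using assms
proof (induction I rule: finite_ne_induct)
  case (insert k I)
  then obtain j where j: "j \<in> I" "\<forall>i\<in>I. t i / t j \<in> B" by auto
  have nz: "t j \<noteq> 0" "t k \<noteq> 0" using insert j by auto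
  hence "t k / t j \<in> B \<or> t j / t k \<in> B" using valuation_ring[of "t k / t j"] by auto
  thus ?case
  proof
    assume "t j / t k \<in> B"
    hence "t i / t k \<in> B" if "i \<in> I" for i
      using that j B_mult[of "t i / t j" "t j / t k"] nz by auto
    thus ?thesis using nz by (auto simp: B_1)
  qed (use j in blast)
qed (auto simp: B_1)

text \<open>After division by a dominant term the others sum to -1, a unit, so they cannot all be
  nonunits.\<close>

lemma two_equivalent_terms:
  assumes "finite I" "I \<noteq> {}" "\<And>i. i \<in> I \<Longrightarrow> t i \<noteq> 0" "(\<Sum>i\<in>I. t i) = 0"
  obtains i j where "i \<in> I" "j \<in> I" "i \<noteq> j" "bunit (t i / t j)"
proof -
  obtain j where j: "j \<in> I" "\<forall>i\<in>I. t i / t j \<in> B" using exists_dominant assms(1-3) by blast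
  have "\<exists>i\<in>I-{j}. bunit (t i / t j)"
  proof (rule ccontr)
    assume "\<not> ?thesis"
    hence "\<not> bunit (\<Sum>i\<in>I-{j}. t i / t j)" using nonunit_sum[of "I-{j}" "\<lambda>i. t i / t j"] assms(1) j by auto
    moreover have "0 = t j + (\<Sum>i\<in>I-{j}. t i)" using assms(1,4) j by (metis sum.remove)
    hence "(\<Sum>i\<in>I-{j}. t i) = - t j" by (simp add: eq_neg_iff_add_eq_0 add.commute)
    hence "(\<Sum>i\<in>I-{j}. t i / t j) = -1"
      using assms(3) j(1) by (simp add: sum_divide_distrib [symmetric])
    moreover have "bunit (-1)" by (auto simp: bunit_def intro: B_uminus B_1)
    ultimately show False by simp
  qed
  thus thesis using that j by auto
qed

text \<open>By Bezout \<open>n * s = 1 - p * t\<close>, which is invertible by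
  \<open>inverse_one_minus\<close>.\<close>

lemma bunit_coprime:
  assumes "\<not> int p dvd n"
  shows "bunit (of_int n)"
proof -
  have "coprime n (int p)" using assms prime by (metis coprime_commute prime_imp_coprime prime_nat_int_transfer)
  then obtain s t where "n * s + int p * t = 1"
    by (metis bezout_int coprime_imp_gcd_eq_1 mult.commute)
  hence "of_int n * of_int s + P * of_int t = 1" by (metis of_int_add of_int_mult of_int_1 of_int_of_nat_eq)
  hence e: "of_int n * of_int s = 1 - P * of_int t" by (simp add: algebra_simps)
  have i: "1 - P * of_int t \<noteq> 0" "inverse (1 - P * of_int t) \<in> B" using inverse_one_minus[OF B_of_int] by auto
  have nz: "of_int n \<noteq> (0::complex)" using e i by auto
  hence "inverse (of_int n) = of_int s * inverse (1 - P * of_int t)"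
    using e i by (simp add: field_simps)
  also have "\<dots> \<in> B" using i by (intro B_mult B_of_int)
  finally show ?thesis using nz by (auto simp: bunit_def B_of_int)
qed

lemma bunit_of_int:
  assumes "n \<noteq> 0"
  obtains k :: nat where "bunit (of_int n / P ^ k)"
proof -
  obtain m where m: "n = int p ^ multiplicity (int p) n * m" "\<not> int p dvd m"
    using multiplicity_decompose'[of n "int p"] assms prime by (metis not_prime_unit prime_nat_int_transfer)
  have "of_int n / P ^ multiplicity (int p) n = of_int m"
    by (subst m(1)) simp
  thus thesis using that bunit_coprime[OF m(2)] by metis
qed

text \<open>
  In an integral equation for \<open>x\<close> two terms must have the same valuation, so a power of \<open>x\<close> is a power of \<open>p\<close> up
  to a unit. In particular the value group is of rank one on algebraic numbers.
\<close>
lemma exists_valuation: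
  assumes "algebraic x" "x \<noteq> 0"
  obtains e :: nat and a :: int where "e > 0" "bunit (x ^ e / P powi a)"
proof -
  note result = that
  obtain q where q: "\<And>i. coeff q i \<in> \<int>" "q \<noteq> 0" "poly q x = 0" using assms(1) unfolding algebraic_def by blast
  define I where "I = {i. i \<le> degree q \<and> coeff q i \<noteq> 0}"
  have fin: "finite I" "I \<noteq> {}" using q(2) by (auto simp: I_def)
  have "(\<Sum>i\<in>I. coeff q i * x ^ i) = poly q x"
    unfolding poly_altdef I_def by (intro sum.mono_neutral_left) auto
  then obtain i j where ij: "i \<in> I" "j \<in> I" "i \<noteq> j" "bunit (coeff q i * x ^ i / (coeff q j * x ^ j))"
    using two_equivalent_terms[OF fin, of "\<lambda>i. coeff q i * x ^ i"] assms(2) q(3) by (auto simp: I_def)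
  have wlog: thesis if ij: "i \<in> I" "j \<in> I" "j < i" "bunit (coeff q i * x ^ i / (coeff q j * x ^ j))" for i j
  proof -
    have "\<exists>k::nat. bunit (coeff q i / P ^ k)" if "i \<in> I" for i
    proof -
      obtain n where "coeff q i = of_int n" using q(1)[of i] by (auto elim: Ints_cases)
      thus ?thesis using that bunit_of_int[of n] by (auto simp: I_def)
    qed
    then obtain k l where kl: "bunit (coeff q i / P ^ k)" "bunit (coeff q j / P ^ l)" using ij by blast
    have nz: "coeff q i \<noteq> 0" "coeff q j \<noteq> 0" using ij by (auto simp: I_def)
    have "x ^ (i - j) / P powi (int l - int k) =
       (coeff q i * x ^ i / (coeff q j * x ^ j)) * ((coeff q j / P ^ l) / (coeff q i / P ^ k))"
      using nz assms(2) ij(3) by (simp add: power_int_diff power_diff)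
    moreover have "bunit \<dots>" by (intro bunit_mult bunit_divide ij kl)
    ultimately show thesis using result[of "i - j" "int l - int k"] ij(3) by simp
  qed
  show thesis
  proof (cases "j < i")
    case False
    have "bunit (coeff q j * x ^ j / (coeff q i * x ^ i))" using bunit_inverse[OF ij(4)] by simp
    thus thesis using wlog[of j i] False ij by auto
  qed (use wlog[of i j] ij in auto)
qed

definition ord :: "complex \<Rightarrow> real" where
  "ord x = (SOME r. \<exists>(e::nat) (a::int). e > 0 \<and> bunit (x ^ e / P powi a) \<and> r = of_int a / of_nat e)"

text \<open>Independence of the choice in \<open>ord\<close>: raised to crossed exponents, two
  descriptions of \<open>x\<close> differ by a unit that is a power of \<open>P\<close>, and only
  \<open>P ^ 0\<close> is a unit.\<close>

lemma ord_eq: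
  assumes "e > 0" "bunit (x ^ e / P powi a)"
  shows "ord x = of_int a / of_nat e"
proof -
  have "\<exists>e a. e > 0 \<and> bunit (x ^ e / P powi a) \<and> ord x = of_int a / of_nat e"
    unfolding ord_def by (rule someI_ex) (use assms in blast)
  then obtain e' a' where e': "e' > 0" "bunit (x ^ e' / P powi a')" "ord x = of_int a' / of_nat e'" by blast
  have x0: "x \<noteq> 0" using assms by (auto simp: bunit_def)
  have "bunit ((x ^ e / P powi a) ^ e' / (x ^ e' / P powi a') ^ e)"
    by (intro bunit_divide[OF bunit_power[OF assms(2)] bunit_power[OF e'(2)]])
  also have "(x ^ e / P powi a) ^ e' / (x ^ e' / P powi a') ^ e = P powi (a' * int e - a * int e')"
    using x0 by (simp add: power_divide power_mult [symmetric] power_int_diff power_int_mult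
        power_int_of_nat mult.commute)
  finally have "a' * int e = a * int e'" by (simp add: bunit_P_powi)
  hence "real_of_int a' * real e = real_of_int a * real e'" by (metis of_int_mult of_int_of_nat_eq)
  thus ?thesis unfolding e'(3) using assms(1) e'(1) by (simp add: field_simps)
qed

lemma ord_mult:
  assumes "algebraic x" "algebraic y" "x \<noteq> 0" "y \<noteq> 0"
  shows "ord (x * y) = ord x + ord y"
proof -
  obtain e a where x: "e > 0" "bunit (x ^ e / P powi a)" using exists_valuation assms by blast
  obtain e' a' where y: "e' > 0" "bunit (y ^ e' / P powi a')" using exists_valuation assms by blast
  have "bunit ((x ^ e / P powi a) ^ e' * (y ^ e' / P powi a') ^ e)"
    by (intro bunit_mult[OF bunit_power[OF x(2)] bunit_power[OF y(2)]])
  also have "(x ^ e / P powi a) ^ e' * (y ^ e' / P powi a') ^ e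
      = (x * y) ^ (e * e') / P powi (a * int e' + a' * int e)"
    by (simp add: power_divide power_mult [symmetric] power_mult_distrib power_int_add power_int_mult
        power_int_of_nat mult.commute)
  finally have bu: "bunit ((x * y) ^ (e * e') / P powi (a * int e' + a' * int e))" .
  have ee: "e * e' > 0" using x(1) y(1) by simp
  have "of_int (a * int e' + a' * int e) / of_nat (e * e') = real_of_int a / of_nat e + of_int a' / of_nat e'"
    using x(1) y(1) by (simp add: add_divide_distrib)
  thus ?thesis unfolding ord_eq[OF x] ord_eq[OF y] ord_eq[OF ee bu] .
qed

text \<open>The point is that \<open>x ^ e\<close> in \<open>B\<close> implies \<open>x\<close> in
  \<open>B\<close>: otherwise \<open>1 / x\<close> lies in \<open>B\<close>, and
  \<open>x = x ^ e * (1 / x) ^ (e - 1)\<close>.\<close>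

lemma ord_nonneg_iff:
  assumes "algebraic x" "x \<noteq> 0"
  shows "ord x \<ge> 0 \<longleftrightarrow> x \<in> B"
proof -
  obtain e a where x: "e > 0" "bunit (x ^ e / P powi a)" using exists_valuation assms by blast
  have "ord x \<ge> 0 \<longleftrightarrow> a \<ge> 0" using ord_eq[OF x] x(1) by (simp add: zero_le_divide_iff)
  also have "\<dots> \<longleftrightarrow> x \<in> B"
  proof
    assume a: "a \<ge> 0"
    show "x \<in> B"
    proof (rule ccontr)
      assume "x \<notin> B"
      hence inv: "inverse x \<in> B" using valuation_ring assms by blast
      have "x ^ e = (x ^ e / P powi a) * P ^ nat a" using a by (simp add: power_int_def)
      also have "\<dots> \<in> B" using x(2) by (intro B_mult B_power B_of_nat) (simp add: bunit_def)
      finally have "x ^ e * inverse x ^ (e - 1) \<in> B" by (rule B_mult[OF _ B_power[OF inv]])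
      moreover obtain n where "e = Suc n" using x(1) by (cases e) auto
      hence "x = x ^ e * inverse x ^ (e - 1)" using assms(2) by (simp add: power_inverse)
      ultimately have "x \<in> B" by simp
      thus False using \<open>x \<notin> B\<close> by simp
    qed
  next
    assume xB: "x \<in> B"
    show "a \<ge> 0"
    proof (rule ccontr)
      assume "\<not> a \<ge> 0"
      then obtain n where a: "a = - int (Suc n)" by (cases a rule: int_cases) auto
      have "P powi a = inverse (P ^ Suc n)" by (simp only: a power_int_minus power_int_of_nat)
      hence "inverse P = inverse (x ^ e / P powi a) * x ^ e * P ^ n"
        using assms(2) by (simp add: field_simps)
      also have "\<dots> \<in> B" using x(2) xB by (intro B_mult B_power B_of_nat) (auto simp: bunit_def)
      finally show False using p_inv by simp
    qed
  qed
  finally show ?thesis .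
qed

lemma ord_P: "ord P = 1"
  using ord_eq[of 1 P 1] by (simp add: bunit_1)

definition pabs :: "complex \<Rightarrow> real" where
  "pabs x = (if x = 0 then 0 else of_nat p powr (- ord x))"

lemma p_gt_1: "real p > 1" using prime prime_gt_1_nat by simp

lemma pabs_pos: "x \<noteq> 0 \<Longrightarrow> pabs x > 0"
  using p_gt_1 by (simp add: pabs_def)

lemma pabs_mult: "algebraic x \<Longrightarrow> algebraic y \<Longrightarrow> pabs (x * y) = pabs x * pabs y"
  by (auto simp: pabs_def ord_mult powr_add [symmetric])

lemma pabs_le_1_iff: "algebraic x \<Longrightarrow> pabs x \<le> 1 \<longleftrightarrow> x \<in> B"
  using powr_le_cancel_iff[OF p_gt_1, of "- ord x" 0] p_gt_1 ord_nonneg_iff[of x]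
  by (auto simp: pabs_def B_0)

text \<open>After division by the larger of the two, all that remains is that \<open>B\<close> is
  closed under adding 1.\<close>

lemma pabs_ultrametric:
  assumes "algebraic x" "algebraic y"
  shows "pabs (x + y) \<le> max (pabs x) (pabs y)"
proof -
  have *: "pabs (x + y) \<le> pabs y" if "algebraic x" "algebraic y" "pabs x \<le> pabs y" for x y
  proof (cases "y = 0")
    case True
    hence "x = 0" using that(3) pabs_pos[of x] by (cases "x = 0") (auto simp: pabs_def)
    thus ?thesis using True by simp
  next
    case False
    have xy: "algebraic (x / y)" using that by (intro algebraic_divide)
    have "pabs (x / y) * pabs y = pabs x" using pabs_mult[OF xy that(2)] False by simp
    hence "pabs (x / y) \<le> 1" using that(3) pabs_pos[OF False] by (metis mult_le_cancel_right2 less_le_not_le)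
    hence "x / y + 1 \<in> B" using pabs_le_1_iff[OF xy] by (intro B_add B_1) auto
    moreover have xy1: "algebraic (x / y + 1)" using xy by (intro algebraic_add) auto
    ultimately have "pabs (x / y + 1) \<le> 1" by (simp add: pabs_le_1_iff)
    moreover have "(x / y + 1) * y = x + y" using False by (simp add: field_simps)
    hence "pabs (x + y) = pabs (x / y + 1) * pabs y" using pabs_mult[OF xy1 that(2)] by simp
    ultimately show ?thesis using pabs_pos[OF False] by (simp add: mult_le_cancel_right1)
  qed
  show ?thesis
  proof (cases "pabs x \<le> pabs y")
    case False
    thus ?thesis using *[OF assms(2,1)] by (simp add: add.commute)
  qed (use *[OF assms] in simp)
qed

lemma pabs_P: "pabs P = 1 / real p"
  using p_gt_1 by (simp add: pabs_def ord_P powr_minus_divide)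

lemma pabs_of_int: "pabs (of_int n) \<le> 1"
  by (simp add: pabs_le_1_iff B_of_int)

end

definition is_padic_abs :: "nat \<Rightarrow> (complex \<Rightarrow> real) \<Rightarrow> bool" where
  "is_padic_abs p v \<longleftrightarrow> v 0 = 0 \<and> (\<forall>x. x \<noteq> 0 \<longrightarrow> v x > 0) \<and>
     (\<forall>x y. algebraic x \<longrightarrow> algebraic y \<longrightarrow> v (x * y) = v x * v y \<and> v (x + y) \<le> max (v x) (v y)) \<and>
     v (of_nat p) = 1 / real p \<and> (\<forall>n. v (of_int n) \<le> 1)"

text \<open>
  One fixed extension of the \<open>p\<close>-adic absolute value; its values at transcendental numbers are junk. Composing it
  with all embeddings of a number field yields all places above \<open>p\<close>, with multiplicity.
\<close>
definition padic_abs :: "nat \<Rightarrow> complex \<Rightarrow> real" where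
  "padic_abs p = (SOME v. is_padic_abs p v)"

lemma padic_abs:
  assumes "prime p"
  shows "is_padic_abs p (padic_abs p)"
proof -
  obtain B where B: "subring B" "inverse (of_nat p) \<notin> B"
    "\<And>B'. subring B' \<Longrightarrow> inverse (of_nat p) \<notin> B' \<Longrightarrow> B \<subseteq> B' \<Longrightarrow> B' = B"
    using maximal_subring[OF assms] by metis
  interpret maximal_ring p B using assms B by unfold_locales auto
  have "is_padic_abs p pabs"
    unfolding is_padic_abs_def
    by (auto simp: pabs_pos pabs_mult pabs_ultrametric pabs_P pabs_of_int) (simp add: pabs_def)
  thus ?thesis unfolding padic_abs_def by (rule someI[of "is_padic_abs p"])
qed

section \<open>Number fields and norms\<close>

definition subfield :: "complex set \<Rightarrow> bool" where
  "subfield F \<longleftrightarrow> \<rat> \<subseteq> F \<and> (\<forall>x\<in>F. \<forall>y\<in>F. x + y \<in> F \<and> x * y \<in> F) \<and> (\<forall>x\<in>F. inverse x \<in> F)"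

text \<open>The base field is general because \<open>primitive_element_two\<close> works over
  \<open>rat_adjoin \<theta>\<close>. Minimality of the degree stands in for irreducibility.\<close>

definition min_poly :: "complex set \<Rightarrow> complex \<Rightarrow> complex poly \<Rightarrow> bool" where
  "min_poly F x m \<longleftrightarrow> m \<in> polys_over F \<and> lead_coeff m = 1 \<and> poly m x = 0 \<and>
     (\<forall>g\<in>polys_over F. poly g x = 0 \<longrightarrow> g = 0 \<or> degree m \<le> degree g)"

context
  fixes F assumes F: "subfield F"
begin

lemma subfield_Rats: "x \<in> \<rat> \<Longrightarrow> x \<in> F"
  and subfield_add: "x \<in> F \<Longrightarrow> y \<in> F \<Longrightarrow> x + y \<in> F"
  and subfield_mult: "x \<in> F \<Longrightarrow> y \<in> F \<Longrightarrow> x * y \<in> F"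
  and subfield_inverse: "x \<in> F \<Longrightarrow> inverse x \<in> F"
  using F by (auto simp: subfield_def)

lemma subfield_0: "0 \<in> F" and subfield_1: "1 \<in> F"
  by (auto intro: subfield_Rats)

lemma subfield_uminus: "x \<in> F \<Longrightarrow> - x \<in> F"
  using subfield_mult[of "-1" x] subfield_Rats[of "-1"] by simp

lemma subfield_diff: "x \<in> F \<Longrightarrow> y \<in> F \<Longrightarrow> x - y \<in> F"
  using subfield_add[of x "- y"] subfield_uminus by simp

lemma subfield_divide: "x \<in> F \<Longrightarrow> y \<in> F \<Longrightarrow> x / y \<in> F"
  by (simp add: divide_inverse subfield_mult subfield_inverse)

lemma subfield_power: "x \<in> F \<Longrightarrow> x ^ n \<in> F"
  by (induction n) (auto intro: subfield_1 subfield_mult)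

lemma subfield_powi: "x \<in> F \<Longrightarrow> x powi n \<in> F"
  by (auto simp: power_int_def intro: subfield_power subfield_inverse)

lemma subfield_sum: "(\<And>i. i \<in> I \<Longrightarrow> f i \<in> F) \<Longrightarrow> (\<Sum>i\<in>I. f i) \<in> F"
  by (induction I rule: infinite_finite_induct) (auto intro: subfield_0 subfield_add)

lemma subfield_prod: "(\<And>i. i \<in> I \<Longrightarrow> f i \<in> F) \<Longrightarrow> (\<Prod>i\<in>I. f i) \<in> F"
  by (induction I rule: infinite_finite_induct) (auto intro: subfield_1 subfield_mult)

lemma polys_over_const: "c \<in> F \<Longrightarrow> [:c:] \<in> polys_over F"
  by (auto simp: polys_over_def coeff_pCons subfield_0 split: nat.splits)

lemma polys_over_linear: "c \<in> F \<Longrightarrow> d \<in> F \<Longrightarrow> [:c, d:] \<in> polys_over F"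
  by (auto simp: polys_over_def coeff_pCons subfield_0 split: nat.splits)

lemma polys_over_monom: "c \<in> F \<Longrightarrow> monom c n \<in> polys_over F"
  by (auto simp: polys_over_def subfield_0)

lemma polys_over_add: "p \<in> polys_over F \<Longrightarrow> q \<in> polys_over F \<Longrightarrow> p + q \<in> polys_over F"
  by (auto simp: polys_over_def intro: subfield_add)

lemma polys_over_diff: "p \<in> polys_over F \<Longrightarrow> q \<in> polys_over F \<Longrightarrow> p - q \<in> polys_over F"
  by (auto simp: polys_over_def intro: subfield_diff)

lemma polys_over_mult: "p \<in> polys_over F \<Longrightarrow> q \<in> polys_over F \<Longrightarrow> p * q \<in> polys_over F"
  by (auto simp: polys_over_def coeff_mult intro!: subfield_sum subfield_mult)

lemma polys_over_smult: "c \<in> F \<Longrightarrow> p \<in> polys_over F \<Longrightarrow> smult c p \<in> polys_over F"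
  by (auto simp: polys_over_def intro: subfield_mult)

lemma polys_over_pderiv: "p \<in> polys_over F \<Longrightarrow> pderiv p \<in> polys_over F"
  by (auto simp: polys_over_def coeff_pderiv intro!: subfield_mult[OF subfield_Rats] simp del: of_nat_Suc)

lemma polys_over_pCons: "pCons a p \<in> polys_over F \<longleftrightarrow> a \<in> F \<and> p \<in> polys_over F"
  unfolding polys_over_def
  by (auto simp: coeff_pCons split: nat.splits)

lemma polys_over_pcompose: "p \<in> polys_over F \<Longrightarrow> q \<in> polys_over F \<Longrightarrow> p \<circ>\<^sub>p q \<in> polys_over F"
proof (induction p)
  case 0
  thus ?case by simp
next
  case (pCons a p)
  thus ?case by (auto simp: pcompose_pCons polys_over_pCons intro!: polys_over_add polys_over_mult polys_over_const)
qed

lemma poly_in_subfield: "p \<in> polys_over F \<Longrightarrow> x \<in> F \<Longrightarrow> poly p x \<in> F"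
  unfolding poly_altdef polys_over_def by (auto intro!: subfield_sum subfield_mult subfield_power)

lemma polys_over_div:
  assumes "p \<in> polys_over F" "m \<in> polys_over F" "m \<noteq> 0"
  obtains s r where "s \<in> polys_over F" "r \<in> polys_over F" "p = s * m + r" "r = 0 \<or> degree r < degree m"
proof -
  have "\<exists>s\<in>polys_over F. \<exists>r\<in>polys_over F. p = s * m + r \<and> (r = 0 \<or> degree r < degree m)"
    using assms(1)
  proof (induction "degree p" arbitrary: p rule: less_induct)
    case less
    show ?case
    proof (cases "p = 0 \<or> degree p < degree m")
      case True
      have "0 \<in> polys_over F" by (simp add: polys_over_def subfield_0)
      thus ?thesis using True less by (intro bexI[of _ 0] bexI[of _ p]) auto
    next
      case False
      define c where "c = lead_coeff p / lead_coeff m"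
      define k where "k = degree p - degree m"
      have c: "c \<in> F" unfolding c_def using less assms(2) by (auto simp: polys_over_def intro: subfield_divide)
      have cm: "monom c k \<in> polys_over F" using c by (rule polys_over_monom)
      define p' where "p' = p - monom c k * m"
      have p': "p' \<in> polys_over F" unfolding p'_def using less cm assms(2) by (intro polys_over_diff polys_over_mult)
      have "c \<noteq> 0" using False assms(3) by (simp add: c_def)
      hence dm: "degree (monom c k * m) = degree p"
        using False assms(3) by (subst degree_mult_eq) (auto simp: degree_monom_eq k_def)
      have "lead_coeff (monom c k * m) = c * lead_coeff m" by (simp only: lead_coeff_mult lead_coeff_monom)
      also have "\<dots> = lead_coeff p" using assms(3) by (simp add: c_def)
      finally have "coeff (monom c k * m) (degree p) = lead_coeff p" unfolding dm .
      hence "coeff p' (degree p) = 0" by (simp add: p'_def)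
      moreover have "degree p' \<le> degree p" unfolding p'_def using dm by (intro degree_diff_le) auto
      ultimately have "p' = 0 \<or> degree p' < degree p" by (metis leading_coeff_0_iff le_neq_implies_less)
      hence "\<exists>s\<in>polys_over F. \<exists>r\<in>polys_over F. p' = s * m + r \<and> (r = 0 \<or> degree r < degree m)"
      proof
        assume "p' = 0"
        thus ?thesis using p' by (intro bexI[of _ 0]) auto
      qed (use less(1) p' in blast)
      then obtain s r where sr: "s \<in> polys_over F" "r \<in> polys_over F" "p' = s * m + r" "r = 0 \<or> degree r < degree m"
        by blast
      have "p = (s + monom c k) * m + r" using sr(3) by (simp add: p'_def algebra_simps)
      thus ?thesis using sr cm by (intro bexI[of _ "s + monom c k"] bexI[of _ r] conjI polys_over_add)
    qed
  qed
  thus thesis using that by blast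
qed

lemma min_poly_exists:
  assumes "g \<in> polys_over F" "g \<noteq> 0" "poly g x = 0"
  obtains m where "min_poly F x m"
proof -
  define S where "S = {g\<in>polys_over F. g \<noteq> 0 \<and> poly g x = 0}"
  obtain m where m: "m \<in> S" "\<And>g. g \<in> S \<Longrightarrow> degree m \<le> degree g"
    using ex_has_least_nat[of "\<lambda>g. g \<in> S" g degree] assms by (auto simp: S_def)
  define c where "c = inverse (lead_coeff m)"
  have c: "c \<in> F" "c \<noteq> 0" "c * lead_coeff m = 1"
    using m(1) by (auto simp: c_def S_def polys_over_def intro: subfield_inverse)
  have "min_poly F x (smult c m)"
    unfolding min_poly_def using c m by (auto simp: S_def intro: polys_over_smult)
  thus thesis by (rule that)
qed

lemma min_poly_dvd:
  assumes "min_poly F x m" "g \<in> polys_over F" "poly g x = 0"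
  obtains k where "k \<in> polys_over F" "g = k * m"
proof -
  have m: "m \<in> polys_over F" "m \<noteq> 0" "poly m x = 0" using assms(1) by (auto simp: min_poly_def)
  obtain s r where sr: "s \<in> polys_over F" "r \<in> polys_over F" "g = s * m + r" "r = 0 \<or> degree r < degree m"
    using polys_over_div[OF assms(2) m(1,2)] by blast
  have "poly r x = 0" using sr(3) m(3) assms(3) by simp
  hence "r = 0" using sr assms(1) by (auto simp: min_poly_def)
  thus thesis using that sr by simp
qed

text \<open>For the way from \<open>t\<close> back to \<open>x\<close>: the minimal polynomial
  \<open>h\<close> of \<open>t\<close> divides \<open>m = k * h\<close>, and \<open>k\<close>, of
  smaller degree, does not vanish at \<open>x\<close>, so \<open>h\<close> does. This is what makes
  the embeddings \<open>conj\<close> well defined and injective.\<close>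

lemma min_poly_conjugate:
  assumes "min_poly F x m" "poly m t = 0" "g \<in> polys_over F"
  shows "poly g t = 0 \<longleftrightarrow> poly g x = 0"
proof
  assume "poly g x = 0"
  then obtain k where "g = k * m" using min_poly_dvd[OF assms(1,3)] by blast
  thus "poly g t = 0" using assms(2) by simp
next
  assume gt: "poly g t = 0"
  have m: "m \<in> polys_over F" "m \<noteq> 0" "poly m x = 0" using assms(1) by (auto simp: min_poly_def)
  obtain h where h: "min_poly F t h" using min_poly_exists[OF m(1,2) assms(2)] by blast
  obtain k where k: "k \<in> polys_over F" "m = k * h" using min_poly_dvd[OF h m(1) assms(2)] by blast
  obtain l where l: "g = l * h" using min_poly_dvd[OF h assms(3) gt] by blast
  have "degree h \<noteq> 0"
  proof
    assume "degree h = 0"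
    hence "h = 1" using h by (metis min_poly_def degree_eq_zeroE lead_coeff_pCons(2) one_pCons lead_coeff_pCons(1))
    thus False using h by (simp add: min_poly_def)
  qed
  moreover have "k \<noteq> 0" "h \<noteq> 0" using k m by auto
  ultimately have "degree k < degree m" unfolding k(2) by (subst degree_mult_eq) auto
  hence "poly k x \<noteq> 0" using assms(1) k(1) \<open>k \<noteq> 0\<close> unfolding min_poly_def by (meson not_le)
  hence "poly h x = 0" using k m(3) by simp
  thus "poly g x = 0" using l by simp
qed

text \<open>A double root would be a root of the derivative, which by
  \<open>min_poly_conjugate\<close> would then vanish at \<open>x\<close> despite its smaller
  degree.\<close>

lemma min_poly_rsquarefree:
  assumes "min_poly F x m"
  shows "rsquarefree m"
  unfolding rsquarefree_roots
proof (intro allI notI)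
  fix t assume t: "poly m t = 0 \<and> poly (pderiv m) t = 0"
  have m: "m \<in> polys_over F" "m \<noteq> 0" using assms by (auto simp: min_poly_def)
  have "poly (pderiv m) x = 0"
    using min_poly_conjugate[OF assms _ polys_over_pderiv[OF m(1)]] t by blast
  hence "pderiv m = 0 \<or> degree m \<le> degree (pderiv m)"
    using assms polys_over_pderiv[OF m(1)] unfolding min_poly_def by blast
  hence "degree m = 0" by (auto simp: pderiv_eq_0_iff degree_pderiv)
  then obtain c where "m = [:c:]" by (metis degree_eq_zeroE)
  thus False using t m by simp
qed

end

lemma subfield_RatsI: "subfield \<rat>"
  by (simp add: subfield_def)

section \<open>Simple extensions of the rationals and primitive elements\<close>

definition rat_adjoin :: "complex \<Rightarrow> complex set" where
  "rat_adjoin \<theta> = (\<lambda>q. poly q \<theta>) ` polys_over \<rat>"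

lemma subfield_rat_adjoin:
  assumes "algebraic \<theta>"
  shows "subfield (rat_adjoin \<theta>)"
proof -
  note Q = subfield_RatsI
  have rats: "\<rat> \<subseteq> rat_adjoin \<theta>"
  proof
    fix c :: complex assume "c \<in> \<rat>"
    thus "c \<in> rat_adjoin \<theta>" unfolding rat_adjoin_def
      by (intro image_eqI[of _ _ "[:c:]"] polys_over_const[OF Q]) auto
  qed
  have ring: "x + y \<in> rat_adjoin \<theta>" "x * y \<in> rat_adjoin \<theta>"
    if xy: "x \<in> rat_adjoin \<theta>" "y \<in> rat_adjoin \<theta>" for x y
  proof -
    obtain q r where q: "q \<in> polys_over \<rat>" "r \<in> polys_over \<rat>" "x = poly q \<theta>" "y = poly r \<theta>"
      using xy by (auto simp: rat_adjoin_def)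
    show "x + y \<in> rat_adjoin \<theta>" unfolding rat_adjoin_def
      by (rule image_eqI[of _ _ "q + r"]) (use q polys_over_add[OF Q] in auto)
    show "x * y \<in> rat_adjoin \<theta>" unfolding rat_adjoin_def
      by (rule image_eqI[of _ _ "q * r"]) (use q polys_over_mult[OF Q] in auto)
  qed
  have pow: "x ^ n \<in> rat_adjoin \<theta>" if "x \<in> rat_adjoin \<theta>" for x n
    using that rats ring by (induction n) auto
  have sum: "(\<Sum>i\<in>I. f i) \<in> rat_adjoin \<theta>" if "\<And>i. i \<in> I \<Longrightarrow> f i \<in> rat_adjoin \<theta>" for I and f :: "nat \<Rightarrow> complex"
    using that by (induction I rule: infinite_finite_induct) (use rats ring in auto)
  have alg: "algebraic x" if x: "x \<in> rat_adjoin \<theta>" for x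
  proof -
    obtain q where "q \<in> polys_over \<rat>" "x = poly q \<theta>" using x unfolding rat_adjoin_def by blast
    thus ?thesis unfolding poly_altdef polys_over_def using assms
      by (auto intro!: algebraic_sum algebraic_mult[OF rat_imp_algebraic algebraic_power])
  qed
  have "inverse x \<in> rat_adjoin \<theta>" if x: "x \<in> rat_adjoin \<theta>" "x \<noteq> 0" for x
  proof -
    obtain p where p: "coeff p 0 \<noteq> 0" "poly (map_poly of_int p) x = 0"
      by (rule algebraicE'_nonzero[OF alg[OF x(1)] x(2)])
    define q :: "complex poly" where "q = map_poly of_int p"
    have q: "\<And>i. coeff q i \<in> \<int>" "poly q x = 0" "coeff q 0 \<noteq> 0"
      using p by (simp_all add: q_def coeff_map_poly)
    \<comment> \<open>The constant term is nonzero, so \<open>c + x * poly r x = 0\<close> expresses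
      \<open>1 / x\<close> as a polynomial in \<open>x\<close>.\<close>
    obtain c r where cr: "q = pCons c r" by (cases q) auto
    have co: "c \<noteq> 0" "c \<in> \<rat>" "coeff r i \<in> \<rat>" for i
      using q(3) q(1)[of 0] q(1)[of "Suc i"] Ints_subset_Rats by (auto simp: cr)
    have "c + x * poly r x = 0" using q(2) by (simp add: cr)
    hence "inverse x = (- inverse c) * poly r x" using co x(2) by (simp add: field_simps add_eq_0_iff2)
    moreover have "poly r x \<in> rat_adjoin \<theta>" unfolding poly_altdef
      by (intro sum ring(2) pow x(1) subsetD[OF rats] co(3))
    moreover have "- inverse c \<in> rat_adjoin \<theta>" using co(2) by (intro subsetD[OF rats]) simp
    ultimately show ?thesis by (simp only: ring(2))
  qed
  hence "inverse x \<in> rat_adjoin \<theta>" if "x \<in> rat_adjoin \<theta>" for x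
    using that by (cases "x = 0") auto
  thus ?thesis unfolding subfield_def using rats ring by blast
qed

lemma generator_in_rat_adjoin: "\<theta> \<in> rat_adjoin \<theta>"
  unfolding rat_adjoin_def
  by (rule image_eqI[of _ _ "[:0, 1:]"]) (auto intro: polys_over_linear[OF subfield_RatsI])

lemma rat_adjoin_subset: "subfield F \<Longrightarrow> \<theta> \<in> F \<Longrightarrow> rat_adjoin \<theta> \<subseteq> F"
proof
  fix x assume F: "subfield F" and \<theta>: "\<theta> \<in> F" and "x \<in> rat_adjoin \<theta>"
  then obtain q where q: "q \<in> polys_over \<rat>" "x = poly q \<theta>" unfolding rat_adjoin_def by blast
  hence "q \<in> polys_over F" using subfield_Rats[OF F] by (simp add: polys_over_def)
  thus "x \<in> F" using q(2) poly_in_subfield[OF F _ \<theta>] by simp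
qed

lemma min_poly_Rats_exists:
  assumes "algebraic x"
  obtains m where "min_poly \<rat> x m"
proof -
  obtain p where p: "lead_coeff p = 1" "\<And>i. coeff p i \<in> \<rat>" "poly p x = 0"
    using algebraic_monic[OF assms] by blast
  have "p \<in> polys_over \<rat>" "p \<noteq> 0" using p(1,2) by (auto simp: polys_over_def)
  thus thesis using that by (rule min_poly_exists[OF subfield_RatsI _ _ p(3)])
qed

text \<open>
  For all but finitely many \<open>c\<close>, the minimal polynomial of \<open>b\<close> over \<open>\<rat>(a + c b)\<close> divides two polynomials whose only
  common root is \<open>b\<close>.
\<close>
lemma primitive_element_two:
  assumes "algebraic a" "algebraic b"
  obtains \<theta> where "algebraic \<theta>" "a \<in> rat_adjoin \<theta>" "b \<in> rat_adjoin \<theta>"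
proof -
  note Q = subfield_RatsI
  obtain f where f: "min_poly \<rat> a f" using min_poly_Rats_exists assms by blast
  obtain g where g: "min_poly \<rat> b g" using min_poly_Rats_exists assms by blast
  have f': "f \<in> polys_over \<rat>" "f \<noteq> 0" "poly f a = 0" using f by (auto simp: min_poly_def)
  have g': "g \<in> polys_over \<rat>" "g \<noteq> 0" "poly g b = 0" using g by (auto simp: min_poly_def)
  \<comment> \<open>The values \<open>c\<close> for which another pair of roots satisfies
    \<open>a' + c * b' = a + c * b\<close>. Pairs with \<open>b' = b\<close> contribute 0, the value
    of a division by 0; this only enlarges a finite set.\<close>
  define bad where "bad = (\<lambda>(a', b'). (a' - a) / (b - b')) ` ({x. poly f x = 0} \<times> {x. poly g x = 0})"
  have "finite bad" unfolding bad_def using f' g' by (intro finite_imageI finite_cartesian_product poly_roots_finite)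
  moreover have "infinite (range (of_nat :: nat \<Rightarrow> complex))"
    by (intro range_inj_infinite inj_of_nat)
  ultimately have "\<not> range (of_nat :: nat \<Rightarrow> complex) \<subseteq> bad" using finite_subset by blast
  then obtain n :: nat where n: "of_nat n \<notin> bad" by blast
  define c :: complex where "c = of_nat n"
  define \<theta> where "\<theta> = a + c * b"
  have alg: "algebraic \<theta>" unfolding \<theta>_def c_def using assms by (intro algebraic_add algebraic_mult) auto
  define F where "F = rat_adjoin \<theta>"
  have F: "subfield F" unfolding F_def using alg by (rule subfield_rat_adjoin)
  have sub: "polys_over \<rat> \<subseteq> polys_over F" using F by (auto simp: polys_over_def subfield_def)
  have \<theta>: "\<theta> \<in> F" by (simp add: F_def generator_in_rat_adjoin)
  have c: "c \<in> F" unfolding c_def by (rule subfield_Rats[OF F]) simp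
  have gF: "g \<in> polys_over F" using g' sub by auto
  have fF: "f \<circ>\<^sub>p [:\<theta>, - c:] \<in> polys_over F"
    using sub f'(1) by (intro polys_over_pcompose[OF F] polys_over_linear[OF F] subfield_uminus[OF F] \<theta> c) auto
  have fb: "poly (f \<circ>\<^sub>p [:\<theta>, - c:]) b = 0" using f' by (simp add: poly_pcompose \<theta>_def algebra_simps)
  obtain m where m: "min_poly F b m" using min_poly_exists[OF F gF g'(2,3)] by blast
  obtain k where k: "g = k * m" using min_poly_dvd[OF F m gF g'(3)] by blast
  obtain l where l: "f \<circ>\<^sub>p [:\<theta>, - c:] = l * m" using min_poly_dvd[OF F m fF fb] by blast
  have root: "t = b" if "poly m t = 0" for t
  proof (rule ccontr)
    assume "t \<noteq> b"
    have "poly g t = 0" using that k by simp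
    moreover have "poly (f \<circ>\<^sub>p [:\<theta>, - c:]) t = 0" using that l by simp
    hence "poly f (a + c * (b - t)) = 0" by (simp add: poly_pcompose \<theta>_def algebra_simps)
    moreover have "c = (a + c * (b - t) - a) / (b - t)" using \<open>t \<noteq> b\<close> by simp
    ultimately have "c \<in> bad" unfolding bad_def by force
    thus False using n by (simp add: c_def)
  qed
  have mb: "poly m b = 0" "m \<noteq> 0" "lead_coeff m = 1" "m \<in> polys_over F" using m by (auto simp: min_poly_def)
  then obtain m1 where m1: "m = [:-b, 1:] * m1" by (metis poly_eq_0_iff_dvd dvdE)
  \<comment> \<open>\<open>m\<close> has no root except \<open>b\<close>, and a second factor
    \<open>X - b\<close> would make \<open>b\<close> a double root of \<open>g\<close>.\<close>
  have "degree m1 = 0"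
  proof (rule ccontr)
    assume "degree m1 \<noteq> 0"
    then obtain t where t: "poly m1 t = 0"
      using fundamental_theorem_of_algebra[of m1] by (auto simp: constant_degree)
    hence "t = b" using root[of t] m1 by simp
    then obtain m2 where "m1 = [:-b, 1:] * m2" using t by (metis poly_eq_0_iff_dvd dvdE)
    hence "g = [:-b, 1:] * ([:-b, 1:] * (k * m2))" using k m1 by (simp only: mult_ac)
    hence "poly (pderiv g) b = 0" by (simp only: pderiv_mult poly_add poly_mult) simp
    thus False using min_poly_rsquarefree[OF Q g] g'(3) by (auto simp: rsquarefree_roots)
  qed
  then obtain e where "m1 = [:e:]" by (metis degree_eq_zeroE)
  hence "m = [:-b, 1:]" using m1 mb by auto
  hence "- b \<in> F" using mb(4) by (auto simp: polys_over_pCons[OF F])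
  hence b: "b \<in> F" using subfield_uminus[OF F, of "- b"] by simp
  have "a = \<theta> - c * b" by (simp add: \<theta>_def)
  hence "a \<in> F" using subfield_diff[OF F \<theta> subfield_mult[OF F c b]] by simp
  thus thesis using that[OF alg] b by (simp add: F_def)
qed

lemma primitive_element:
  assumes "finite X" "\<And>x. x \<in> X \<Longrightarrow> algebraic x"
  obtains \<theta> where "algebraic \<theta>" "X \<subseteq> rat_adjoin \<theta>"
proof -
  have "\<exists>\<theta>. algebraic \<theta> \<and> X \<subseteq> rat_adjoin \<theta>"
    using assms
  proof (induction X rule: finite_induct)
    case empty
    show ?case by (intro exI[of _ 0]) auto
  next
    case (insert x X)
    then obtain \<eta> where \<eta>: "algebraic \<eta>" "X \<subseteq> rat_adjoin \<eta>" by auto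
    obtain \<theta> where \<theta>: "algebraic \<theta>" "\<eta> \<in> rat_adjoin \<theta>" "x \<in> rat_adjoin \<theta>"
      using primitive_element_two[OF \<eta>(1), of x] insert by blast
    have "rat_adjoin \<eta> \<subseteq> rat_adjoin \<theta>"
      using \<theta> by (intro rat_adjoin_subset subfield_rat_adjoin)
    thus ?case using \<eta> \<theta> by blast
  qed
  thus thesis using that by blast
qed

text \<open>The Euclidean algorithm for resultants: reduce \<open>q\<close> modulo \<open>f\<close> and exchange the roles of the two.\<close>
lemma prod_roots_rational:
  assumes "(\<Prod>t\<in>#A. [:-t, 1:]) \<in> polys_over \<rat>" "q \<in> polys_over \<rat>"
  shows "(\<Prod>t\<in>#A. poly q t) \<in> (\<rat> :: complex set)"
  using assms
proof (induction "size A" arbitrary: A q rule: less_induct)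
  case less
  note Q = subfield_RatsI
  define f where "f = (\<Prod>t\<in>#A. [:-t, 1:])"
  have f: "f \<in> polys_over \<rat>" using less.prems by (simp add: f_def)
  have monic: "f \<noteq> 0 \<and> lead_coeff f = 1 \<and> degree f = size A"
    unfolding f_def
  proof (induction A)
    case (add t A)
    define g where "g = (\<Prod>t\<in>#A. [:-t, 1:])"
    have g: "g \<noteq> 0" "lead_coeff g = 1" "degree g = size A" using add by (auto simp: g_def)
    have "[:-t, 1:] * g \<noteq> 0" using g(1) by (simp only: mult_eq_0_iff) simp
    moreover have "lead_coeff ([:-t, 1:] * g) = 1" using g(2) by (simp only: lead_coeff_mult) simp
    moreover have "degree ([:-t, 1:] * g) = Suc (size A)" using g by (subst degree_mult_eq) auto
    ultimately show ?case by (simp only: image_mset_add_mset prod_mset.add_mset size_add_mset g_def) blast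
  qed auto
  have root: "poly f t = 0" if "t \<in># A" for t
    using that by (auto simp: f_def poly_prod_mset image_iff)
  obtain s r where sr: "s \<in> polys_over \<rat>" "r \<in> polys_over \<rat>" "q = s * f + r" "r = 0 \<or> degree r < degree f"
    using polys_over_div[OF Q less.prems(2) f] monic by blast
  have qr: "(\<Prod>t\<in>#A. poly q t) = (\<Prod>t\<in>#A. poly r t)"
    by (intro arg_cong[of _ _ prod_mset] image_mset_cong) (simp add: sr(3) root)
  show ?case
  proof (cases "r = 0")
    case True
    show ?thesis
    proof (cases "A = {#}")
      case False
      hence "(\<Prod>t\<in>#A. poly r t) = 0" using True by (auto simp: nonempty_has_size [symmetric])
      thus ?thesis using qr by (simp only: Rats_0)
    qed simp
  next
    case False
    then obtain C where C: "size C = degree r" "r = smult (lead_coeff r) (\<Prod>x\<in>#C. [:-x, 1:])"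
      using alg_closed_imp_factorization by blast
    define c where "c = lead_coeff r"
    have c: "c \<in> \<rat>" "c \<noteq> 0" using False sr(2) by (auto simp: c_def polys_over_def)
    have "smult (inverse c) r = (\<Prod>x\<in>#C. [:-x, 1:])" using C(2) c by (metis c_def left_inverse smult_1_left smult_smult)
    hence "(\<Prod>x\<in>#C. [:-x, 1:]) \<in> polys_over \<rat>" using polys_over_smult[OF Q _ sr(2), of "inverse c"] c by simp
    hence IH: "(\<Prod>x\<in>#C. poly f x) \<in> \<rat>" using less.hyps[of C f] f C sr(4) monic False by auto
    have "poly r t = c * (\<Prod>x\<in>#C. t - x)" for t
      by (subst C(2)) (simp add: c_def poly_prod_mset)
    hence "(\<Prod>t\<in>#A. poly r t) = (\<Prod>t\<in>#A. c * (\<Prod>x\<in>#C. t - x))" by simp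
    also have "\<dots> = c ^ size A * (\<Prod>x\<in>#C. \<Prod>t\<in>#A. t - x)"
      by (simp add: prod_mset.distrib prod_mset.swap[of _ C A])
    also have "(\<Prod>x\<in>#C. \<Prod>t\<in>#A. t - x) = (\<Prod>x\<in>#C. (-1) ^ size A * poly f x)"
    proof (intro arg_cong[of _ _ prod_mset] image_mset_cong)
      fix x
      have "(\<Prod>t\<in>#A. t - x) = (\<Prod>t\<in>#A. (-1) * (x - t))" by simp
      also have "\<dots> = (-1) ^ size A * (\<Prod>t\<in>#A. x - t)" by (simp only: prod_mset.distrib) simp
      finally show "(\<Prod>t\<in>#A. t - x) = (-1) ^ size A * poly f x" by (simp add: f_def poly_prod_mset)
    qed
    also have "\<dots> = ((-1) ^ size A) ^ size C * (\<Prod>x\<in>#C. poly f x)" by (simp add: prod_mset.distrib)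
    finally show ?thesis unfolding qr using c IH by simp
  qed
qed

text \<open>The minimal polynomial is squarefree, so its set of roots can serve as the multiset of
  \<open>prod_roots_rational\<close>.\<close>

lemma norm_rational:
  assumes "min_poly \<rat> \<theta> f" "q \<in> polys_over \<rat>"
  shows "(\<Prod>t | poly f t = 0. poly q t) \<in> \<rat>"
proof -
  have "f = (\<Prod>t | poly f t = 0. [:-t, 1:])"
    using complex_poly_decompose_rsquarefree[OF min_poly_rsquarefree[OF subfield_RatsI assms(1)]] assms(1)
    by (simp add: min_poly_def)
  hence "(\<Prod>t\<in>#mset_set {t. poly f t = 0}. [:-t, 1:]) \<in> polys_over \<rat>"
    using assms(1) by (simp add: min_poly_def prod_unfold_prod_mset)
  from prod_roots_rational[OF this assms(2)] show ?thesis by (simp add: prod_unfold_prod_mset)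
qed

section \<open>The product formula over the rational numbers\<close>

context
  fixes p :: nat assumes p: "prime p"
begin

lemma padic_abs_0 [simp]: "padic_abs p 0 = 0"
  and padic_abs_pos: "x \<noteq> 0 \<Longrightarrow> padic_abs p x > 0"
  and padic_abs_mult: "algebraic x \<Longrightarrow> algebraic y \<Longrightarrow> padic_abs p (x * y) = padic_abs p x * padic_abs p y"
  and padic_abs_add: "algebraic x \<Longrightarrow> algebraic y \<Longrightarrow> padic_abs p (x + y) \<le> max (padic_abs p x) (padic_abs p y)"
  and padic_abs_p: "padic_abs p (of_nat p) = 1 / real p"
  and padic_abs_int: "padic_abs p (of_int n) \<le> 1"
  using padic_abs[OF p] by (auto simp: is_padic_abs_def)

lemma padic_abs_nonneg: "padic_abs p x \<ge> 0"
  using padic_abs_pos[of x] by (cases "x = 0") auto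

lemma padic_abs_1 [simp]: "padic_abs p 1 = 1"
  using padic_abs_mult[of 1 1] padic_abs_pos[of 1] by simp

lemma padic_abs_power: "algebraic x \<Longrightarrow> padic_abs p (x ^ n) = padic_abs p x ^ n"
  by (induction n) (auto simp: padic_abs_mult algebraic_power)

lemma padic_abs_uminus: "algebraic x \<Longrightarrow> padic_abs p (- x) = padic_abs p x"
proof -
  assume x: "algebraic x"
  have "padic_abs p (-1) * padic_abs p (-1) = 1" using padic_abs_mult[of "-1" "-1"] by simp
  hence "padic_abs p (-1) ^ 2 = 1 ^ 2" by (simp add: power2_eq_square)
  hence "padic_abs p (-1) = 1" by (rule power_eq_imp_eq_base) (auto simp: padic_abs_nonneg)
  thus ?thesis using padic_abs_mult[of "-1" x] x by simp
qed

lemma padic_abs_inverse: "algebraic x \<Longrightarrow> padic_abs p (inverse x) = inverse (padic_abs p x)"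
proof (cases "x = 0")
  case False
  assume x: "algebraic x"
  have "padic_abs p x * padic_abs p (inverse x) = 1" using padic_abs_mult[of x "inverse x"] x False by auto
  thus ?thesis by (metis inverse_unique)
qed simp

lemma padic_abs_powi: "algebraic x \<Longrightarrow> padic_abs p (x powi n) = padic_abs p x powi n"
  by (auto simp: power_int_def padic_abs_power padic_abs_inverse algebraic_power algebraic_inverse power_inverse)

lemma padic_abs_prod:
  "(\<And>i. i \<in> I \<Longrightarrow> algebraic (f i)) \<Longrightarrow> padic_abs p (\<Prod>i\<in>I. f i) = (\<Prod>i\<in>I. padic_abs p (f i)) \<and> algebraic (\<Prod>i\<in>I. f i)"
  by (induction I rule: infinite_finite_induct) (auto simp: padic_abs_mult intro: algebraic_mult)

lemma padic_abs_sum_le: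
  assumes "\<And>i. i \<in> I \<Longrightarrow> algebraic (f i)" "\<And>i. i \<in> I \<Longrightarrow> padic_abs p (f i) \<le> C" "C \<ge> 0"
  shows "padic_abs p (\<Sum>i\<in>I. f i) \<le> C"
  using assms(1,2)
proof (induction I rule: infinite_finite_induct)
  case (insert i I)
  have "padic_abs p (f i + sum f I) \<le> max (padic_abs p (f i)) (padic_abs p (sum f I))"
    using insert by (intro padic_abs_add algebraic_sum) auto
  also have "\<dots> \<le> C" using insert by auto
  finally show ?case using insert by simp
qed (use assms(3) in auto)

lemma padic_abs_diff: "algebraic x \<Longrightarrow> algebraic y \<Longrightarrow> padic_abs p (x - y) \<le> max (padic_abs p x) (padic_abs p y)"
  using padic_abs_add[of x "- y"] padic_abs_uminus[of y] by simp

lemma padic_abs_add_eq: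
  assumes "algebraic x" "algebraic y" "padic_abs p x < padic_abs p y"
  shows "padic_abs p (x + y) = padic_abs p y"
proof -
  have "padic_abs p (x + y) \<le> padic_abs p y" using padic_abs_add[OF assms(1,2)] assms(3) by simp
  moreover have "padic_abs p (x + y - x) \<le> max (padic_abs p (x + y)) (padic_abs p x)"
    using assms by (intro padic_abs_diff algebraic_add)
  ultimately show ?thesis using assms(3) by simp
qed

text \<open>Otherwise Bezout would write 1 as a sum of two terms of absolute value below 1.\<close>

lemma padic_abs_coprime:
  assumes "\<not> int p dvd n"
  shows "padic_abs p (of_int n) = 1"
proof (rule antisym[OF padic_abs_int], rule ccontr)
  assume "\<not> 1 \<le> padic_abs p (of_int n)"
  hence lt: "padic_abs p (of_int n) < 1" by simp
  have "coprime n (int p)" using assms p by (metis coprime_commute prime_imp_coprime prime_nat_int_transfer)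
  then obtain s t where "n * s + int p * t = 1"
    by (metis bezout_int coprime_imp_gcd_eq_1 mult.commute)
  hence e: "of_int n * of_int s + of_nat p * of_int t = (1 :: complex)"
    by (metis of_int_add of_int_mult of_int_1 of_int_of_nat_eq)
  have "padic_abs p (of_int n * of_int s) = padic_abs p (of_int n) * padic_abs p (of_int s)"
    by (simp add: padic_abs_mult)
  also have "\<dots> \<le> padic_abs p (of_int n) * 1" by (intro mult_left_mono padic_abs_int padic_abs_nonneg)
  finally have 1: "padic_abs p (of_int n * of_int s) < 1" using lt by simp
  have "padic_abs p (of_nat p * of_int t) = 1 / real p * padic_abs p (of_int t)"
    by (simp add: padic_abs_mult padic_abs_p)
  also have "\<dots> \<le> 1 / real p * 1" by (intro mult_left_mono padic_abs_int) auto
  also have "\<dots> < 1" using prime_gt_1_nat[OF p] by simp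
  finally have 2: "padic_abs p (of_nat p * of_int t) < 1" .
  have "padic_abs p 1 \<le> max (padic_abs p (of_int n * of_int s)) (padic_abs p (of_nat p * of_int t))"
    unfolding e [symmetric] by (intro padic_abs_add algebraic_mult) auto
  thus False using 1 2 by simp
qed

lemma padic_abs_nat:
  assumes "n > 0"
  shows "padic_abs p (of_nat n) = 1 / real (p ^ multiplicity p n)"
proof -
  obtain m where m: "n = p ^ multiplicity p n * m" "\<not> p dvd m"
    using multiplicity_decompose'[of n p] assms p by (metis not_prime_unit less_numeral_extra(3))
  have "\<not> int p dvd int m" using m(2) by simp
  hence "padic_abs p (of_nat m) = 1" using padic_abs_coprime[of "int m"] by simp
  moreover have "padic_abs p (of_nat n) = padic_abs p (of_nat p ^ multiplicity p n * of_nat m)"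
    by (subst m(1)) simp
  ultimately show ?thesis
    by (simp add: padic_abs_mult padic_abs_power padic_abs_p algebraic_power power_one_over)
qed

end

lemma prod_multiplicity_le:
  assumes "finite S" "\<And>p. p \<in> S \<Longrightarrow> prime p" "n > 0"
  shows "(\<Prod>p\<in>S. p ^ multiplicity p n) \<le> (n :: nat)"
    and "(\<And>p. prime p \<Longrightarrow> p dvd n \<Longrightarrow> p \<in> S) \<Longrightarrow> (\<Prod>p\<in>S. p ^ multiplicity p n) = n"
proof -
  have pf: "(\<Prod>p\<in>prime_factors n. p ^ multiplicity p n) = n"
    using prod_prime_factors[of n] assms(3) by simp
  have eq: "(\<Prod>p\<in>S. p ^ multiplicity p n) = (\<Prod>p\<in>S \<inter> prime_factors n. p ^ multiplicity p n)"
  proof (rule prod.mono_neutral_right)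
    show "\<forall>p\<in>S - S \<inter> prime_factors n. p ^ multiplicity p n = 1"
    proof
      fix p assume "p \<in> S - S \<inter> prime_factors n"
      hence "\<not> p dvd n" using assms by (auto simp: in_prime_factors_iff)
      thus "p ^ multiplicity p n = 1" by (simp add: not_dvd_imp_multiplicity_0)
    qed
  qed (use assms in auto)
  also have "\<dots> \<le> (\<Prod>p\<in>prime_factors n. p ^ multiplicity p n)"
    using assms(3) by (intro dvd_imp_le prod_dvd_prod_subset) (auto simp: pf)
  finally show "(\<Prod>p\<in>S. p ^ multiplicity p n) \<le> n" using pf by simp
  assume "\<And>p. prime p \<Longrightarrow> p dvd n \<Longrightarrow> p \<in> S"
  hence "S \<inter> prime_factors n = prime_factors n" by (auto simp: in_prime_factors_iff)
  thus "(\<Prod>p\<in>S. p ^ multiplicity p n) = n" using eq pf by simp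
qed

lemma Rats_coprime_quotient:
  assumes "x \<in> \<rat>" "x \<noteq> (0 :: complex)"
  obtains a b :: nat where "a > 0" "b > 0" "coprime a b" "cmod x = real a / real b"
    "\<And>p. prime p \<Longrightarrow> padic_abs p x = padic_abs p (of_nat a) / padic_abs p (of_nat b)"
    "x = of_nat a / of_nat b \<or> x = - (of_nat a / of_nat b)"
proof -
  obtain q where q: "x = of_rat q" using assms(1) by (rule Rats_cases)
  obtain m n where mn: "quotient_of q = (m, n)" by fastforce
  have "n > 0" "coprime m n" "q = of_int m / of_int n"
    using mn quotient_of_denom_pos quotient_of_coprime quotient_of_div by blast+
  note mn' = this
  have x: "x = of_int m / of_int n" using q mn'(3) by (simp add: of_rat_divide)
  define a b where "a = nat \<bar>m\<bar>" and "b = nat n"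
  have m0: "m \<noteq> 0" using x assms(2) by auto
  have b: "of_int n = (of_nat b :: complex)" using mn'(1) by (simp add: b_def)
  have a: "of_int m = (of_nat a :: complex) \<or> of_int m = - (of_nat a :: complex)"
    by (cases "m \<ge> 0") (auto simp: a_def)
  have x': "x = of_nat a / of_nat b \<or> x = - (of_nat a / of_nat b)" using x a b by auto
  show thesis
  proof (rule that)
    show "a > 0" "b > 0" using m0 mn' by (auto simp: a_def b_def)
    show "coprime a b" using mn' unfolding a_def b_def by (simp add: coprime_nat_abs_left_iff coprime_int_iff [symmetric])
    show "cmod x = real a / real b" using x' by (auto simp: norm_divide)
    show "padic_abs p x = padic_abs p (of_nat a) / padic_abs p (of_nat b)" if p: "prime p" for p
    proof -
      have "padic_abs p (of_nat a / of_nat b) = padic_abs p (of_nat a) / padic_abs p (of_nat b)"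
        by (simp add: divide_inverse padic_abs_mult[OF p] padic_abs_inverse[OF p] algebraic_inverse)
      thus ?thesis using x' padic_abs_uminus[OF p, of "of_nat a / of_nat b"] by (auto intro: algebraic_divide)
    qed
  qed (rule x')
qed

lemma denominator_primes:
  assumes "coprime a (b::nat)" "a > 0" "b > 0" "prime p" "p dvd b"
  shows "padic_abs p (of_nat a) / padic_abs p (of_nat b) = real (p ^ multiplicity p b)" "real (p ^ multiplicity p b) > 1"
proof -
  have "\<not> p dvd a" using assms by (meson coprime_common_divisor_nat not_prime_1 prime_nat_iff coprime_def not_prime_unit)
  hence "multiplicity p a = 0" by (rule not_dvd_imp_multiplicity_0)
  thus "padic_abs p (of_nat a) / padic_abs p (of_nat b) = real (p ^ multiplicity p b)"
    using assms by (simp add: padic_abs_nat)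
  have "multiplicity p b > 0" using assms by (simp add: prime_multiplicity_gt_zero_iff)
  hence "p ^ multiplicity p b > 1" using prime_gt_1_nat[OF assms(4)] by (intro one_less_power)
  thus "real (p ^ multiplicity p b) > 1" by (metis of_nat_1 of_nat_less_iff)
qed

text \<open>In lowest terms \<open>a / b\<close> the denominator is composed of primes of
  \<open>S\<close>, whose absolute values cancel it; what remains is \<open>a\<close> divided by its
  S-part.\<close>

lemma product_formula_ge_1:
  assumes "finite S" "\<And>p. p \<in> S \<Longrightarrow> prime p" "x \<in> \<rat>" "x \<noteq> 0"
    and int: "\<And>p. prime p \<Longrightarrow> p \<notin> S \<Longrightarrow> padic_abs p x \<le> 1"
  shows "cmod x * (\<Prod>p\<in>S. padic_abs p x) \<ge> 1"
proof -
  obtain a b :: nat where ab: "a > 0" "b > 0" "coprime a b" "cmod x = real a / real b"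
    "\<And>p. prime p \<Longrightarrow> padic_abs p x = padic_abs p (of_nat a) / padic_abs p (of_nat b)"
    using Rats_coprime_quotient[OF assms(3,4)] by metis
  have dvd: "p \<in> S" if "prime p" "p dvd b" for p
  proof (rule ccontr)
    assume "p \<notin> S"
    hence "padic_abs p x \<le> 1" using int that by blast
    thus False using ab(5)[OF that(1)] denominator_primes[OF ab(3,1,2) that] by (simp del: of_nat_power)
  qed
  define A where "A = (\<Prod>p\<in>S. p ^ multiplicity p a)"
  have A: "A \<le> a" "A > 0" unfolding A_def using prod_multiplicity_le(1)[OF assms(1,2) ab(1)]
    assms(2) by (auto intro!: prod_pos simp: prime_gt_0_nat)
  have B: "(\<Prod>p\<in>S. p ^ multiplicity p b) = b" using prod_multiplicity_le(2)[OF assms(1,2) ab(2)] dvd by blast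
  have "(\<Prod>p\<in>S. padic_abs p x) = (\<Prod>p\<in>S. real (p ^ multiplicity p b) / real (p ^ multiplicity p a))"
    using assms(2) ab(1,2) by (intro prod.cong refl) (simp add: ab(5) padic_abs_nat)
  also have "\<dots> = real (\<Prod>p\<in>S. p ^ multiplicity p b) / real A"
    by (simp only: prod_dividef A_def of_nat_prod)
  finally have "cmod x * (\<Prod>p\<in>S. padic_abs p x) = real a / real A" unfolding B using ab by simp
  thus ?thesis using A by simp
qed

text \<open>The bounds at the primes of \<open>S\<close> limit the denominator to
  \<open>max 1 C ^ card S\<close>; the bound on \<open>cmod x\<close> then limits the
  numerator.\<close>

lemma finite_rationals_bounded:
  assumes "finite S" "\<And>p. p \<in> S \<Longrightarrow> prime p"
  shows "finite {x\<in>\<rat>. cmod x \<le> C \<and> (\<forall>p. prime p \<longrightarrow> p \<notin> S \<longrightarrow> padic_abs p x \<le> 1) \<and> (\<forall>p\<in>S. padic_abs p x \<le> C)}"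
    (is "finite ?X")
proof -
  define D where "D = (max 1 C) ^ card S"
  define m where "m = nat \<lceil>D\<rceil>"
  define n where "n = nat \<lceil>\<bar>C\<bar> * D\<rceil>"
  have D: "D \<ge> 1" unfolding D_def by (intro one_le_power) auto
  define Y where "Y = (\<lambda>(a, b). of_nat a / of_nat b :: complex) ` ({..n} \<times> {..m})"
  have "?X \<subseteq> insert 0 (Y \<union> uminus ` Y)"
  proof
    fix x assume x: "x \<in> ?X"
    show "x \<in> insert 0 (Y \<union> uminus ` Y)"
    proof (cases "x = 0")
      case False
      obtain a b :: nat where ab: "a > 0" "b > 0" "coprime a b" "cmod x = real a / real b"
        "\<And>p. prime p \<Longrightarrow> padic_abs p x = padic_abs p (of_nat a) / padic_abs p (of_nat b)"
        "x = of_nat a / of_nat b \<or> x = - (of_nat a / of_nat b)"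
        using Rats_coprime_quotient[of x] x False by blast
      have dvd: "p \<in> S" if "prime p" "p dvd b" for p
      proof (rule ccontr)
        assume "p \<notin> S"
        hence "padic_abs p x \<le> 1" using x that by blast
        thus False using ab(5)[OF that(1)] denominator_primes[OF ab(3,1,2) that] by (simp del: of_nat_power)
      qed
      have "(\<Prod>p\<in>S. p ^ multiplicity p b) = b" using prod_multiplicity_le(2)[OF assms ab(2)] dvd by blast
      hence "real b = (\<Prod>p\<in>S. real (p ^ multiplicity p b))" by (metis of_nat_prod)
      also have "\<dots> \<le> (\<Prod>p\<in>S. max 1 C)"
      proof (rule prod_mono)
        fix p assume p: "p \<in> S"
        have "real (p ^ multiplicity p b) \<le> max 1 C"
        proof (cases "p dvd b")
          case True
          have "padic_abs p x \<le> C" using x p by blast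
          thus ?thesis using ab(5)[OF assms(2)[OF p]] denominator_primes(1)[OF ab(3,1,2) assms(2)[OF p] True] by simp
        qed (simp add: not_dvd_imp_multiplicity_0)
        thus "0 \<le> real (p ^ multiplicity p b) \<and> real (p ^ multiplicity p b) \<le> max 1 C" by simp
      qed
      also have "\<dots> = D" by (simp add: D_def)
      finally have bD: "real b \<le> D" .
      have "real a = cmod x * real b" using ab by simp
      also have "\<dots> \<le> \<bar>C\<bar> * D" using x bD by (intro mult_mono) auto
      finally have "real a \<le> \<bar>C\<bar> * D" .
      hence "a \<le> n" "b \<le> m" using bD unfolding m_def n_def by (auto simp: le_nat_iff le_ceiling_iff nat_le_real_less) linarith+
      hence "of_nat a / of_nat b \<in> Y" unfolding Y_def by force
      thus ?thesis using ab(6) by blast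
    qed simp
  qed
  moreover have "finite Y" by (simp add: Y_def)
  ultimately show ?thesis by (meson finite.insertI finite_UnI finite_imageI finite_subset)
qed

text \<open>If \<open>p\<close> divides neither the leading nor the constant coefficient of an
  integer equation of \<open>x\<close>, an absolute value above 1 would make the leading term
  dominate, and one below 1 the constant term.\<close>

lemma finite_bad_primes:
  assumes "algebraic x" "x \<noteq> 0"
  shows "finite {p. prime p \<and> padic_abs p x \<noteq> 1}"
proof -
  obtain q where q: "q \<noteq> 0" "coeff q 0 \<noteq> 0" "poly (map_poly of_int q) x = 0"
    by (rule algebraicE'_nonzero[OF assms])
  define c where "c = (\<lambda>i. of_int (coeff q i) :: complex)"
  define n where "n = degree q"
  have "degree (map_poly of_int q :: complex poly) = n" unfolding n_def by (rule degree_map_poly) simp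
  hence sum: "(\<Sum>i\<le>n. c i * x ^ i) = 0" using q(3) by (simp add: poly_altdef c_def coeff_map_poly)
  define bad where "bad = {p. int p dvd coeff q 0} \<union> {p. int p dvd coeff q n}"
  have "finite bad" unfolding bad_def
  proof (intro finite_UnI)
    have "finite {p. int p dvd k}" if "k \<noteq> 0" for k
    proof -
      have "{p. int p dvd k} \<subseteq> nat ` {m. m dvd k}" by force
      thus ?thesis using finite_divisors_int[OF that] by (meson finite_imageI finite_subset)
    qed
    thus "finite {p. int p dvd coeff q 0}" "finite {p. int p dvd coeff q n}" using q by (auto simp: n_def)
  qed
  moreover have "padic_abs p x = 1" if p: "prime p" and "p \<notin> bad" for p
  proof -
    have c0: "padic_abs p (c 0) = 1" "padic_abs p (c n) = 1"
      using \<open>p \<notin> bad\<close> by (auto simp: bad_def c_def intro!: padic_abs_coprime[OF p])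
    have alg: "algebraic (c i * x ^ i)" for i
      using assms unfolding c_def by (intro algebraic_mult algebraic_power) auto
    define r where "r = padic_abs p x"
    have r: "r > 0" unfolding r_def using padic_abs_pos[OF p] assms by blast
    have trm: "padic_abs p (c i * x ^ i) = padic_abs p (c i) * r ^ i" for i
      using assms by (simp add: padic_abs_mult[OF p] padic_abs_power[OF p] algebraic_power c_def r_def)
    have le: "padic_abs p (c i * x ^ i) \<le> r ^ i" for i
    proof -
      have "padic_abs p (c i) * r ^ i \<le> 1 * r ^ i"
        using r padic_abs_int[OF p] by (intro mult_right_mono) (auto simp: c_def)
      thus ?thesis using trm by simp
    qed
    have "\<not> r > 1"
    proof
      assume r1: "r > 1"
      have "n \<noteq> 0"
      proof
        assume "n = 0"
        hence "c 0 = 0" using sum by simp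
        thus False using c0 padic_abs_0[OF p] by simp
      qed
      have "(\<Sum>i\<le>n. c i * x ^ i) = (\<Sum>i<n. c i * x ^ i) + c n * x ^ n"
        by (simp add: lessThan_Suc_atMost [symmetric])
      hence "c n * x ^ n = - (\<Sum>i<n. c i * x ^ i)" using sum by (simp add: eq_neg_iff_add_eq_0 add.commute)
      hence "padic_abs p (c n * x ^ n) = padic_abs p (\<Sum>i<n. c i * x ^ i)"
        using padic_abs_uminus[OF p] alg by (simp add: algebraic_sum)
      also have "\<dots> \<le> r ^ (n - 1)"
      proof (rule padic_abs_sum_le[OF p alg])
        fix i assume "i \<in> {..<n}"
        hence "r ^ i \<le> r ^ (n - 1)" using r1 by (intro power_increasing) auto
        thus "padic_abs p (c i * x ^ i) \<le> r ^ (n - 1)" using le[of i] by simp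
      qed (use r in auto)
      also have "\<dots> < r ^ n" using r1 \<open>n \<noteq> 0\<close> by (intro power_strict_increasing) auto
      finally show False using trm[of n] c0 by simp
    qed
    moreover have "\<not> r < 1"
    proof
      assume r1: "r < 1"
      have "(\<Sum>i\<le>n. c i * x ^ i) = c 0 + (\<Sum>i\<in>{1..n}. c i * x ^ i)"
        by (subst atMost_atLeast0, subst sum.atLeast_Suc_atMost) auto
      hence "c 0 = - (\<Sum>i\<in>{1..n}. c i * x ^ i)" using sum by (simp add: eq_neg_iff_add_eq_0)
      hence "padic_abs p (c 0) = padic_abs p (\<Sum>i\<in>{1..n}. c i * x ^ i)"
        using padic_abs_uminus[OF p] alg by (simp add: algebraic_sum)
      also have "\<dots> \<le> r"
      proof (rule padic_abs_sum_le[OF p alg])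
        fix i assume "i \<in> {1..n}"
        hence "r ^ i \<le> r ^ 1" using r1 r by (intro power_decreasing) auto
        thus "padic_abs p (c i * x ^ i) \<le> r" using le[of i] by simp
      qed (use r in auto)
      finally show False using c0 r1 by simp
    qed
    ultimately show ?thesis by (simp add: r_def)
  qed
  ultimately show ?thesis by (metis (mono_tags, lifting) finite_subset mem_Collect_eq subsetI)
qed

section \<open>Units of a number field\<close>

lemma powi_eq_1D:
  assumes "(r::real) powi k = 1" "r > 0" "k \<noteq> 0"
  shows "r = 1"
proof -
  have pow: "r ^ n = 1 \<Longrightarrow> n > 0 \<Longrightarrow> r = 1" for n
    using assms(2) power_eq_imp_eq_base[of r n 1] by simp
  show ?thesis
  proof (cases "k \<ge> 0")
    case True
    thus ?thesis using assms pow[of "nat k"] by (simp add: power_int_def)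
  next
    case False
    hence "inverse r ^ nat (- k) = 1" using assms by (simp add: power_int_def)
    thus ?thesis using pow[of "nat (- k)"] False by (simp add: power_inverse)
  qed
qed

section \<open>Embeddings, places and S-integers of a simple extension\<close>

locale number_places =
  fixes \<theta> :: complex and f :: "complex poly"
  assumes alg_\<theta>: "algebraic \<theta>" and min_f: "min_poly \<rat> \<theta> f"
begin

abbreviation "K \<equiv> rat_adjoin \<theta>"
definition "T = {t. poly f t = 0}"

lemma f_nz: "f \<noteq> 0" and f_\<theta>: "poly f \<theta> = 0" and f_Rats: "f \<in> polys_over \<rat>"
  using min_f by (auto simp: min_poly_def)

lemma finite_T: "finite T" and \<theta>_T: "\<theta> \<in> T"
  using f_nz f_\<theta> by (auto simp: T_def intro: poly_roots_finite)

lemma algebraic_T: "t \<in> T \<Longrightarrow> algebraic t"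
  using f_nz f_Rats by (intro algebraicI'[of f]) (auto simp: T_def polys_over_def)

lemmas K = subfield_rat_adjoin[OF alg_\<theta>]
lemmas K_simps = subfield_add[OF K] subfield_mult[OF K] subfield_diff[OF K] subfield_uminus[OF K]
  subfield_divide[OF K] subfield_inverse[OF K] subfield_power[OF K] subfield_powi[OF K]
  subfield_0[OF K] subfield_1[OF K]

text \<open>The embedding of \<open>K\<close> that maps \<open>\<theta>\<close> to the root \<open>t\<close>; \<open>conj_poly\<close> shows independence of the choice.\<close>
definition conj :: "complex \<Rightarrow> complex \<Rightarrow> complex" where
  "conj t x = poly (SOME q. q \<in> polys_over \<rat> \<and> poly q \<theta> = x) t"

lemma conj_poly:
  assumes "q \<in> polys_over \<rat>" "t \<in> T"
  shows "conj t (poly q \<theta>) = poly q t"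
proof -
  define r where "r = (SOME r. r \<in> polys_over \<rat> \<and> poly r \<theta> = poly q \<theta>)"
  have r: "r \<in> polys_over \<rat> \<and> poly r \<theta> = poly q \<theta>"
    unfolding r_def by (rule someI[of _ q]) (use assms in auto)
  hence "q - r \<in> polys_over \<rat>" "poly (q - r) \<theta> = 0"
    using polys_over_diff[OF subfield_RatsI assms(1)] by auto
  hence "poly (q - r) t = 0"
    using min_poly_conjugate[OF subfield_RatsI min_f, of t "q - r"] assms(2) unfolding T_def by blast
  thus ?thesis by (simp add: conj_def r_def)
qed

lemma K_cases:
  assumes "x \<in> K"
  obtains q where "q \<in> polys_over \<rat>" "x = poly q \<theta>"
  using assms unfolding rat_adjoin_def by blast

context
  fixes t assumes t: "t \<in> T"
begin

lemma conj_add: "x \<in> K \<Longrightarrow> y \<in> K \<Longrightarrow> conj t (x + y) = conj t x + conj t y"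
  by (elim K_cases) (simp add: conj_poly[OF _ t] flip: poly_add add: polys_over_add[OF subfield_RatsI])

lemma conj_mult: "x \<in> K \<Longrightarrow> y \<in> K \<Longrightarrow> conj t (x * y) = conj t x * conj t y"
  by (elim K_cases) (simp add: conj_poly[OF _ t] flip: poly_mult add: polys_over_mult[OF subfield_RatsI])

lemma conj_Rats: "x \<in> \<rat> \<Longrightarrow> conj t x = x"
  using conj_poly[OF polys_over_const[OF subfield_RatsI] t, of x] by simp

lemma conj_0 [simp]: "conj t 0 = 0" and conj_1 [simp]: "conj t 1 = 1"
  by (simp_all add: conj_Rats)

lemma conj_eq_0_iff: "x \<in> K \<Longrightarrow> conj t x = 0 \<longleftrightarrow> x = 0"
  using min_poly_conjugate[OF subfield_RatsI min_f] t
  by (elim K_cases) (auto simp: conj_poly[OF _ t] T_def)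

lemma conj_uminus: "x \<in> K \<Longrightarrow> conj t (- x) = - conj t x"
  using conj_mult[of "-1" x] conj_Rats[of "-1"] subfield_Rats[OF K, of "-1"] by simp

lemma conj_diff: "x \<in> K \<Longrightarrow> y \<in> K \<Longrightarrow> conj t (x - y) = conj t x - conj t y"
  using conj_add[of x "- y"] conj_uminus[of y] K_simps(4)[of y] by simp

lemma conj_inverse: "x \<in> K \<Longrightarrow> conj t (inverse x) = inverse (conj t x)"
proof (cases "x = 0")
  case False
  assume x: "x \<in> K"
  have "conj t x * conj t (inverse x) = 1" using conj_mult[OF x K_simps(6)[OF x]] False by simp
  thus ?thesis by (metis inverse_unique)
qed simp

lemma conj_power: "x \<in> K \<Longrightarrow> conj t (x ^ n) = conj t x ^ n"
  by (induction n) (auto simp: conj_mult K_simps)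

lemma conj_powi: "x \<in> K \<Longrightarrow> conj t (x powi n) = conj t x powi n"
  by (auto simp: power_int_def conj_power conj_inverse K_simps power_inverse)

lemma conj_prod: "(\<And>i. i \<in> I \<Longrightarrow> g i \<in> K) \<Longrightarrow> conj t (\<Prod>i\<in>I. g i) = (\<Prod>i\<in>I. conj t (g i))"
  by (induction I rule: infinite_finite_induct) (auto simp: conj_mult subfield_prod[OF K])

lemma algebraic_conj: "x \<in> K \<Longrightarrow> algebraic (conj t x)"
proof (elim K_cases)
  fix q assume "q \<in> polys_over \<rat>" "x = poly q \<theta>"
  hence "conj t x = (\<Sum>i\<le>degree q. coeff q i * t ^ i)" "\<And>i. coeff q i \<in> \<rat>"
    using conj_poly[OF _ t] by (auto simp: poly_altdef polys_over_def)
  thus ?thesis using algebraic_T[OF t]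
    by (auto intro!: algebraic_sum algebraic_mult[OF rat_imp_algebraic algebraic_power])
qed

end

lemma conj_\<theta>: "x \<in> K \<Longrightarrow> conj \<theta> x = x"
  by (elim K_cases) (simp add: conj_poly[OF _ \<theta>_T])

lemma norm_Rats: "x \<in> K \<Longrightarrow> (\<Prod>t\<in>T. conj t x) \<in> \<rat>"
  using norm_rational[OF min_f] unfolding T_def [symmetric]
  by (elim K_cases) (simp add: conj_poly cong: prod.cong)

text \<open>\<^const>\<open>None\<close> stands for the archimedean place of \<open>\<rat>\<close>.\<close>
fun place :: "complex \<times> nat option \<Rightarrow> complex \<Rightarrow> real" where
  "place (t, None) x = cmod (conj t x)"
| "place (t, Some p) x = padic_abs p (conj t x)"

definition places :: "nat set \<Rightarrow> (complex \<times> nat option) set" where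
  "places S = T \<times> insert None (Some ` S)"

definition s_integers :: "nat set \<Rightarrow> complex set" where
  "s_integers S = {x\<in>K. \<forall>p. prime p \<longrightarrow> p \<notin> S \<longrightarrow> (\<forall>t\<in>T. padic_abs p (conj t x) \<le> 1)}"

text \<open>
  The characteristic polynomial \<open>\<chi> x\<close> is determined by its values at \<open>0, \<dots>, d\<close>, which are norms and hence rational
  numbers of bounded height.
\<close>
lemma northcott_s_integers:
  assumes S: "finite S" "\<And>p. p \<in> S \<Longrightarrow> prime p"
  shows "finite {x\<in>s_integers S. \<forall>w\<in>places S. place w x \<le> B}" (is "finite ?A")
proof -
  define d where "d = card T"
  \<comment> \<open>A bound for the product of the \<open>d\<close> factors
    \<open>y - conj t x\<close> with \<open>y \<le> d\<close>. The extra 1 makes the base at least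
    1, as the p-adic estimate requires.\<close>
  define C where "C = (real d + \<bar>B\<bar> + 1) ^ d"
  define X where "X = {x\<in>\<rat>. cmod x \<le> C \<and> (\<forall>p. prime p \<longrightarrow> p \<notin> S \<longrightarrow> padic_abs p x \<le> 1) \<and> (\<forall>p\<in>S. padic_abs p x \<le> C)}"
  define \<chi> where "\<chi> = (\<lambda>x. \<Prod>t\<in>T. [:- conj t x, 1:])"
  define g where "g = (\<lambda>x. \<lambda>y\<in>{..d}. poly (\<chi> x) (of_nat y))"
  have C1: "real d + \<bar>B\<bar> + 1 \<ge> 1" by simp
  have ev: "poly (\<chi> x) (of_nat y) \<in> X" if x: "x \<in> ?A" and y: "y \<le> d" for x y
  proof -
    define N where "N = (\<Prod>t\<in>T. of_nat y - conj t x)"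
    have xK: "x \<in> K" and int: "\<And>p t. prime p \<Longrightarrow> p \<notin> S \<Longrightarrow> t \<in> T \<Longrightarrow> padic_abs p (conj t x) \<le> 1"
      and inf: "\<And>t. t \<in> T \<Longrightarrow> cmod (conj t x) \<le> B"
      and fin: "\<And>t p. t \<in> T \<Longrightarrow> p \<in> S \<Longrightarrow> padic_abs p (conj t x) \<le> B"
      using x by (auto simp: s_integers_def places_def)
    have yK: "of_nat y \<in> K" by (rule subfield_Rats[OF K]) simp
    have cj: "conj t (of_nat y - x) = of_nat y - conj t x" if "t \<in> T" for t
      using conj_diff[OF that yK xK] conj_Rats[OF that] by simp
    have eq: "poly (\<chi> x) (of_nat y) = N"
      by (simp add: \<chi>_def N_def poly_prod)
    have "N \<in> \<rat>"
      using norm_Rats[OF K_simps(3)[OF yK xK]] cj by (simp add: N_def)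
    moreover have "cmod N \<le> C"
    proof -
      have "cmod N = (\<Prod>t\<in>T. cmod (of_nat y - conj t x))"
        by (simp add: N_def prod_norm)
      also have "\<dots> \<le> (\<Prod>t\<in>T. real d + \<bar>B\<bar> + 1)"
      proof (rule prod_mono, safe)
        fix t assume "t \<in> T"
        have "cmod (of_nat y - conj t x) \<le> cmod (of_nat y) + cmod (conj t x)" by (rule norm_triangle_ineq4)
        also have "\<dots> \<le> real d + \<bar>B\<bar> + 1" using y inf[OF \<open>t \<in> T\<close>] by simp
        finally show "cmod (of_nat y - conj t x) \<le> real d + \<bar>B\<bar> + 1" .
      qed simp
      finally show ?thesis by (simp add: C_def d_def)
    qed
    moreover have "padic_abs p N \<le> D ^ d"
      if p: "prime p" and D: "D \<ge> 1" "\<And>t. t \<in> T \<Longrightarrow> padic_abs p (conj t x) \<le> D" for p D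
    proof -
      have alg: "algebraic (of_nat y - conj t x)" if "t \<in> T" for t
        using algebraic_conj[OF that xK] by (intro algebraic_diff) auto
      have "padic_abs p N = (\<Prod>t\<in>T. padic_abs p (of_nat y - conj t x))"
        using padic_abs_prod[OF p, of T "\<lambda>t. of_nat y - conj t x"] alg by (simp add: N_def)
      also have "\<dots> \<le> (\<Prod>t\<in>T. D)"
      proof (rule prod_mono, safe)
        fix t assume t: "t \<in> T"
        show "0 \<le> padic_abs p (of_nat y - conj t x)" by (rule padic_abs_nonneg[OF p])
        have "padic_abs p (of_nat y - conj t x) \<le> max (padic_abs p (of_nat y)) (padic_abs p (conj t x))"
          using algebraic_conj[OF t xK] by (intro padic_abs_diff[OF p]) auto
        also have "\<dots> \<le> D" using D(1) D(2)[OF t] padic_abs_int[OF p, of "int y"] by simp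
        finally show "padic_abs p (of_nat y - conj t x) \<le> D" .
      qed
      finally show ?thesis by (simp add: d_def)
    qed
    note bnd = this
    have "padic_abs p N \<le> 1" if "prime p" "p \<notin> S" for p
      using bnd[OF that(1), of 1] int[OF that] by simp
    moreover have "padic_abs p N \<le> C" if "p \<in> S" for p
      unfolding C_def
    proof (rule bnd[OF S(2)[OF that] C1])
      fix t assume "t \<in> T"
      thus "padic_abs p (conj t x) \<le> real d + \<bar>B\<bar> + 1" using fin[OF _ that, of t] by simp
    qed
    ultimately show ?thesis unfolding X_def eq by blast
  qed
  have "g ` ?A \<subseteq> (\<Pi>\<^sub>E y\<in>{..d}. X)"
    unfolding g_def using ev by (intro image_subsetI restrict_PiE_iff[THEN iffD2] ballI) auto
  moreover have "finite X" unfolding X_def by (rule finite_rationals_bounded[OF S])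
  hence "finite (\<Pi>\<^sub>E y\<in>{..d}. X)" by (intro finite_PiE) auto
  ultimately have fin: "finite (g ` ?A)" by (rule finite_subset)
  have fiber: "finite {x\<in>?A. g x = g x0}" for x0
  proof (rule finite_subset)
    have deg: "degree (\<chi> x) \<le> d" and \<chi>nz: "\<chi> x \<noteq> 0" for x
      unfolding \<chi>_def d_def
      using degree_prod_sum_le[OF finite_T, of "\<lambda>t. [:- conj t x, 1:]"] finite_T by auto
    show "{x\<in>?A. g x = g x0} \<subseteq> {x. poly (\<chi> x0) x = 0}"
    proof safe
      fix x assume x: "x \<in> s_integers S" "g x = g x0"
      have "poly (\<chi> x) (of_nat y) = poly (\<chi> x0) (of_nat y)" if "y \<le> d" for y
        using fun_cong[OF x(2), of y] that by (simp add: g_def)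
      hence "of_nat ` {..d} \<subseteq> {z. poly (\<chi> x - \<chi> x0) z = 0}" by auto
      hence "\<chi> x - \<chi> x0 \<noteq> 0 \<Longrightarrow> card (of_nat ` {..d} :: complex set) \<le> card {z. poly (\<chi> x - \<chi> x0) z = 0}"
        by (intro card_mono poly_roots_finite)
      moreover have "card (of_nat ` {..d} :: complex set) = d + 1"
        by (subst card_image) (auto simp: inj_on_def)
      moreover have "\<chi> x - \<chi> x0 \<noteq> 0 \<Longrightarrow> card {z. poly (\<chi> x - \<chi> x0) z = 0} \<le> degree (\<chi> x - \<chi> x0)"
        by (rule card_poly_roots_bound)
      moreover have "degree (\<chi> x - \<chi> x0) \<le> d" by (intro degree_diff_le deg)
      ultimately have "\<chi> x - \<chi> x0 = 0" by linarith
      hence "\<chi> x0 = \<chi> x" by simp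
      moreover have "x \<in> K" using x by (simp add: s_integers_def)
      \<comment> \<open>The identity embedding belongs to the root \<theta>, so \<open>x\<close> is
        a root of its own characteristic polynomial.\<close>
      hence "poly (\<chi> x) x = 0" unfolding \<chi>_def poly_prod
        using finite_T \<theta>_T conj_\<theta> by (intro prod_zero bexI[of _ \<theta>]) auto
      ultimately show "poly (\<chi> x0) x = 0" by simp
    qed
    show "finite {x. poly (\<chi> x0) x = 0}" by (rule poly_roots_finite[OF \<chi>nz])
  qed
  have "?A \<subseteq> (\<Union>z\<in>g ` ?A. {x\<in>?A. g x = z})" by blast
  moreover have "finite (\<Union>z\<in>g ` ?A. {x\<in>?A. g x = z})"
  proof (rule finite_UN_I[OF fin])
    fix z assume "z \<in> g ` ?A"
    then obtain x0 where "z = g x0" by blast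
    thus "finite {x\<in>?A. g x = z}" by (simp only: fiber)
  qed
  ultimately show ?thesis by (rule finite_subset)
qed

lemma valued_ring_s_integers:
  assumes S: "finite S" "\<And>p. p \<in> S \<Longrightarrow> prime p"
  shows "valued_ring (s_integers S) (places S) place"
proof
  show "1 \<in> s_integers S" by (auto simp: s_integers_def K_simps)
  fix x assume x: "x \<in> s_integers S"
  hence xK: "x \<in> K" by (simp add: s_integers_def)
  show "- x \<in> s_integers S"
    using x by (auto simp: s_integers_def K_simps conj_uminus padic_abs_uminus algebraic_conj)
  show "place w x > 0" if "w \<in> places S" "x \<noteq> 0" for w
    using that xK S(2) by (auto simp: places_def conj_eq_0_iff padic_abs_pos)
  fix y assume y: "y \<in> s_integers S"
  hence yK: "y \<in> K" by (simp add: s_integers_def)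
  show "x + y \<in> s_integers S"
  proof -
    have "padic_abs p (conj t (x + y)) \<le> 1" if "prime p" "p \<notin> S" "t \<in> T" for p t
      using padic_abs_add[OF that(1) algebraic_conj[OF that(3) xK] algebraic_conj[OF that(3) yK]] x y that
      by (auto simp: conj_add[OF that(3) xK yK] s_integers_def intro: order.trans)
    thus ?thesis using xK yK by (auto simp: s_integers_def K_simps)
  qed
  show "x * y \<in> s_integers S"
  proof -
    have "padic_abs p (conj t (x * y)) \<le> 1" if "prime p" "p \<notin> S" "t \<in> T" for p t
      using padic_abs_mult[OF that(1) algebraic_conj[OF that(3) xK] algebraic_conj[OF that(3) yK]] x y that
      by (auto simp: conj_mult[OF that(3) xK yK] s_integers_def intro!: mult_le_one padic_abs_nonneg)
    thus ?thesis using xK yK by (auto simp: s_integers_def K_simps)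
  qed
  show "place w (x * y) = place w x * place w y" if "w \<in> places S" for w
    using that S(2) xK yK by (auto simp: places_def conj_mult norm_mult padic_abs_mult algebraic_conj)
  show "place w (x + y) \<le> place w x + place w y" if w: "w \<in> places S" for w
  proof -
    have "padic_abs p (conj t x + conj t y) \<le> padic_abs p (conj t x) + padic_abs p (conj t y)"
      if "prime p" "t \<in> T" for p t
      using padic_abs_add[OF that(1) algebraic_conj[OF that(2) xK] algebraic_conj[OF that(2) yK]]
        padic_abs_nonneg[OF that(1), of "conj t x"] padic_abs_nonneg[OF that(1), of "conj t y"] by linarith
    thus ?thesis using w S(2) xK yK by (auto simp: places_def conj_add norm_triangle_ineq)
  qed
next
  show "finite (places S)" using S finite_T by (simp add: places_def)
  show "place w 0 = 0" if "w \<in> places S" for w using that S(2) by (auto simp: places_def)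
  show "finite {x\<in>s_integers S. \<forall>w\<in>places S. place w x \<le> B}" for B by (rule northcott_s_integers[OF S])
  fix x assume x: "x \<in> s_integers S" "x \<noteq> 0"
  hence xK: "x \<in> K" by (simp add: s_integers_def)
  \<comment> \<open>The norm is rational and integral outside \<open>S\<close>, so the product
    formula over \<rat> applies to it; multiplicativity distributes the result over the
    embeddings.\<close>
  define N where "N = (\<Prod>t\<in>T. conj t x)"
  have N: "N \<in> \<rat>" "N \<noteq> 0" unfolding N_def
    using norm_Rats[OF xK] finite_T conj_eq_0_iff[OF _ xK] x(2) by (auto simp: prod_zero_iff)
  have vN: "padic_abs p N = (\<Prod>t\<in>T. padic_abs p (conj t x))" if "prime p" for p
    unfolding N_def using padic_abs_prod[OF that, of T "\<lambda>t. conj t x"] algebraic_conj[OF _ xK] by simp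
  have "padic_abs p N \<le> 1" if "prime p" "p \<notin> S" for p
    unfolding vN[OF that(1)] using x(1) that
    by (intro prod_le_1) (auto simp: s_integers_def padic_abs_nonneg)
  hence "1 \<le> cmod N * (\<Prod>p\<in>S. padic_abs p N)" by (intro product_formula_ge_1[OF S N])
  also have "\<dots> = (\<Prod>t\<in>T. cmod (conj t x)) * (\<Prod>p\<in>S. \<Prod>t\<in>T. padic_abs p (conj t x))"
    using S(2) by (simp add: vN cong: prod.cong) (simp add: N_def prod_norm)
  also have "\<dots> = (\<Prod>w\<in>places S. place w x)"
  proof -
    have "(\<Prod>w\<in>places S. place w x) = (\<Prod>t\<in>T. \<Prod>w\<in>insert None (Some ` S). place (t, w) x)"
      unfolding places_def by (simp add: prod.cartesian_product)
    also have "\<dots> = (\<Prod>t\<in>T. cmod (conj t x) * (\<Prod>p\<in>S. padic_abs p (conj t x)))"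
      using S(1) by (simp add: prod.insert prod.reindex)
    also have "\<dots> = (\<Prod>t\<in>T. cmod (conj t x)) * (\<Prod>p\<in>S. \<Prod>t\<in>T. padic_abs p (conj t x))"
      by (simp add: prod.distrib prod.swap[of _ S T])
    finally show ?thesis by simp
  qed
  finally show "1 \<le> (\<Prod>w\<in>places S. place w x)" .
qed

section \<open>S-units and functions with three zeros or poles\<close>

definition s_unit :: "nat set \<Rightarrow> complex \<Rightarrow> bool" where
  "s_unit S x \<longleftrightarrow> x \<in> K \<and> x \<noteq> 0 \<and> (\<forall>p. prime p \<longrightarrow> p \<notin> S \<longrightarrow> (\<forall>t\<in>T. padic_abs p (conj t x) = 1))"

lemma s_unit_K: "s_unit S x \<Longrightarrow> x \<in> K" and s_unit_nz: "s_unit S x \<Longrightarrow> x \<noteq> 0"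
  by (auto simp: s_unit_def)

lemma s_unit_mult: "s_unit S x \<Longrightarrow> s_unit S y \<Longrightarrow> s_unit S (x * y)"
  by (auto simp: s_unit_def K_simps conj_mult padic_abs_mult algebraic_conj)

lemma s_unit_inverse: "s_unit S x \<Longrightarrow> s_unit S (inverse x)"
  by (auto simp: s_unit_def K_simps conj_inverse padic_abs_inverse algebraic_conj)

lemma s_unit_divide: "s_unit S x \<Longrightarrow> s_unit S y \<Longrightarrow> s_unit S (x / y)"
  by (simp add: divide_inverse s_unit_mult s_unit_inverse)

theorem s_unit_equation_finite:
  assumes S: "finite S" "\<And>p. p \<in> S \<Longrightarrow> prime p"
  shows "finite {x. s_unit S x \<and> s_unit S (1 - x)}"
proof -
  interpret valued_ring "s_integers S" "places S" place by (rule valued_ring_s_integers[OF S])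
  have "unit x" if "s_unit S x" for x
  proof -
    have "y \<in> s_integers S" if "s_unit S y" for y using that by (auto simp: s_unit_def s_integers_def)
    thus ?thesis unfolding unit_def using that s_unit_inverse s_unit_nz by blast
  qed
  hence "{x. s_unit S x \<and> s_unit S (1 - x)} \<subseteq> unit_solutions" by (auto simp: unit_solutions_def)
  thus ?thesis using finite_unit_solutions finite_subset by blast
qed

text \<open>By \<open>finite_bad_primes\<close>, each conjugate of each element of \<open>X\<close>
  fails to be a unit at finitely many primes only.\<close>

lemma enlarge_S:
  assumes S: "finite S" "\<And>p. p \<in> S \<Longrightarrow> prime p" and X: "finite X" "X \<subseteq> K" "0 \<notin> X"
  obtains S' where "finite S'" "\<And>p. p \<in> S' \<Longrightarrow> prime p" "S \<subseteq> S'" "\<And>x. x \<in> X \<Longrightarrow> s_unit S' x"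
proof -
  define S' where "S' = S \<union> (\<Union>x\<in>X. \<Union>t\<in>T. {p. prime p \<and> padic_abs p (conj t x) \<noteq> 1})"
  have nz: "conj t x \<noteq> 0" if "x \<in> X" "t \<in> T" for x t
    using conj_eq_0_iff[OF that(2), of x] X that(1) by blast
  have al: "algebraic (conj t x)" if "x \<in> X" "t \<in> T" for x t
    using algebraic_conj[OF that(2), of x] X that(1) by blast
  show thesis
  proof (rule that)
    show "finite S'" unfolding S'_def using S(1) X(1) finite_T al nz
      by (intro finite_UnI finite_UN_I finite_bad_primes)
    show "prime p" if "p \<in> S'" for p using that S(2) by (auto simp: S'_def)
    show "S \<subseteq> S'" by (auto simp: S'_def)
    show "s_unit S' x" if "x \<in> X" for x unfolding s_unit_def
    proof (intro conjI allI impI ballI)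
      show "x \<in> K" "x \<noteq> 0" using that X by auto
      show "padic_abs p (conj t x) = 1" if "prime p" "p \<notin> S'" "t \<in> T" for p t
        using that \<open>x \<in> X\<close> by (auto simp: S'_def)
    qed
  qed
qed

lemma s_unit_root: "x \<in> K \<Longrightarrow> s_unit S (x ^ n) \<Longrightarrow> n > 0 \<Longrightarrow> s_unit S x"
proof -
  assume x: "x \<in> K" "s_unit S (x ^ n)" "n > 0"
  have "padic_abs p (conj t x) = 1" if "prime p" "p \<notin> S" "t \<in> T" for p t
  proof (rule power_eq_imp_eq_base)
    show "padic_abs p (conj t x) ^ n = 1 ^ n"
      using x that by (simp add: s_unit_def conj_power padic_abs_power algebraic_conj)
  qed (use that x in \<open>auto simp: padic_abs_nonneg\<close>)
  thus ?thesis using x by (auto simp: s_unit_def)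
qed

text \<open>
  Modulo the place, \<open>u\<close> can meet at most one point of \<open>Z \<union> {\<infinity>}\<close>, and if it did, the product would not be a unit.
\<close>
lemma local_units:
  assumes p: "prime p" and t: "t \<in> T" and Z: "finite Z" "Z \<subseteq> K" and c: "c \<in> K" and u: "u \<in> K" "u \<notin> Z"
    and e: "\<And>z. z \<in> Z \<Longrightarrow> e z \<noteq> (0::int)"
    and vc: "padic_abs p (conj t c) = 1" and vZ: "\<And>z. z \<in> Z \<Longrightarrow> padic_abs p (conj t z) \<le> 1"
    and vd: "\<And>z z'. z \<in> Z \<Longrightarrow> z' \<in> Z \<Longrightarrow> z \<noteq> z' \<Longrightarrow> padic_abs p (conj t (z - z')) = 1"
    and v1: "padic_abs p (conj t (c * (\<Prod>z\<in>Z. (u - z) powi e z))) = 1"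
  shows "\<exists>r. (\<forall>z\<in>Z. padic_abs p (conj t (u - z)) = r) \<and> ((\<Sum>z\<in>Z. e z) \<noteq> 0 \<longrightarrow> r = 1)"
proof -
  define v where "v = (\<lambda>x. padic_abs p (conj t x))"
  have zK: "z \<in> Z \<Longrightarrow> z \<in> K" "z \<in> Z \<Longrightarrow> u - z \<in> K" for z using Z u by (auto simp: K_simps)
  have pos: "v (u - z) > 0" if "z \<in> Z" for z
    unfolding v_def using that zK u conj_eq_0_iff[OF t] by (intro padic_abs_pos[OF p]) auto
  have "v (c * (\<Prod>z\<in>Z. (u - z) powi e z)) = v c * (\<Prod>z\<in>Z. v (u - z) powi e z)"
  proof -
    have K1: "(\<Prod>z\<in>Z. (u - z) powi e z) \<in> K" by (intro subfield_prod[OF K] subfield_powi[OF K] zK(2))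
    have al: "algebraic (conj t ((u - z) powi e z))" if "z \<in> Z" for z
      by (intro algebraic_conj[OF t] subfield_powi[OF K] zK(2) that)
    have "conj t (\<Prod>z\<in>Z. (u - z) powi e z) = (\<Prod>z\<in>Z. conj t ((u - z) powi e z))"
      by (intro conj_prod[OF t] subfield_powi[OF K] zK(2))
    hence "v (\<Prod>z\<in>Z. (u - z) powi e z) = (\<Prod>z\<in>Z. padic_abs p (conj t ((u - z) powi e z)))"
      using padic_abs_prod[OF p, of Z "\<lambda>z. conj t ((u - z) powi e z)"] al by (simp add: v_def)
    also have "\<dots> = (\<Prod>z\<in>Z. v (u - z) powi e z)"
      using zK by (intro prod.cong refl)
        (simp add: v_def conj_powi[OF t] padic_abs_powi[OF p] algebraic_conj[OF t])
    finally show ?thesis using c K1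
      by (simp add: v_def conj_mult[OF t] padic_abs_mult[OF p] algebraic_conj[OF t])
  qed
  hence prod1: "(\<Prod>z\<in>Z. v (u - z) powi e z) = 1" using vc v1 by (simp add: v_def)
  show ?thesis
  proof (cases "v u > 1")
    case True
    \<comment> \<open>Here \<open>u\<close> meets infinity: every factor has the size of
      \<open>u\<close>, so the product has size \<open>v u\<close> to the sum of the
      exponents.\<close>
    have eq: "v (u - z) = v u" if z: "z \<in> Z" for z
    proof -
      have "padic_abs p (- conj t z + conj t u) = padic_abs p (conj t u)"
        using zK(1)[OF z] u(1) vZ[OF z] True padic_abs_uminus[OF p algebraic_conj[OF t zK(1)[OF z]]]
        by (intro padic_abs_add_eq[OF p]) (auto simp: v_def algebraic_conj[OF t])
      thus ?thesis using conj_diff[OF t u(1) zK(1)[OF z]] by (simp add: v_def)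
    qed
    have "(\<Prod>z\<in>Z. v (u - z) powi e z) = (\<Prod>z\<in>Z. v u powi e z)" using eq by (intro prod.cong) auto
    also have "\<dots> = v u powi (\<Sum>z\<in>Z. e z)"
      using Z(1) True by (induction Z rule: finite_induct) (auto simp: power_int_add)
    finally have "v u powi (\<Sum>z\<in>Z. e z) = 1" using prod1 by simp
    hence "(\<Sum>z\<in>Z. e z) = 0" using powi_eq_1D[of "v u"] True by fastforce
    thus ?thesis using eq unfolding v_def by blast
  next
    case False
    have le: "v (u - z) \<le> 1" if z: "z \<in> Z" for z
    proof -
      have "v (u - z) \<le> max (v u) (v z)"
        unfolding v_def conj_diff[OF t u(1) zK(1)[OF z]]
        by (intro padic_abs_diff[OF p] algebraic_conj[OF t] u(1) zK(1)[OF z])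
      thus ?thesis using False vZ[OF z] by (simp add: v_def)
    qed
    have "v (u - z0) = 1" if z0: "z0 \<in> Z" for z0
    proof (rule ccontr)
      assume "v (u - z0) \<noteq> 1"
      hence lt: "v (u - z0) < 1" using le[OF z0] by simp
      \<comment> \<open>Here \<open>u\<close> meets \<open>z0\<close>. The points stay distinct
        modulo the place, so all other factors are units and only the one with exponent
        \<open>e z0\<close> remains.\<close>
      have one: "v (u - z) = 1" if z: "z \<in> Z" "z \<noteq> z0" for z
      proof -
        have "conj t (u - z) = conj t (u - z0) + conj t (z0 - z)"
          using u z z0 zK by (simp add: conj_diff[OF t])
        moreover have "padic_abs p (conj t (z0 - z)) = 1" using vd z0 z by metis
        ultimately show ?thesis unfolding v_def using lt z z0 zK
          padic_abs_add_eq[OF p algebraic_conj[OF t zK(2)[OF z0]] algebraic_conj[OF t K_simps(3)[OF zK(1)[OF z0] zK(1)[OF z(1)]]]]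
          by (simp add: v_def)
      qed
      have "(\<Prod>z\<in>Z. v (u - z) powi e z) = v (u - z0) powi e z0 * (\<Prod>z\<in>Z-{z0}. v (u - z) powi e z)"
        using Z(1) z0 by (rule prod.remove)
      also have "(\<Prod>z\<in>Z-{z0}. v (u - z) powi e z) = 1" using one by (intro prod.neutral) auto
      finally have "v (u - z0) powi e z0 = 1" using prod1 by simp
      hence "v (u - z0) = 1" using powi_eq_1D pos[OF z0] e[OF z0] by blast
      thus False using lt by simp
    qed
    thus ?thesis unfolding v_def by blast
  qed
qed

text \<open>The sum of the exponents is, up to sign, the order of the function at infinity; if it is
  nonzero, infinity serves as the third point.\<close>

theorem three_points_finite:
  assumes S: "finite S" "\<And>p. p \<in> S \<Longrightarrow> prime p" and Z: "finite Z" "Z \<subseteq> K" and c: "c \<in> K" "c \<noteq> 0"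
    and e: "\<And>z. z \<in> Z \<Longrightarrow> e z \<noteq> (0::int)"
    and card: "card Z \<ge> 3 \<or> card Z \<ge> 2 \<and> (\<Sum>z\<in>Z. e z) \<noteq> 0"
  shows "finite {u\<in>K. u \<notin> Z \<and> s_unit S (c * (\<Prod>z\<in>Z. (u - z) powi e z))}" (is "finite ?A")
proof -
  \<comment> \<open>Once these numbers are units, the points of \<open>Z\<close> are integral and
    pairwise distinct modulo every remaining place, as \<open>local_units\<close> demands. The point
    0 is integral anyway.\<close>
  define X where "X = {c} \<union> (\<lambda>(z, z'). z - z') ` {(z, z') \<in> Z \<times> Z. z \<noteq> z'} \<union> (Z - {0})"
  have "finite {(z, z') \<in> Z \<times> Z. z \<noteq> z'}" using Z by (intro finite_subset[OF _ finite_cartesian_product[OF Z(1) Z(1)]]) auto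
  hence "finite X" "X \<subseteq> K" "0 \<notin> X" using Z c by (auto simp: X_def intro!: K_simps(3))
  then obtain S' where S': "finite S'" "\<And>p. p \<in> S' \<Longrightarrow> prime p" "S \<subseteq> S'" "\<And>x. x \<in> X \<Longrightarrow> s_unit S' x"
    using enlarge_S[OF S] by metis
  have diff: "s_unit S' (z - z')" if "z \<in> Z" "z' \<in> Z" "z \<noteq> z'" for z z'
    using that by (intro S'(4)) (auto simp: X_def)
  have loc: "\<exists>r. (\<forall>z\<in>Z. padic_abs p (conj t (u - z)) = r) \<and> ((\<Sum>z\<in>Z. e z) \<noteq> 0 \<longrightarrow> r = 1)"
    if u: "u \<in> ?A" and p: "prime p" "p \<notin> S'" and t: "t \<in> T" for u p t
  proof (rule local_units[OF p(1) t Z c(1)])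
    show "u \<in> K" "u \<notin> Z" using u by auto
    show "padic_abs p (conj t c) = 1" using S'(4)[of c] p t by (simp add: X_def s_unit_def)
    show "padic_abs p (conj t z) \<le> 1" if "z \<in> Z" for z
      using S'(4)[of z] p t that padic_abs_0[OF p(1)] conj_0[OF t] by (cases "z = 0") (auto simp: X_def s_unit_def)
    show "padic_abs p (conj t (z - z')) = 1" if "z \<in> Z" "z' \<in> Z" "z \<noteq> z'" for z z'
      using diff[OF that] p t by (simp add: s_unit_def)
    have "p \<notin> S" using p S'(3) by blast
    thus "padic_abs p (conj t (c * (\<Prod>z\<in>Z. (u - z) powi e z))) = 1"
      using u p(1) t unfolding s_unit_def by blast
  qed (use e in auto)
  have quot: "s_unit S' ((u - z) / (u - z'))" if u: "u \<in> ?A" and z: "z \<in> Z" "z' \<in> Z" for u z z'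
  proof -
    have K': "u - z \<in> K" "u - z' \<in> K" using u z Z by (auto simp: K_simps)
    have nz: "u - z \<noteq> 0" "u - z' \<noteq> 0" using u z by auto
    have "padic_abs p (conj t ((u - z) / (u - z'))) = 1" if p: "prime p" "p \<notin> S'" and t: "t \<in> T" for p t
    proof -
      have "padic_abs p (conj t (u - z)) = padic_abs p (conj t (u - z'))" using loc[OF u p t] z by auto
      moreover have "padic_abs p (conj t (u - z')) > 0"
        using nz K' conj_eq_0_iff[OF t] by (intro padic_abs_pos[OF p(1)]) auto
      ultimately show ?thesis unfolding divide_inverse using K'
        by (simp add: conj_mult[OF t] conj_inverse[OF t] K_simps padic_abs_mult[OF p(1)]
            padic_abs_inverse[OF p(1)] algebraic_conj[OF t] algebraic_inverse)
    qed
    thus ?thesis using nz K' unfolding s_unit_def by (auto simp: K_simps)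
  qed
  have fin: "finite {x. s_unit S' x \<and> s_unit S' (1 - x)}" by (rule s_unit_equation_finite[OF S'(1,2)])
  have reduce: ?thesis if "\<And>u. u \<in> ?A \<Longrightarrow> s_unit S' (g u) \<and> s_unit S' (1 - g u)" "inj_on g ?A" for g
    using that finite_subset[OF _ fin, of "g ` ?A"] finite_imageD[of g ?A] by blast
  show ?thesis
  proof (cases "card Z \<ge> 3")
    case True
    obtain z1 z2 z3 where z: "z1 \<in> Z" "z2 \<in> Z" "z3 \<in> Z" "z1 \<noteq> z2" "z1 \<noteq> z3" "z2 \<noteq> z3"
    proof -
      obtain Z' where "Z' \<subseteq> Z" "card Z' = 3" using True by (metis obtain_subset_with_card_n)
      thus thesis using that by (auto simp: card_3_iff)
    qed
    \<comment> \<open>The cross ratio that sends \<open>z1\<close>, \<open>z3\<close>,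
      \<open>z2\<close> to 0, 1 and infinity.\<close>
    define g where "g = (\<lambda>u. (u - z1) / (u - z2) * ((z3 - z2) / (z3 - z1)))"
    show ?thesis
    proof (rule reduce)
      fix u assume u: "u \<in> ?A"
      have nz: "u - z2 \<noteq> 0" "z3 - z1 \<noteq> 0" using u z by auto
      have "1 - g u = ((u - z2) * (z3 - z1) - (u - z1) * (z3 - z2)) / ((u - z2) * (z3 - z1))"
      proof -
        have "1 - a / b * (c / d) = (b * d - a * c) / (b * d)" if "b \<noteq> 0" "d \<noteq> 0" for a b c d :: complex
          using that by (simp add: diff_divide_distrib)
        thus ?thesis unfolding g_def using nz by blast
      qed
      also have "(u - z2) * (z3 - z1) - (u - z1) * (z3 - z2) = (u - z3) * (z2 - z1)"
        by (simp add: algebra_simps)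
      finally have eq: "1 - g u = (u - z3) / (u - z2) * ((z2 - z1) / (z3 - z1))" by simp
      have "s_unit S' (1 - g u)" unfolding eq
        using z by (intro s_unit_mult s_unit_divide[OF diff diff] quot u) auto
      moreover have "s_unit S' (g u)" unfolding g_def
        using z by (intro s_unit_mult s_unit_divide[OF diff diff] quot u) auto
      ultimately show "s_unit S' (g u) \<and> s_unit S' (1 - g u)" by blast
    next
      show "inj_on g ?A"
      proof (rule inj_onI)
        fix u u' assume u: "u \<in> ?A" "u' \<in> ?A" "g u = g u'"
        have nz: "u - z2 \<noteq> 0" "u' - z2 \<noteq> 0" "z3 - z1 \<noteq> 0" "z3 - z2 \<noteq> 0" using u z by auto
        have "(u - z1) / (u - z2) = (u' - z1) / (u' - z2)" 
          using u(3) nz unfolding g_def by (metis divide_eq_0_iff mult_cancel_right)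
        hence "(u - z1) * (u' - z2) = (u' - z1) * (u - z2)" using nz by (simp add: frac_eq_eq)
        hence "(u - u') * (z1 - z2) = 0" by (simp add: algebra_simps)
        thus "u = u'" using z by simp
      qed
    qed
  next
    case False
    hence card2: "card Z = 2" and sum: "(\<Sum>z\<in>Z. e z) \<noteq> 0" using card by auto
    obtain z1 z2 where z: "z1 \<in> Z" "z2 \<in> Z" "z1 \<noteq> z2" using card2 by (auto simp: card_2_iff)
    have un: "s_unit S' (u - z)" if u: "u \<in> ?A" and z: "z \<in> Z" for u z
    proof -
      have "padic_abs p (conj t (u - z)) = 1" if p: "prime p" "p \<notin> S'" and t: "t \<in> T" for p t
        using loc[OF u p t] z sum by auto
      thus ?thesis using u z Z unfolding s_unit_def by (auto simp: K_simps)
    qed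
    \<comment> \<open>The coordinate with infinity as the third point: \<open>z1\<close> goes to 0
      and \<open>z2\<close> to 1.\<close>
    define g where "g = (\<lambda>u. (u - z1) / (z2 - z1))"
    show ?thesis
    proof (rule reduce)
      fix u assume u: "u \<in> ?A"
      have "1 - g u = (u - z2) / (z1 - z2)" unfolding g_def using z(3) by (simp add: field_simps)
      thus "s_unit S' (g u) \<and> s_unit S' (1 - g u)"
        using s_unit_divide[OF un[OF u z(2)] diff[OF z]] s_unit_divide[OF un[OF u z(1)] diff[OF z(2,1)]] z(3)
        by (simp add: g_def)
    next
      show "inj_on g ?A" unfolding g_def inj_on_def using z by auto
    qed
  qed
qed

end

section \<open>Orbits of rational functions\<close>

lemma poly_as_root_product:
  fixes F :: "complex poly"
  assumes "finite Z" "{z. poly F z = 0} \<subseteq> Z" "F \<noteq> 0"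
  shows "poly F u = lead_coeff F * (\<Prod>z\<in>Z. (u - z) ^ order z F)" "degree F = (\<Sum>z\<in>Z. order z F)"
proof -
  define G where "G = (\<Prod>z | poly F z = 0. [:-z, 1:] ^ order z F)"
  have F: "smult (lead_coeff F) G = F" unfolding G_def by (rule complex_poly_decompose)
  have ord: "order z F = 0" if "poly F z \<noteq> 0" for z using that by (rule order_0I)
  have "poly F u = lead_coeff F * poly G u" by (subst F [symmetric]) simp
  also have "poly G u = (\<Prod>z | poly F z = 0. (u - z) ^ order z F)"
    by (simp add: G_def poly_prod poly_power)
  also have "\<dots> = (\<Prod>z\<in>Z. (u - z) ^ order z F)"
    using assms ord by (intro prod.mono_neutral_left) auto
  finally show "poly F u = lead_coeff F * (\<Prod>z\<in>Z. (u - z) ^ order z F)" .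
  have "degree F = degree G" using assms(3) by (subst F [symmetric]) simp
  also have "\<dots> = (\<Sum>z | poly F z = 0. order z F)"
    unfolding G_def by (subst degree_prod_sum_eq) (auto simp: degree_power_eq)
  also have "\<dots> = (\<Sum>z\<in>Z. order z F)"
    using assms ord by (intro sum.mono_neutral_left) auto
  finally show "degree F = (\<Sum>z\<in>Z. order z F)" .
qed

lemma poly_quotient_as_root_product:
  fixes F G :: "complex poly"
  assumes nz: "F \<noteq> 0" "G \<noteq> 0" and u: "u \<notin> {z. poly (F * G) z = 0}"
  shows "poly F u / poly G u = (lead_coeff F / lead_coeff G) *
     (\<Prod>z | poly (F * G) z = 0. (u - z) powi (int (order z F) - int (order z G)))"
proof -
  define Z where "Z = {z. poly (F * G) z = 0}"
  have Z: "finite Z" "{z. poly F z = 0} \<subseteq> Z" "{z. poly G z = 0} \<subseteq> Z"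
    using poly_roots_finite[of "F * G"] nz by (auto simp: Z_def)
  have "(\<Prod>z\<in>Z. (u - z) powi (int (order z F) - int (order z G)))
      = (\<Prod>z\<in>Z. (u - z) ^ order z F / (u - z) ^ order z G)"
  proof (intro prod.cong refl)
    fix z assume "z \<in> Z"
    hence "u - z \<noteq> 0" using u by (auto simp: Z_def)
    thus "(u - z) powi (int (order z F) - int (order z G)) = (u - z) ^ order z F / (u - z) ^ order z G"
      by (simp add: power_int_diff)
  qed
  also have "\<dots> = (\<Prod>z\<in>Z. (u - z) ^ order z F) / (\<Prod>z\<in>Z. (u - z) ^ order z G)" by (rule prod_dividef)
  finally show ?thesis
    unfolding poly_as_root_product(1)[OF Z(1,2) nz(1)] poly_as_root_product(1)[OF Z(1,3) nz(2)] Z_def [symmetric]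
    by simp
qed

lemma coprime_no_common_root:
  assumes "coprime F (G :: complex poly)" "poly F z = 0" "poly G z = 0"
  shows False
proof -
  have "[:-z, 1:] dvd F" "[:-z, 1:] dvd G" using assms(2,3) by (simp_all add: poly_eq_0_iff_dvd)
  hence "is_unit [:-z, 1:]" using assms(1) coprime_common_divisor by blast
  thus False by (simp add: is_unit_poly_iff)
qed

context number_places
begin

text \<open>\<open>F\<close> and \<open>G\<close> need not have coefficients in \<open>K\<close>:
  the factorisation involves only zeros, poles and the quotient of the leading coefficients.\<close>

lemma poly_quotient_in_K:
  assumes "F \<noteq> 0" "G \<noteq> 0" "{z. poly (F * G) z = 0} \<subseteq> K" "lead_coeff F / lead_coeff G \<in> K"
    "u \<in> K"  "u \<notin> {z. poly (F * G) z = 0}"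
  shows "poly F u / poly G u \<in> K"
  unfolding poly_quotient_as_root_product[OF assms(1,2,6)]
  using assms(3-5) by (intro subfield_mult[OF K] subfield_prod[OF K] subfield_powi[OF K] subfield_diff[OF K]) auto

text \<open>The exponents are differences of root orders and sum to
  \<open>degree F - degree G\<close>; \<open>disj\<close> keeps each of them from cancelling to
  0.\<close>

theorem three_points_finite_poly:
  assumes S: "finite S" "\<And>p. p \<in> S \<Longrightarrow> prime p" and nz: "F \<noteq> 0" "G \<noteq> 0"
    and disj: "\<And>z. poly F z = 0 \<Longrightarrow> poly G z \<noteq> 0"
    and ZK: "{z. poly (F * G) z = 0} \<subseteq> K" and c: "lead_coeff F / lead_coeff G \<in> K"
    and card: "card {z. poly (F * G) z = 0} \<ge> 3 \<or> card {z. poly (F * G) z = 0} \<ge> 2 \<and> degree F \<noteq> degree G"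
  shows "finite {u\<in>K. poly (F * G) u \<noteq> 0 \<and> s_unit S (poly F u / poly G u)}"
proof -
  define Z where "Z = {z. poly (F * G) z = 0}"
  define e where "e = (\<lambda>z. int (order z F) - int (order z G))"
  have Z: "finite Z" "{z. poly F z = 0} \<subseteq> Z" "{z. poly G z = 0} \<subseteq> Z"
    using poly_roots_finite[of "F * G"] nz by (auto simp: Z_def)
  have "(\<Sum>z\<in>Z. e z) = int (degree F) - int (degree G)"
    unfolding poly_as_root_product(2)[OF Z(1,2) nz(1)] poly_as_root_product(2)[OF Z(1,3) nz(2)]
    by (simp add: e_def sum_subtractf)
  hence card': "card Z \<ge> 3 \<or> card Z \<ge> 2 \<and> (\<Sum>z\<in>Z. e z) \<noteq> 0" using card by (auto simp: Z_def)
  have e: "e z \<noteq> 0" if "z \<in> Z" for z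
  proof (cases "poly F z = 0")
    case True
    thus ?thesis using nz disj[OF True] by (simp add: e_def order_0I order_root)
  next
    case False
    hence "poly G z = 0" using that by (simp add: Z_def)
    thus ?thesis using nz False by (simp add: e_def order_0I order_root)
  qed
  have "finite {u\<in>K. u \<notin> Z \<and> s_unit S ((lead_coeff F / lead_coeff G) * (\<Prod>z\<in>Z. (u - z) powi e z))}"
    using ZK c nz e card' Z(1) by (intro three_points_finite[OF S]) (auto simp: Z_def)
  moreover have "{u\<in>K. poly (F * G) u \<noteq> 0 \<and> s_unit S (poly F u / poly G u)} \<subseteq>
      {u\<in>K. u \<notin> Z \<and> s_unit S ((lead_coeff F / lead_coeff G) * (\<Prod>z\<in>Z. (u - z) powi e z))}"
  proof safe
    fix u assume u: "u \<in> K" "poly (F * G) u \<noteq> 0" "s_unit S (poly F u / poly G u)"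
    have "u \<notin> {z. poly (F * G) z = 0}" using u by simp
    from poly_quotient_as_root_product[OF nz this] u(3)
    show "s_unit S ((lead_coeff F / lead_coeff G) * (\<Prod>z\<in>Z. (u - z) powi e z))"
      unfolding Z_def e_def by metis
  qed (auto simp: Z_def)
  ultimately show ?thesis by (rule finite_subset[rotated])
qed

text \<open>If the exponent \<open>l\<close> of \<open>z\<close> were 0, \<open>a\<close> would be a
  root of unity. Wherever the conjugate of \<open>a\<close> has absolute value 1, the relation
  leaves only the \<open>l\<close>-th power of that of \<open>z\<close>.\<close>

lemma s_unit_mult_dependent:
  assumes "s_unit S a" "z \<in> K" "mult_dependent a z" "\<not> (\<exists>m::nat. m \<ge> 1 \<and> a ^ m = 1)"
  shows "s_unit S z"
proof -
  obtain k l :: int where kl: "\<not> (k = 0 \<and> l = 0)" "a powi k * z powi l = 1" and nz: "a \<noteq> 0" "z \<noteq> 0"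
    using assms(3) by (auto simp: mult_dependent_def)
  have "l \<noteq> 0"
  proof
    assume "l = 0"
    hence "k \<noteq> 0" "a powi k = 1" using kl by auto
    hence "a ^ nat \<bar>k\<bar> = 1"
      using nz by (cases "k \<ge> 0") (auto simp: power_int_def power_inverse)
    thus False using assms(4) \<open>k \<noteq> 0\<close> by (metis One_nat_def Suc_leI zero_less_abs_iff zero_less_nat_eq)
  qed
  have "padic_abs p (conj t z) = 1" if p: "prime p" "p \<notin> S" and t: "t \<in> T" for p t
  proof -
    have aK: "a \<in> K" using assms(1) by (rule s_unit_K)
    have "conj t (a powi k * z powi l) = conj t a powi k * conj t z powi l"
      using aK assms(2) by (simp add: conj_mult[OF t] conj_powi[OF t] subfield_powi[OF K])
    hence "padic_abs p (conj t a powi k * conj t z powi l) = 1"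
      unfolding kl(2) using conj_1[OF t] padic_abs_1[OF p(1)] by simp
    moreover have "algebraic (conj t a powi k)" "algebraic (conj t z powi l)"
      using algebraic_conj[OF t subfield_powi[OF K aK, of k]] algebraic_conj[OF t subfield_powi[OF K assms(2), of l]]
      by (simp_all add: conj_powi[OF t] aK assms(2))
    ultimately have "padic_abs p (conj t a) powi k * padic_abs p (conj t z) powi l = 1"
      using padic_abs_mult[OF p(1)] padic_abs_powi[OF p(1)] algebraic_conj[OF t] aK assms(2) by metis
    moreover have "padic_abs p (conj t a) = 1" using assms(1) p t by (simp add: s_unit_def)
    ultimately have "padic_abs p (conj t z) powi l = 1" by simp
    moreover have "padic_abs p (conj t z) > 0"
      using nz conj_eq_0_iff[OF t assms(2)] by (intro padic_abs_pos[OF p(1)]) auto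
    ultimately show ?thesis using powi_eq_1D \<open>l \<noteq> 0\<close> by blast
  qed
  thus ?thesis using nz assms(2) by (auto simp: s_unit_def)
qed

lemma s_unit_uminus: "s_unit S x \<Longrightarrow> s_unit S (- x)"
  by (auto simp: s_unit_def K_simps conj_uminus padic_abs_uminus algebraic_conj)

end

text \<open>In the coordinate \<open>h\<close> of \<open>orbit_finiteness\<close> a step of the
  orbit has the form \<open>c * X ^ d\<close> or \<open>c / X ^ d\<close>; polynomials of this type
  supply the zeros and poles of the following step.\<close>

definition binom_poly :: "complex \<Rightarrow> nat \<Rightarrow> complex \<Rightarrow> complex poly" where
  "binom_poly c d s = monom c d + [:- s:]"

lemma binom_poly:
  assumes "c \<noteq> 0" "d > 0"
  shows "poly (binom_poly c d s) t = c * t ^ d - s" "degree (binom_poly c d s) = d"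
    "lead_coeff (binom_poly c d s) = c" "binom_poly c d s \<noteq> 0"
proof -
  show "poly (binom_poly c d s) t = c * t ^ d - s" by (simp add: binom_poly_def poly_monom)
  show deg: "degree (binom_poly c d s) = d"
    unfolding binom_poly_def using assms by (subst degree_add_eq_left) (auto simp: degree_monom_eq)
  show "lead_coeff (binom_poly c d s) = c"
    unfolding deg using assms by (cases d) (auto simp: binom_poly_def)
  thus "binom_poly c d s \<noteq> 0" using assms by auto
qed

lemma binom_poly_roots:
  assumes "c \<noteq> 0" "d > 0"
  shows "finite {t. poly (binom_poly c d s) t = 0}" "card {t. poly (binom_poly c d s) t = 0} \<ge> 1"
    "s \<noteq> 0 \<Longrightarrow> card {t. poly (binom_poly c d s) t = 0} = d"
proof -
  show fin: "finite {t. poly (binom_poly c d s) t = 0}" by (rule poly_roots_finite[OF binom_poly(4)[OF assms]])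
  have eq: "{t. poly (binom_poly c d s) t = 0} = {t. t ^ d = s / c}"
    using assms by (auto simp: binom_poly(1)[OF assms] eq_divide_eq mult.commute)
  show card: "s \<noteq> 0 \<Longrightarrow> card {t. poly (binom_poly c d s) t = 0} = d"
    unfolding eq using assms by (intro card_nth_roots) auto
  show "card {t. poly (binom_poly c d s) t = 0} \<ge> 1"
  proof (cases "s = 0")
    case True
    hence "0 \<in> {t. poly (binom_poly c d s) t = 0}" using assms by (simp add: binom_poly(1)[OF assms])
    hence "card {t. poly (binom_poly c d s) t = 0} > 0" using fin card_gt_0_iff by blast
    thus ?thesis by simp
  qed (use card assms in auto)
qed

lemma algebraic_binom_poly_root:
  assumes "c \<noteq> 0" "d > 0" "algebraic c" "algebraic s" "poly (binom_poly c d s) t = 0"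
  shows "algebraic t"
proof (rule algebraic_poly_root[OF binom_poly(4)[OF assms(1,2)] _ assms(5)])
  fix i
  show "algebraic (coeff (binom_poly c d s) i)"
    unfolding binom_poly_def coeff_add using assms(3,4)
    by (intro algebraic_add) (auto simp: coeff_pCons split: nat.splits)
qed

lemma avoid_finite:
  assumes "infinite A" "inj h" "finite D"
  obtains n where "n \<in> A" "n \<ge> (k::nat)" "h (n - k) \<notin> D"
proof -
  have "\<exists>n\<in>A. n \<ge> k \<and> h (n - k) \<notin> D"
  proof (rule ccontr)
    assume none: "\<not> ?thesis"
    have "A \<subseteq> {..<k} \<union> (\<lambda>m. m + k) ` (h -` D)"
    proof
      fix n assume n: "n \<in> A"
      show "n \<in> {..<k} \<union> (\<lambda>m. m + k) ` (h -` D)"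
      proof (cases "n < k")
        case False
        hence "h (n - k) \<in> D" using none n by auto
        thus ?thesis using False by (intro UnI2 image_eqI[of _ _ "n - k"]) auto
      qed simp
    qed
    moreover have "finite (h -` D)" using assms(2,3) by (intro finite_vimageI)
    ultimately show False using assms(1) by (meson finite_UnI finite_imageI finite_lessThan finite_subset)
  qed
  thus thesis using that by blast
qed

lemma card_roots_mult:
  assumes "finite {z. poly P z = 0}" "finite {z. poly Q z = 0}" "\<And>z. poly P z = 0 \<Longrightarrow> poly Q z \<noteq> (0::complex)"
  shows "card {z. poly (P * Q) z = 0} = card {z. poly P z = 0} + card {z. poly Q z = 0}"
proof -
  have "{z. poly (P * Q) z = 0} = {z. poly P z = 0} \<union> {z. poly Q z = 0}" by auto
  thus ?thesis using assms by (simp only:) (intro card_Un_disjoint, auto)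
qed

lemma poly_root_exists: "degree (F :: complex poly) > 0 \<Longrightarrow> \<exists>a. poly F a = 0"
  using fundamental_theorem_of_algebra[of F] by (auto simp: constant_degree)

text \<open>
  If \<open>F / G\<close> has at most two zeros and poles on the projective line, it is \<open>c ((x - a) / (x - b)) ^ d\<close>, \<open>c (x - a) ^ d\<close>
  or \<open>c / (x - b) ^ d\<close>. The integrality of \<open>u n\<close> at one step then carries over to the coordinate \<open>(x - a) / (x - b)\<close>,
  \<open>x - a\<close> or \<open>x - b\<close> of \<open>u (n - 1)\<close>, which as a function of the same coordinate of \<open>u (n - 2)\<close> has three zeros and poles.
\<close>
lemma orbit_finiteness:
  fixes F G :: "complex poly" and u :: "nat \<Rightarrow> complex"
  assumes cop: "coprime F G" and nz: "F \<noteq> 0" "G \<noteq> 0"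
    and algZ: "\<And>z. poly (F * G) z = 0 \<Longrightarrow> algebraic z"
    and algc: "algebraic (lead_coeff F / lead_coeff G)"
    and d: "max (degree F) (degree G) = d" "d \<ge> 2"
    and nonmono: "\<not> (degree G = 0 \<and> F = monom (lead_coeff F) d)" "\<not> (degree F = 0 \<and> G = monom (lead_coeff G) d)"
    and u: "\<And>n. poly G (u n) \<noteq> 0" "\<And>n. u (Suc n) = poly F (u n) / poly G (u n)" "inj u"
    and alg: "algebraic (u 0)" and not_unity: "\<not> (\<exists>m::nat. m \<ge> 1 \<and> u 0 ^ m = 1)"
  shows "finite {n. mult_dependent (u 0) (u n)}"
proof (rule ccontr)
  define A where "A = {n. mult_dependent (u 0) (u n)}"
  assume "infinite {n. mult_dependent (u 0) (u n)}"
  hence inf: "infinite A" by (simp add: A_def)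
  define c where "c = lead_coeff F / lead_coeff G"
  define Z where "Z = {z. poly (F * G) z = 0}"
  have algc': "algebraic c" using algc by (simp add: c_def)
  have c0: "c \<noteq> 0" using nz by (simp add: c_def)
  have finZ: "finite Z" unfolding Z_def using nz by (intro poly_roots_finite) auto
  have disj: "poly G z \<noteq> 0" if "poly F z = 0" for z using coprime_no_common_root[OF cop that] by blast
  \<comment> \<open>The field is left open: the cases below bring different new zeros and poles,
    which \<open>number_setup\<close> accepts as \<open>Y\<close>.\<close>
  define good where "good \<theta> f S \<longleftrightarrow> number_places \<theta> f \<and> Z \<subseteq> rat_adjoin \<theta> \<and> c \<in> rat_adjoin \<theta> \<and>
      (\<forall>n. u n \<in> rat_adjoin \<theta>) \<and> finite S \<and> (\<forall>p\<in>S. prime p) \<and>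
      number_places.s_unit \<theta> f S c \<and> (\<forall>n\<in>A. number_places.s_unit \<theta> f S (u n))" for \<theta> f S
  have number_setup: "\<exists>\<theta> f S. good \<theta> f S \<and> Y \<subseteq> rat_adjoin \<theta>"
    if Y: "finite Y" "\<And>y. y \<in> Y \<Longrightarrow> algebraic y" for Y
  proof -
    obtain \<theta> where \<theta>: "algebraic \<theta>" "insert c (insert (u 0) (Y \<union> Z)) \<subseteq> rat_adjoin \<theta>"
    proof (rule primitive_element)
      show "finite (insert c (insert (u 0) (Y \<union> Z)))" using Y finZ by simp
      show "algebraic x" if "x \<in> insert c (insert (u 0) (Y \<union> Z))" for x
        using that Y(2) algZ algc alg by (auto simp: c_def Z_def)
    qed
    obtain f where f: "min_poly \<rat> \<theta> f" using min_poly_Rats_exists[OF \<theta>(1)] by blast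
    interpret number_places \<theta> f using \<theta>(1) f by unfold_locales
    have uK: "u n \<in> K" for n
    proof (induction n)
      case (Suc n)
      show ?case
      proof (cases "poly F (u n) = 0")
        case False
        thus ?thesis unfolding u(2) using Suc \<theta>(2) u(1)[of n] nz
          by (intro poly_quotient_in_K) (auto simp: Z_def c_def)
      qed (simp add: u(2) K_simps)
    qed (use \<theta> in auto)
    have "u 0 \<noteq> 0"
    proof -
      obtain n where "n \<in> A" using inf by fastforce
      thus ?thesis by (auto simp: A_def mult_dependent_def)
    qed
    have cK: "{c, u 0} \<subseteq> K" "0 \<notin> {c, u 0}" using \<theta>(2) c0 \<open>u 0 \<noteq> 0\<close> by auto
    obtain S where S: "finite S" "\<And>p. p \<in> S \<Longrightarrow> prime p" "\<And>x. x \<in> {c, u 0} \<Longrightarrow> s_unit S x"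
      by (rule enlarge_S[of "{}" "{c, u 0}"]) (use cK in auto)
    have "s_unit S (u 0)" by (rule S(3)) simp
    hence un: "s_unit S (u n)" if "n \<in> A" for n
      using s_unit_mult_dependent[OF _ uK _ not_unity] that unfolding A_def by blast
    have np: "number_places \<theta> f" by unfold_locales
    have "good \<theta> f S" unfolding good_def using \<theta>(2) by (intro conjI allI ballI np uK un S) auto
    thus ?thesis using \<theta>(2) by blast
  qed
  show False
  proof (cases "card Z \<ge> 3 \<or> card Z \<ge> 2 \<and> degree F \<noteq> degree G")
    case True
    obtain \<theta> f S where n: "number_places \<theta> f" "Z \<subseteq> rat_adjoin \<theta>" "c \<in> rat_adjoin \<theta>"
        "\<forall>n. u n \<in> rat_adjoin \<theta>" "finite S" "\<forall>p\<in>S. prime p" "\<forall>n\<in>A. number_places.s_unit \<theta> f S (u n)"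
      using number_setup[of "{}"] by (auto simp: good_def)
    interpret number_places \<theta> f by (rule n(1))
    have fin: "finite {x\<in>K. poly (F * G) x \<noteq> 0 \<and> s_unit S (poly F x / poly G x)}"
      using n True disj nz by (intro three_points_finite_poly) (auto simp: Z_def c_def)
    obtain n where n': "n \<in> A" "n \<ge> 1" "u (n - 1) \<notin> {x\<in>K. poly (F * G) x \<noteq> 0 \<and> s_unit S (poly F x / poly G x)}"
      using avoid_finite[OF inf u(3) fin] by blast
    have "s_unit S (u n)" using n(7) n' by blast
    moreover have un: "u n = poly F (u (n - 1)) / poly G (u (n - 1))" using u(2)[of "n - 1"] n'(2) by simp
    ultimately have "poly F (u (n - 1)) \<noteq> 0" using s_unit_nz by fastforce
    thus False using n' \<open>s_unit S (u n)\<close> un n(4) u(1)[of "n - 1"] by auto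
  next
    case False
    \<comment> \<open>Common end of the three exceptional cases: \<open>P / Q\<close> has three
      zeros and poles in the coordinate \<open>h\<close>, and \<open>h n\<close> is a solution
      whenever \<open>n + 2\<close> lies in \<open>A\<close>, hence the shift by 2.\<close>
    have second: False
      if PQ: "P \<noteq> 0" "Q \<noteq> 0" "\<And>z. poly P z = 0 \<Longrightarrow> poly Q z \<noteq> 0" "\<And>z. poly (P * Q) z = 0 \<Longrightarrow> algebraic z"
        "algebraic (lead_coeff P / lead_coeff Q)"
        "card {z. poly (P * Q) z = 0} \<ge> 3 \<or> card {z. poly (P * Q) z = 0} \<ge> 2 \<and> degree P \<noteq> degree Q"
      and h: "inj h" "\<And>\<theta> f S n. good \<theta> f S \<Longrightarrow> Suc (Suc n) \<in> A \<Longrightarrow>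
          h n \<in> rat_adjoin \<theta> \<and> poly Q (h n) \<noteq> 0 \<and> number_places.s_unit \<theta> f S (poly P (h n) / poly Q (h n))"
      for P Q :: "complex poly" and h
    proof -
      define Y where "Y = insert (lead_coeff P / lead_coeff Q) {z. poly (P * Q) z = 0}"
      have "finite Y" unfolding Y_def using PQ by (intro finite.insertI poly_roots_finite) auto
      moreover have "algebraic y" if "y \<in> Y" for y using that PQ by (auto simp: Y_def)
      ultimately obtain \<theta> f S where good: "good \<theta> f S" and Y: "Y \<subseteq> rat_adjoin \<theta>"
        using number_setup[of Y] by blast
      have S: "finite S" "\<And>p. p \<in> S \<Longrightarrow> prime p" using good by (auto simp: good_def)
      interpret number_places \<theta> f using good by (simp add: good_def)
      have fin: "finite {x\<in>K. poly (P * Q) x \<noteq> 0 \<and> s_unit S (poly P x / poly Q x)}"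
        using Y PQ by (intro three_points_finite_poly S) (auto simp: Y_def)
      obtain m where m: "m \<in> A" "m \<ge> 2" "h (m - 2) \<notin> {x\<in>K. poly (P * Q) x \<noteq> 0 \<and> s_unit S (poly P x / poly Q x)}"
        using avoid_finite[OF inf h(1) fin] by blast
      have "Suc (Suc (m - 2)) = m" using m(2) by simp
      hence "Suc (Suc (m - 2)) \<in> A" using m(1) by (simp only:)
      from h(2)[OF good this]
      have hm: "h (m - 2) \<in> K" "poly Q (h (m - 2)) \<noteq> 0" "s_unit S (poly P (h (m - 2)) / poly Q (h (m - 2)))" by auto
      have "poly P (h (m - 2)) \<noteq> 0" using s_unit_nz[OF hm(3)] by auto
      thus False using hm m(3) by auto
    qed
    have eval: "poly H x = lead_coeff H * (x - a) ^ degree H"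
      if "H \<noteq> 0" "{z. poly H z = 0} \<subseteq> {a}" for H :: "complex poly" and a x
      using poly_as_root_product[OF _ that(2,1)] by simp
    consider (eq) "degree F = d" "degree G = d" | (pol) "degree F = d" "degree G < d" | (inv) "degree G = d" "degree F < d"
      using d(1) by (cases rule: linorder_cases[of "degree F" "degree G"]) auto
    thus False
    proof cases
      case eq
      obtain a b where ab: "poly F a = 0" "poly G b = 0" using poly_root_exists[of F] poly_root_exists[of G] eq d(2) by auto
      have "a \<noteq> b" using disj ab by auto
      have "card Z \<le> 2" using False by auto
      moreover have "{a, b} \<subseteq> Z" using ab by (auto simp: Z_def)
      ultimately have Zab: "Z = {a, b}" using card_seteq[OF finZ, of "{a, b}"] \<open>a \<noteq> b\<close> by simp
      have "{z. poly F z = 0} \<subseteq> {a}" "{z. poly G z = 0} \<subseteq> {b}"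
        using Zab disj ab by (auto simp: Z_def)
      hence FG: "poly F x = lead_coeff F * (x - a) ^ d" "poly G x = lead_coeff G * (x - b) ^ d" for x
        using eval[of F] eval[of G] nz eq by auto
      have ub: "u n \<noteq> b" for n using u(1)[of n] ab by auto
      have step: "u (Suc n) = c * ((u n - a) / (u n - b)) ^ d" for n
        by (simp add: u(2) FG c_def power_divide)
      define h where "h = (\<lambda>n. (u n - a) / (u n - b))"
      have "inj h"
      proof (rule injI)
        fix m n assume "h m = h n"
        hence "(u m - a) * (u n - b) = (u n - a) * (u m - b)" using ub by (simp add: h_def frac_eq_eq)
        hence "(u m - u n) * (a - b) = 0" by (simp add: algebra_simps)
        thus "m = n" using \<open>a \<noteq> b\<close> u(3) by (simp add: inj_eq)
      qed
      note bp = binom_poly[OF c0, of d] binom_poly_roots[OF c0, of d]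
      have d0: "d > 0" using d by simp
      have alg_ab: "algebraic a" "algebraic b" using algZ ab by auto
      \<comment> \<open>One of \<open>a\<close> and \<open>b\<close> is nonzero and has
        \<open>d\<close> preimages under \<open>c * X ^ d\<close>, the other at least one, and
        \<open>d + 1 \<ge> 3\<close>.\<close>
      have cd: "card {z. poly (binom_poly c d a * binom_poly c d b) z = 0} \<ge> 3"
      proof -
        have "card {z. poly (binom_poly c d a * binom_poly c d b) z = 0}
            = card {z. poly (binom_poly c d a) z = 0} + card {z. poly (binom_poly c d b) z = 0}"
          using bp d0 \<open>a \<noteq> b\<close> by (intro card_roots_mult) auto
        moreover have "a \<noteq> 0 \<or> b \<noteq> 0" using \<open>a \<noteq> b\<close> by auto
        ultimately show ?thesis using bp(6)[OF d0, of a] bp(6)[OF d0, of b] bp(7)[OF d0, of a] bp(7)[OF d0, of b] d(2) by auto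
      qed
      show False
      proof (rule second[of "binom_poly c d a" "binom_poly c d b" h])
        fix \<theta> f S n assume good: "good \<theta> f S" and n: "Suc (Suc n) \<in> A"
        interpret number_places \<theta> f using good by (simp add: good_def)
        have ZK: "Z \<subseteq> K" and uK: "u m \<in> K" and cu: "s_unit S c" and un: "s_unit S (u (Suc (Suc n)))" for m
          using good n by (auto simp: good_def)
        have abK: "a \<in> K" "b \<in> K" using ZK Zab by auto
        have w: "u (Suc n) = c * h n ^ d" by (simp add: step h_def)
        have "s_unit S ((c * ((u (Suc n) - a) / (u (Suc n) - b)) ^ d) / c)"
          using un cu unfolding step[of "Suc n"] by (rule s_unit_divide)
        hence "s_unit S (((u (Suc n) - a) / (u (Suc n) - b)) ^ d)" using c0 by simp
        hence "s_unit S ((u (Suc n) - a) / (u (Suc n) - b))"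
          by (rule s_unit_root[OF subfield_divide[OF K subfield_diff[OF K uK abK(1)] subfield_diff[OF K uK abK(2)]] _ d0])
        moreover have "c * h n ^ d - b \<noteq> 0" using ub[of "Suc n"] w by auto
        moreover have "h n \<in> K" unfolding h_def by (intro subfield_divide[OF K] subfield_diff[OF K] uK abK)
        ultimately show "h n \<in> rat_adjoin \<theta> \<and> poly (binom_poly c d b) (h n) \<noteq> 0 \<and>
           s_unit S (poly (binom_poly c d a) (h n) / poly (binom_poly c d b) (h n))"
          using w by (simp add: bp(1)[OF d0])
      next
        show "binom_poly c d a \<noteq> 0" "binom_poly c d b \<noteq> 0" by (rule bp(4)[OF d0])+
        show "poly (binom_poly c d b) z \<noteq> 0" if "poly (binom_poly c d a) z = 0" for z
          using that \<open>a \<noteq> b\<close> by (simp add: bp(1)[OF d0])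
        show "algebraic z" if "poly (binom_poly c d a * binom_poly c d b) z = 0" for z
          using that algebraic_binom_poly_root[OF c0 d0 algc'] alg_ab unfolding poly_mult mult_eq_0_iff by blast
        show "algebraic (lead_coeff (binom_poly c d a) / lead_coeff (binom_poly c d b))"
          unfolding bp(3)[OF d0] using c0 by simp
        show "3 \<le> card {z. poly (binom_poly c d a * binom_poly c d b) z = 0} \<or>
            2 \<le> card {z. poly (binom_poly c d a * binom_poly c d b) z = 0} \<and>
            degree (binom_poly c d a) \<noteq> degree (binom_poly c d b)" using cd by blast
      qed (rule \<open>inj h\<close>)
    next
      case pol
      have "card Z \<le> 1" using False pol by auto
      obtain a where a: "poly F a = 0" using poly_root_exists[of F] pol d(2) by auto
      hence "{a} \<subseteq> Z" by (auto simp: Z_def)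
      hence Za: "Z = {a}" using card_seteq[OF finZ, of "{a}"] \<open>card Z \<le> 1\<close> by simp
      have degG: "degree G = 0"
      proof (rule ccontr)
        assume "degree G \<noteq> 0"
        then obtain b where "poly G b = 0" using poly_root_exists[of G] by auto
        moreover from this have "b = a" using Za by (auto simp: Z_def)
        ultimately show False using disj a by auto
      qed
      then obtain g where g: "G = [:g:]" by (metis degree_eq_zeroE)
      have F: "poly F x = lead_coeff F * (x - a) ^ d" for x
        using eval[of F a] nz pol Za by (auto simp: Z_def)
      \<comment> \<open>Excluding the monomial matters here: with \<open>a = 0\<close> all roots of
        \<open>binom_poly c d a\<close> would coincide.\<close>
      have "a \<noteq> 0"
      proof
        assume "a = 0"
        hence "poly F x = poly (monom (lead_coeff F) d) x" for x by (simp add: F poly_monom)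
        hence "F = monom (lead_coeff F) d" by (metis poly_eq_poly_eq_iff ext)
        thus False using nonmono(1) degG by blast
      qed
      have step: "u (Suc n) = c * (u n - a) ^ d" for n
        by (simp add: u(2) F c_def g)
      define h where "h = (\<lambda>n. u n - a)"
      have "inj h" using u(3) by (auto simp: h_def inj_def)
      note bp = binom_poly[OF c0, of d] binom_poly_roots[OF c0, of d]
      have d0: "d > 0" using d by simp
      have alg_a: "algebraic a" using algZ a by auto
      show False
      \<comment> \<open>The pole is at infinity, so \<open>Q = 1\<close>; \<open>d \<ge> 2\<close>
        distinct roots together with unequal degrees suffice.\<close>
      proof (rule second[of "binom_poly c d a" 1 h])
        fix \<theta> f S n assume good: "good \<theta> f S" and n: "Suc (Suc n) \<in> A"
        interpret number_places \<theta> f using good by (simp add: good_def)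
        have ZK: "Z \<subseteq> K" and uK: "u m \<in> K" and cu: "s_unit S c" and un: "s_unit S (u (Suc (Suc n)))" for m
          using good n by (auto simp: good_def)
        have aK: "a \<in> K" using ZK Za by auto
        have w: "u (Suc n) = c * h n ^ d" by (simp add: step h_def)
        have "s_unit S ((c * (u (Suc n) - a) ^ d) / c)"
          using un cu unfolding step[of "Suc n"] by (rule s_unit_divide)
        hence "s_unit S ((u (Suc n) - a) ^ d)" using c0 by simp
        hence "s_unit S (u (Suc n) - a)"
          by (rule s_unit_root[OF subfield_diff[OF K uK aK] _ d0])
        moreover have "h n \<in> K" unfolding h_def by (intro subfield_diff[OF K] uK aK)
        ultimately show "h n \<in> rat_adjoin \<theta> \<and> poly 1 (h n) \<noteq> 0 \<and> s_unit S (poly (binom_poly c d a) (h n) / poly 1 (h n))"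
          using w by (simp add: bp(1)[OF d0])
      next
        show "binom_poly c d a \<noteq> 0" by (rule bp(4)[OF d0])
        show "algebraic z" if "poly (binom_poly c d a * 1) z = 0" for z
          using that algebraic_binom_poly_root[OF c0 d0 algc' alg_a] by simp
        show "algebraic (lead_coeff (binom_poly c d a) / lead_coeff 1)"
          unfolding bp(3)[OF d0] using algc' by simp
        show "3 \<le> card {z. poly (binom_poly c d a * 1) z = 0} \<or>
            2 \<le> card {z. poly (binom_poly c d a * 1) z = 0} \<and> degree (binom_poly c d a) \<noteq> degree (1 :: complex poly)"
          using bp(7)[OF d0 \<open>a \<noteq> 0\<close>] bp(2)[OF d0, of a] d(2) by simp
      qed (use \<open>inj h\<close> in simp_all)
    next
      case inv
      have "card Z \<le> 1" using False inv by auto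
      obtain b where b: "poly G b = 0" using poly_root_exists[of G] inv d(2) by auto
      hence "{b} \<subseteq> Z" by (auto simp: Z_def)
      hence Zb: "Z = {b}" using card_seteq[OF finZ, of "{b}"] \<open>card Z \<le> 1\<close> by simp
      have degF: "degree F = 0"
      proof (rule ccontr)
        assume "degree F \<noteq> 0"
        then obtain a where "poly F a = 0" using poly_root_exists[of F] by auto
        moreover from this have "b = a" using Zb by (auto simp: Z_def)
        ultimately show False using disj b by auto
      qed
      then obtain g where g: "F = [:g:]" by (metis degree_eq_zeroE)
      have G: "poly G x = lead_coeff G * (x - b) ^ d" for x
        using eval[of G b] nz inv Zb by (auto simp: Z_def)
      have b0: "b \<noteq> 0"
      proof
        assume "b = 0"
        hence "poly G x = poly (monom (lead_coeff G) d) x" for x by (simp add: G poly_monom)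
        hence "G = monom (lead_coeff G) d" by (metis poly_eq_poly_eq_iff ext)
        thus False using nonmono(2) degF by blast
      qed
      have ub: "u n \<noteq> b" for n using u(1)[of n] b by auto
      have step: "u (Suc n) = c / (u n - b) ^ d" for n
        by (simp add: u(2) G c_def g)
      define h where "h = (\<lambda>n. u n - b)"
      have "inj h" using u(3) by (auto simp: h_def inj_def)
      note bp = binom_poly[OF b0, of d] binom_poly_roots[OF b0, of d]
      have d0: "d > 0" using d by simp
      have alg_b: "algebraic b" using algZ b by auto
      have rootsQ: "{z. poly (monom 1 d) z = 0} = {0::complex}" using d0 by (auto simp: poly_monom)
      \<comment> \<open>\<open>b - c / X ^ d\<close> has \<open>d\<close> distinct zeros and a pole
        at 0.\<close>
      have cd: "card {z. poly (binom_poly b d c * monom 1 d) z = 0} \<ge> 3"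
      proof -
        have "card {z. poly (binom_poly b d c * monom 1 d) z = 0}
            = card {z. poly (binom_poly b d c) z = 0} + card {z. poly (monom 1 d) z = (0::complex)}"
          using bp d0 c0 rootsQ by (intro card_roots_mult) (auto simp: poly_monom)
        thus ?thesis unfolding rootsQ using bp(7)[OF d0 c0] d(2) by simp
      qed
      show False
      proof (rule second[of "binom_poly b d c" "monom 1 d" h])
        fix \<theta> f S n assume good: "good \<theta> f S" and n: "Suc (Suc n) \<in> A"
        interpret number_places \<theta> f using good by (simp add: good_def)
        have ZK: "Z \<subseteq> K" and uK: "u m \<in> K" and cu: "s_unit S c" and un: "s_unit S (u (Suc (Suc n)))" for m
          using good n by (auto simp: good_def)
        have bK: "b \<in> K" using ZK Zb by auto
        have hn: "h n \<noteq> 0" using ub by (simp add: h_def)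
        have w: "u (Suc n) = c / h n ^ d" by (simp add: step h_def)
        have "s_unit S (c / (c / (u (Suc n) - b) ^ d))"
          using cu un unfolding step[of "Suc n"] by (rule s_unit_divide)
        hence "s_unit S ((u (Suc n) - b) ^ d)" using c0 by simp
        hence "s_unit S (u (Suc n) - b)"
          by (rule s_unit_root[OF subfield_diff[OF K uK bK] _ d0])
        hence "s_unit S (b - u (Suc n))" using s_unit_uminus by fastforce
        moreover have "b - u (Suc n) = (b * h n ^ d - c) / h n ^ d" using hn w by (simp add: diff_divide_distrib)
        moreover have "h n \<in> K" unfolding h_def by (intro subfield_diff[OF K] uK bK)
        ultimately show "h n \<in> rat_adjoin \<theta> \<and> poly (monom 1 d) (h n) \<noteq> 0 \<and>
            s_unit S (poly (binom_poly b d c) (h n) / poly (monom 1 d) (h n))"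
          using hn by (simp add: bp(1)[OF d0] poly_monom)
      next
        show "algebraic (lead_coeff (binom_poly b d c) / lead_coeff (monom 1 d))"
          using alg_b bp(3)[OF d0] by (simp add: lead_coeff_monom)
        show "algebraic z" if "poly (binom_poly b d c * monom 1 d) z = 0" for z
        proof -
          have "poly (binom_poly b d c) z = 0 \<or> z = 0" using that by (auto simp: poly_monom)
          thus ?thesis using algebraic_binom_poly_root[OF b0 d0 alg_b algc'] by auto
        qed
        show "binom_poly b d c \<noteq> 0" by (rule bp(4)[OF d0])
        show "poly (monom 1 d) z \<noteq> 0" if "poly (binom_poly b d c) z = 0" for z
          using that c0 d0 by (auto simp: bp(1)[OF d0] poly_monom)
        show "3 \<le> card {z. poly (binom_poly b d c * monom 1 d) z = 0} \<or>
            2 \<le> card {z. poly (binom_poly b d c * monom 1 d) z = 0} \<and>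
            degree (binom_poly b d c) \<noteq> degree (monom (1 :: complex) d)" using cd by blast
      qed (use \<open>inj h\<close> in simp_all)
    qed
  qed
qed

lemma rat_orbit_add: "rat_orbit \<phi> \<alpha> m = Some z \<Longrightarrow> rat_orbit \<phi> \<alpha> (m + n) = rat_orbit \<phi> z n"
  by (induction n) auto

lemma rat_orbit_defined:
  assumes "rat_orbit \<phi> \<alpha> n \<noteq> None" "m \<le> n"
  shows "rat_orbit \<phi> \<alpha> m \<noteq> None"
  using assms(2,1) by (induction rule: dec_induct) (auto split: option.splits)

theorem theorem4p13:
  fixes K :: "complex set" and \<phi> :: "complex poly fract" and d :: nat and \<alpha> :: complex
  assumes "number_field K"
    and "\<phi> \<in> ratfuns_over K"
    and "rat_degree \<phi> = d" and "d \<ge> 2"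
    and "\<not> (\<exists>\<beta>\<in>K - {0}. \<phi> = Fraction_Field.Fract (monom \<beta> d) 1 \<or> \<phi> = Fraction_Field.Fract [:\<beta>:] (monom 1 d))"
    and "algebraic \<alpha>"
    and "\<not> (\<exists>m::nat. m \<ge> 1 \<and> \<alpha> ^ m = 1)"
    and "\<not> rat_preperiodic \<phi> \<alpha>"
  shows "finite {n::nat. n \<ge> 1 \<and> (\<exists>z. rat_orbit \<phi> \<alpha> n = Some z \<and> mult_dependent \<alpha> z)}"
proof (rule ccontr)
  define A where "A = {n::nat. n \<ge> 1 \<and> (\<exists>z. rat_orbit \<phi> \<alpha> n = Some z \<and> mult_dependent \<alpha> z)}"
  assume "infinite {n::nat. n \<ge> 1 \<and> (\<exists>z. rat_orbit \<phi> \<alpha> n = Some z \<and> mult_dependent \<alpha> z)}"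
  hence inf: "infinite A" by (simp add: A_def)
  define F G where "F = rat_num \<phi>" and "G = rat_den \<phi>"
  obtain f0 g0 where \<phi>: "\<phi> = Fraction_Field.Fract f0 g0" "f0 \<in> polys_over K" "g0 \<in> polys_over K" "g0 \<noteq> 0"
    using assms(2) by (auto simp: ratfuns_over_def)
  have "quot_of_fract \<phi> = normalize_quot (f0, g0)"
    using quot_of_fract_quot_to_fract[of "(f0, g0)"] by (simp add: quot_to_fract_def \<phi>(1))
  then obtain e where e: "f0 = F * e" "g0 = G * e"
    using normalize_quotE[OF \<phi>(4), of f0] unfolding F_def G_def rat_num_def rat_den_def by metis
  have "e \<noteq> 0" and G0: "G \<noteq> 0" using e \<phi>(4) by auto
  have "(F, G) \<in> normalized_fracts"
    using quot_of_fract_in_normalized_fracts[of \<phi>] by (simp add: F_def G_def rat_num_def rat_den_def)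
  hence cop: "coprime F G" by (simp add: normalized_fracts_def)
  have deg: "max (degree F) (degree G) = d" using assms(3) by (simp add: rat_degree_def F_def G_def)
  have F0: "F \<noteq> 0"
  proof
    assume "F = 0"
    hence "degree G = 0" using cop by (auto simp: is_unit_poly_iff)
    thus False using deg assms(4) \<open>F = 0\<close> by simp
  qed
  have \<phi>FG: "\<phi> = Fraction_Field.Fract F G" by (simp add: F_def G_def rat_num_def rat_den_def)
  have algK: "x \<in> K \<Longrightarrow> algebraic x" for x by (rule algebraic_if_number_field[OF assms(1)])
  have quotK: "x / y \<in> K" if "x \<in> K" "y \<in> K" for x y
    using that assms(1) unfolding number_field_def divide_inverse by blast
  have algZ: "algebraic z" if "poly (F * G) z = 0" for z
  proof -
    have "poly f0 z = 0 \<or> poly g0 z = 0" using that e by auto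
    moreover have "f0 \<noteq> 0" using e F0 \<open>e \<noteq> 0\<close> by simp
    ultimately show ?thesis using algebraic_poly_root[of f0 z] algebraic_poly_root[of g0 z] \<phi> algK
      by (auto simp: polys_over_def)
  qed
  \<comment> \<open>\<open>F\<close> and \<open>G\<close> differ from \<open>f0\<close> and
    \<open>g0\<close> by a common factor, so this quotient lies in \<open>K\<close>. It is the
    \<beta> of the excluded monomials.\<close>
  define c where "c = lead_coeff F / lead_coeff G"
  have "c = lead_coeff f0 / lead_coeff g0"
    unfolding c_def e lead_coeff_mult using \<open>e \<noteq> 0\<close> by simp
  hence cK: "c \<in> K - {0}" using \<phi>(2,3) F0 G0 by (auto simp: c_def polys_over_def intro!: quotK)
  have nonmono1: "\<not> (degree G = 0 \<and> F = monom (lead_coeff F) d)"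
  proof safe
    assume "degree G = 0" and F: "F = monom (lead_coeff F) d"
    then obtain g where g: "G = [:g:]" by (metis degree_eq_zeroE)
    have "F = smult g (monom c d)" using G0 by (subst F) (simp add: c_def g smult_monom)
    hence "\<phi> = Fraction_Field.Fract (monom c d) 1"
      unfolding \<phi>FG using G0 by (simp add: eq_fract g)
    thus False using assms(5) cK by blast
  qed
  have nonmono2: "\<not> (degree F = 0 \<and> G = monom (lead_coeff G) d)"
  proof safe
    assume "degree F = 0" and G: "G = monom (lead_coeff G) d"
    then obtain k where k: "F = [:k:]" by (metis degree_eq_zeroE)
    have "smult c G = monom k d" using G0 by (subst G) (simp add: c_def k smult_monom)
    hence "\<phi> = Fraction_Field.Fract [:c:] (monom 1 d)"
      unfolding \<phi>FG using G0 by (simp add: eq_fract k smult_monom)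
    thus False using assms(5) cK by blast
  qed
  define u where "u = (\<lambda>n. the (rat_orbit \<phi> \<alpha> n))"
  \<comment> \<open>\<open>A\<close> is unbounded, and an orbit defined at some step is defined at
    all earlier ones; so no element of the orbit is a pole.\<close>
  have defined: "rat_orbit \<phi> \<alpha> n = Some (u n)" for n
  proof -
    obtain m where "m \<in> A" "m \<ge> n" using inf by (metis infinite_nat_iff_unbounded_le)
    hence "rat_orbit \<phi> \<alpha> n \<noteq> None" using rat_orbit_defined[of \<phi> \<alpha> m n] by (auto simp: A_def)
    thus ?thesis by (auto simp: u_def)
  qed
  have u0: "u 0 = \<alpha>" using defined[of 0] by simp
  have uG: "poly G (u n) \<noteq> 0" and uS: "u (Suc n) = poly F (u n) / poly G (u n)" for n
    using defined[of n] defined[of "Suc n"]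
    by (auto simp: rat_pole_def rat_eval_def F_def G_def split: if_splits)
  have "u i \<noteq> u j" if "i < j" for i j
  proof
    assume eq: "u i = u j"
    have "rat_orbit \<phi> (u i) (j - i) = rat_orbit \<phi> \<alpha> j" using rat_orbit_add[OF defined[of i], of "j - i"] that by simp
    hence "rat_orbit \<phi> (u i) (j - i) = Some (u i)" using defined[of j] eq by simp
    hence "rat_periodic \<phi> (u j)" unfolding rat_periodic_def using that eq by (intro exI[of _ "j - i"]) auto
    \<comment> \<open>The later index is taken because \<open>rat_preperiodic\<close> asks for
      \<open>m \<ge> 1\<close>, while \<open>i\<close> may be 0.\<close>
    hence "rat_preperiodic \<phi> \<alpha>" unfolding rat_preperiodic_def using that defined[of j] by (intro exI[of _ j]) auto
    thus False using assms(8) by blast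
  qed
  hence "inj u" by (metis injI linorder_neqE_nat)
  have algc: "algebraic (lead_coeff F / lead_coeff G)" using cK algK by (simp add: c_def)
  have "finite {n. mult_dependent (u 0) (u n)}"
    by (rule orbit_finiteness[OF cop F0 G0 algZ algc deg assms(4) nonmono1 nonmono2 uG uS \<open>inj u\<close>])
      (use assms(6,7) u0 in simp_all)
  moreover have "A \<subseteq> {n. mult_dependent (u 0) (u n)}" using defined by (auto simp: A_def u0)
  ultimately show False using inf finite_subset by blast
qed

end
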